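(* Let $K$ be a field, and let $G$ be a finite cyclic subgroup of $\mathrm{GL}_n(K)$ that contains no transvections, acting on the polynomial ring $R := K[x_1,\dots,x_n]$. Let $\mathfrak{m}$ and $\mathfrak{n}$ denote the homogeneous maximal ideals of $R$ and of the invariant ring $R^G$, respectively. Then the Hilbert series of $H^n_{\mathfrak{n}}(R^G)$ and $H^n_{\mathfrak{m}}(R)^G$ coincide, i.e., for each integer $k$, one has $$\operatorname{rank}_K\,[H^n_{\mathfrak{n}}(R^G)]_k\ =\ \operatorname{rank}_K\,[H^n_{\mathfrak{m}}(R)^G]_k.$$
   Context: The ring $R=K[x_1,\dots,x_n]$ has the standard grading. A matrix $M\in \mathrm{GL}_n(K)$ acts on $R$ by the degree-preserving $K$-algebra automorphism $X\mapsto MX$, where $X$ is the column vector $(x_1,\dots,x_n)^T$ (so $x_i\mapsto \sum_j M_{ij}x_j$). $R^G$ is the subring of elements fixed by all of $G$, with the induced grading. An element $g\in \mathrm{GL}_n(K)$ of finite order is a pseudoreflection if $g-I$ has rank one. It is a transvection if it is a pseudoreflection whose Jordan form (after extending scalars) consists of a single $2\times 2$ Jordan block with eigenvalue $1$ together with $1\times 1$ blocks with eigenvalue $1$, i.e., $g-I$ has rank one and $(g-I)^2=0$. Local cohomology modules carry their natural $\mathbb{Z}$-gradings, $[-]_k$ denotes the degree $k$ component, and $\operatorname{rank}_K$ is vector space dimension over $K$. Since $\mathfrak{n}R$ has radical $\mathfrak{m}$, one identifies $H^n_{\mathfrak{m}}(R)=H^n_{\mathfrak{n}}(R)$. For a homogeneous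 system of parameters $y_1,\dots,y_n$ of $R^G$, this module is identified with the Čech cohomology $R_{y_1\cdots y_n}/\sum_i R_{y_1\cdots\hat{y}_i\cdots y_n}$, and $g\in G$ acts by $\left[\frac{r}{y_1^d\cdots y_n^d}\right]\mapsto\left[\frac{g(r)}{y_1^d\cdots y_n^d}\right]$. $H^n_{\mathfrak{m}}(R)^G$ is the submodule of elements fixed by all of $G$. *)

theory Defs
  imports
    "HOL-Analysis.Analysis"
    "HOL-Library.Poly_Mapping"
    "HOL-Library.Extended_Nat"
    "HOL-Computational_Algebra.Fraction_Field"
    "HOL-Algebra.Elementary_Groups"
    "HOL-Algebra.AbelCoset"
    "Jordan_Normal_Form.Missing_VectorSpace"
begin

section \<open>Dimensions of vector spaces given as module records\<close>

definition field_ring :: "'k::field ring" where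
  "field_ring = \<lparr>carrier = UNIV, mult = (*), one = 1, zero = 0, add = (+)\<rparr>"

definition rank_over :: "('k::field, 'v, 'm) module_scheme \<Rightarrow> enat" where
  "rank_over V =
     (if vectorspace.fin_dim field_ring V then enat (vectorspace.dim field_ring V) else \<infinity>)"

text \<open>The fields \<open>mult\<close> and \<open>one\<close>, which the record type of modules inherits from rings,
  play no role for modules and are left unspecified.\<close>

definition quot_module :: "('k, 'v, 'm) module_scheme \<Rightarrow> 'v set \<Rightarrow> ('k, 'v set) module" where
  "quot_module V W =
     \<lparr>carrier = a_rcosets\<^bsub>V\<^esub> W, mult = undefined, one = undefined,
      zero = W, add = set_add V,
      smult = (\<lambda>c C. \<Union>x\<in>C. W +>\<^bsub>V\<^esub> (c \<odot>\<^bsub>V\<^esub> x))\<rparr>"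

section \<open>The polynomial ring and its linear group\<close>

text \<open>The variables are indexed by a finite type; its linear order is only used by the library
  to show that the polynomial ring is an integral domain.\<close>

type_synonym ('n, 'k) mpoly = "('n \<Rightarrow>\<^sub>0 nat) \<Rightarrow>\<^sub>0 'k"

definition mconst :: "'k::field \<Rightarrow> ('n, 'k) mpoly" where
  "mconst c = Poly_Mapping.single 0 c"

definition mvar :: "'n \<Rightarrow> ('n, 'k::field) mpoly" where
  "mvar i = Poly_Mapping.single (Poly_Mapping.single i 1) 1"

definition homogeneous :: "nat \<Rightarrow> ('n::finite, 'k::field) mpoly \<Rightarrow> bool" where
  "homogeneous d p \<longleftrightarrow>
     (\<forall>m\<in>Poly_Mapping.keys p. (\<Sum>i\<in>UNIV. Poly_Mapping.lookup m i) = d)"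

definition GL :: "('k::field ^ 'n ^ 'n) monoid" where
  "GL = \<lparr>carrier = {A. invertible A}, mult = (**), one = mat 1\<rparr>"

definition pseudoreflection :: "'k::field ^ 'n ^ 'n \<Rightarrow> bool" where
  "pseudoreflection g \<longleftrightarrow>
     g \<in> carrier GL \<and> (\<exists>m::nat. m > 0 \<and> g [^]\<^bsub>GL\<^esub> m = \<one>\<^bsub>GL\<^esub>) \<and> rank (g - mat 1) = 1"

definition transvection :: "'k::field ^ 'n ^ 'n \<Rightarrow> bool" where
  "transvection g \<longleftrightarrow> pseudoreflection g \<and> (g - mat 1) ** (g - mat 1) = 0"

text \<open>The \<open>K\<close>-algebra endomorphism with \<open>x\<^sub>i \<mapsto> \<Sum>\<^sub>j M\<^sub>i\<^sub>j x\<^sub>j\<close>.\<close>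

definition lin_act :: "'k::field ^ 'n ^ 'n \<Rightarrow> ('n::finite, 'k) mpoly \<Rightarrow> ('n, 'k) mpoly" where
  "lin_act M p =
     (\<Sum>m\<in>Poly_Mapping.keys p. mconst (Poly_Mapping.lookup p m) *
        (\<Prod>i\<in>UNIV. (\<Sum>j\<in>UNIV. mconst (M $ i $ j) * mvar j) ^ Poly_Mapping.lookup m i))"

definition invariants :: "('k::field ^ 'n ^ 'n) set \<Rightarrow> ('n::finite, 'k) mpoly set" where
  "invariants G = {p. \<forall>M\<in>G. lin_act M p = p}"

definition hom_max_ideal :: "('n::finite, 'k::field) mpoly set \<Rightarrow> ('n, 'k) mpoly set" where
  "hom_max_ideal A = {p \<in> A. Poly_Mapping.lookup p 0 = 0}"

text \<open>Homogeneous elements of positive degree of the graded subring \<open>A\<close>, generating an ideal of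
  \<open>A\<close> whose radical is the homogeneous maximal ideal. Their number is the number of variables,
  which is the dimension of \<open>A\<close> in the case of interest, where the polynomial ring is integral
  over \<open>A\<close>.\<close>

definition hsop :: "('n::finite, 'k::field) mpoly set \<Rightarrow> ('n \<Rightarrow> ('n, 'k) mpoly) \<Rightarrow> bool" where
  "hsop A y \<longleftrightarrow>
     (\<forall>i. y i \<in> A \<and> (\<exists>d>0. homogeneous d (y i))) \<and>
     {p \<in> A. \<exists>t::nat. p ^ t \<in> {\<Sum>i\<in>UNIV. a i * y i | a. \<forall>i. a i \<in> A}} = hom_max_ideal A"

section \<open>Top local cohomology as Cech cohomology\<close>

text \<open>All localizations are formed inside the fraction field of the polynomial ring.\<close>

definition frac_space :: "('k::field, ('n::{finite,linorder}, 'k) mpoly fract) module" where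
  "frac_space =
     \<lparr>carrier = UNIV, mult = (*), one = 1, zero = 0, add = (+),
      smult = (\<lambda>c q. Fract (mconst c) 1 * q)\<rparr>"

definition localized ::
    "('n::{finite,linorder}, 'k::field) mpoly set \<Rightarrow> ('n, 'k) mpoly \<Rightarrow> ('n, 'k) mpoly fract set" where
  "localized A f = {Fract r (f ^ d) | r d. r \<in> A}"

definition localized_deg ::
    "('n::{finite,linorder}, 'k::field) mpoly set \<Rightarrow> ('n, 'k) mpoly \<Rightarrow> int \<Rightarrow> ('n, 'k) mpoly fract set" where
  "localized_deg A f k =
     {Fract r (f ^ d) | r d e j. r \<in> A \<and> homogeneous j r \<and> homogeneous e f \<and>
        int j - int (d * e) = k}"

definition cech_prod :: "('n::{finite,linorder} \<Rightarrow> ('n, 'k::field) mpoly) \<Rightarrow> ('n, 'k) mpoly" where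
  "cech_prod y = (\<Prod>i\<in>UNIV. y i)"

definition cech_top ::
    "('n::{finite,linorder} \<Rightarrow> ('n, 'k::field) mpoly) \<Rightarrow> ('n, 'k) mpoly set \<Rightarrow>
     ('k, ('n, 'k) mpoly fract) module" where
  "cech_top y A = frac_space\<lparr>carrier := localized A (cech_prod y)\<rparr>"

definition cech_boundaries ::
    "('n::{finite,linorder} \<Rightarrow> ('n, 'k::field) mpoly) \<Rightarrow> ('n, 'k) mpoly set \<Rightarrow>
     ('n, 'k) mpoly fract set" where
  "cech_boundaries y A =
     {\<Sum>i\<in>UNIV. w i | w. \<forall>i. w i \<in> localized A (\<Prod>j\<in>UNIV - {i}. y j)}"

definition cech_class ::
    "('n::{finite,linorder} \<Rightarrow> ('n, 'k::field) mpoly) \<Rightarrow> ('n, 'k) mpoly set \<Rightarrow>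
     ('n, 'k) mpoly fract \<Rightarrow> ('n, 'k) mpoly fract set" where
  "cech_class y A u = cech_boundaries y A +>\<^bsub>cech_top y A\<^esub> u"

text \<open>For a subring \<open>A\<close> containing the \<open>y i\<close>, this is \<open>H\<^sup>n(A)\<close> with support in the ideal
  generated by the \<open>y i\<close>. For a homogeneous system of parameters \<open>y\<close> of the invariant ring
  \<open>R\<^sup>G\<close>, it is the local cohomology of \<open>R\<^sup>G\<close> at its homogeneous maximal ideal if
  \<open>A = R\<^sup>G\<close>, and that of \<open>R\<close> at its homogeneous maximal ideal if \<open>A = UNIV\<close>.\<close>

definition local_cohom ::
    "('n::{finite,linorder} \<Rightarrow> ('n, 'k::field) mpoly) \<Rightarrow> ('n, 'k) mpoly set \<Rightarrow>
     ('k, ('n, 'k) mpoly fract set) module" where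
  "local_cohom y A = quot_module (cech_top y A) (cech_boundaries y A)"

text \<open>The degree \<open>k\<close> component of a graded subspace \<open>N\<close> of \<open>local_cohom y A\<close>.\<close>

definition graded_part ::
    "('n::{finite,linorder} \<Rightarrow> ('n, 'k::field) mpoly) \<Rightarrow> ('n, 'k) mpoly set \<Rightarrow>
     ('k, ('n, 'k) mpoly fract set) module \<Rightarrow> int \<Rightarrow> ('k, ('n, 'k) mpoly fract set) module" where
  "graded_part y A N k =
     N\<lparr>carrier := carrier N \<inter> cech_class y A ` localized_deg A (cech_prod y) k\<rparr>"

text \<open>The action \<open>[r / (\<Prod>i. y i)\<^sup>d] \<mapsto> [g(r) / (\<Prod>i. y i)\<^sup>d]\<close> on \<open>H\<^sup>n(R)\<close>, well defined when
  the \<open>y i\<close> are invariant under \<open>g\<close>; the classes in the union then coincide.\<close>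

definition cohom_act ::
    "('n::{finite,linorder} \<Rightarrow> ('n, 'k::field) mpoly) \<Rightarrow> 'k ^ 'n::{finite,linorder} ^ 'n::{finite,linorder} \<Rightarrow>
     ('n, 'k) mpoly fract set \<Rightarrow> ('n, 'k) mpoly fract set" where
  "cohom_act y g C =
     (\<Union>(r, d) \<in> {(r, d). Fract r (cech_prod y ^ d) \<in> C}.
        cech_class y UNIV (Fract (lin_act g r) (cech_prod y ^ d)))"

definition local_cohom_invariants ::
    "('k::field ^ 'n::{finite,linorder} ^ 'n::{finite,linorder}) set \<Rightarrow> ('n::{finite,linorder} \<Rightarrow> ('n, 'k) mpoly) \<Rightarrow>
     ('k, ('n, 'k) mpoly fract set) module" where
  "local_cohom_invariants G y =
     (local_cohom y UNIV)\<lparr>carrier :=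
        {C \<in> carrier (local_cohom y UNIV). \<forall>g\<in>G. cohom_act y g C = C}\<rparr>"

end

theory Submission
  imports Defs
begin

text \<open>Top local cohomology is right exact, so the trace \<open>R \<rightarrow> R\<^sup>G\<close> induces a map from the
  coinvariants of \<open>H\<^sup>n(R)\<close> to \<open>H\<^sup>n(R\<^sup>G)\<close>. It is an isomorphism: this is where transvections are
  excluded. In degree \<open>k\<close> the group acts on a finite-dimensional space through powers of one
  endomorphism, so that invariants and coinvariants have the same dimension.

  Without transvections, every element \<open>g \<noteq> 1\<close> of \<open>p\<close>-power order, \<open>p = char K\<close>, has
  \<open>rank (g - 1) \<ge> 2\<close>, so
  its fixed locus has codimension at least two and the ideal of traces has height at least two. In
  elementary terms: for each \<open>i\<close>, some nonzero polynomial in the parameters \<open>y\<^sub>j\<close> with \<open>j \<noteq> i\<close> is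
  a trace. Indeed, modulo two independent linear forms the remaining \<open>n - 1\<close> parameters are
  algebraically dependent.

  The isomorphism is checked on functionals. A functional on \<open>H\<^sup>n(R)\<close> in degree \<open>k\<close> is a
  \<open>K[y]\<close>-linear map \<open>F\<close> from \<open>R\<close> to \<open>K[y]\<close>, and it vanishes on the image of \<open>g - 1\<close> iff \<open>F\<close> is
  invariant. If \<open>s = Tr s'\<close> lies in \<open>K[y]\<close>, then \<open>s F(r) = F(s' Tr r)\<close>, so \<open>F\<close> factors through the
  trace by \<open>a \<mapsto> F(s' a) / s\<close>, provided the division is exact. For a second such element
  \<open>t = Tr t'\<close> one has \<open>t F(s' a) = s F(t' a)\<close>, and traces \<open>t\<close> avoiding a prescribed variable force
  \<open>s\<close> to divide \<open>F(s' a)\<close> by a comparison of leading monomials.\<close>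

text \<open>The obstacle is that R^G need not be Cohen-Macaulay, hence need not be free over K[y],
  so its top cohomology has no evident basis. Passing to functionals with values in K[y] avoids this
  at the price of an exact division. Height two makes the division exact: a common divisor of
  polynomials of which the i-th is free of the variable i is free of every variable, hence constant.
  Being free of a prescribed variable is thus an elementary form of height two, without prime ideals
  or dimension theory.

  The part of the group of order prime to p may contain pseudoreflections and does no harm: its
  order is invertible in K, so a trace of the p-part is, up to this factor, a trace of the whole
  group. In the p-part all eigenvalues are 1, so an element g with g - 1 of rank one is a
  transvection.

  Invariants and coinvariants are the kernel and the cokernel of the single map g - 1. They are
  matched by dimension only, so the result compares Hilbert series and gives no map between the two
  modules. This is also why the graded pieces must first be shown finite-dimensional, which comes
  from the integrality of the variables over R^G.\<close>

abbreviation (input) "lookup \<equiv> Poly_Mapping.lookup"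
abbreviation (input) "keys \<equiv> Poly_Mapping.keys"
abbreviation (input) "single \<equiv> Poly_Mapping.single"

section \<open>Polynomials and substitution homomorphisms\<close>

lemma mconst_add: "mconst (a + b) = mconst a + mconst b"
  by (simp add: mconst_def single_add)

lemma mconst_mult: "mconst (a * b) = mconst a * mconst b"
  by (simp add: mconst_def mult_single)

lemma mconst_0 [simp]: "mconst 0 = 0"
  by (simp add: mconst_def)

lemma mconst_1 [simp]: "mconst 1 = 1"
  by (simp add: mconst_def)

lemma mconst_diff: "mconst (a - b) = mconst a - mconst b"
  by (simp add: mconst_def single_diff)

lemma mconst_of_nat: "mconst (of_nat k) = of_nat k"
  by (simp add: mconst_def)

lemma lookup_mconst_mult: "lookup (mconst c * p) m = c * lookup p m"
proof -
  have "mconst c * p = Poly_Mapping.map ((*) c) p"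
    by (simp add: mconst_def mult_map_scale_conv_mult)
  then show ?thesis
    by (simp add: Poly_Mapping.map.rep_eq when_def)
qed

lemma mvar_power: "mvar i ^ k = single (single i k) 1"
  by (induction k) (simp_all add: mvar_def mult_single flip: single_add)

lemma prod_single: "finite I \<Longrightarrow> (\<Prod>i\<in>I. single (f i) (1::'k::field)) = single (\<Sum>i\<in>I. f i) 1"
  by (induction I rule: finite_induct) (simp_all add: mult_single)

lemma sum_single_lookup: "(\<Sum>i\<in>UNIV. single i (lookup m i)) = (m :: 'n::finite \<Rightarrow>\<^sub>0 nat)"
  by (rule poly_mapping_eqI) (simp add: lookup_sum lookup_single when_def)

lemma single_monom:
  "single (m :: 'n::finite \<Rightarrow>\<^sub>0 nat) c = mconst c * (\<Prod>i\<in>UNIV. mvar i ^ lookup m i)"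
  by (simp add: mvar_power prod_single sum_single_lookup mconst_def mult_single)

lemma mpoly_add_induct [case_names zero single add]:
  assumes "P 0" "\<And>a b. P (single a b)" "\<And>p q. P p \<Longrightarrow> P q \<Longrightarrow> P (p + q)"
  shows "P p"
proof (induction p rule: Poly_Mapping.update_induct)
  case const
  show ?case by fact
next
  case (update f a b)
  have "Poly_Mapping.update a b f = single a b + f"
    using update.hyps(1)
    by (intro poly_mapping_eqI) (auto simp: lookup_update lookup_add lookup_single when_def in_keys_iff)
  then show ?case using assms update.IH by simp
qed

lemma mpoly_induct [case_names const var add mult]:
  fixes p :: "('n::finite, 'k::field) mpoly"
  assumes c: "\<And>c. P (mconst c)" and v: "\<And>i. P (mvar i)"
    and add: "\<And>p q. P p \<Longrightarrow> P q \<Longrightarrow> P (p + q)"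
    and mult: "\<And>p q. P p \<Longrightarrow> P q \<Longrightarrow> P (p * q)"
  shows "P p"
proof (induction p rule: mpoly_add_induct)
  case zero
  show ?case using c[of 0] by simp
next
  case (single a b)
  have 1: "P 1" using c[of 1] by simp
  have pow: "P (mvar i ^ k)" for i k
    by (induction k) (auto intro: 1 v mult)
  have "P (\<Prod>i\<in>I. mvar i ^ lookup a i)" if "finite I" for I
    using that by (induction I rule: finite_induct) (auto intro: 1 mult pow)
  then show ?case by (simp add: single_monom mult c)
next
  case (add p q)
  then show ?case by (rule assms(3))
qed

text \<open>The linear action and the evaluation of a polynomial at the parameters \<open>y\<close>
  are both instances, so the homomorphism and composition laws are shown once for both.\<close>

definition poly_subst ::
    "('m \<Rightarrow> ('n::finite, 'k::field) mpoly) \<Rightarrow> ('m::finite, 'k) mpoly \<Rightarrow> ('n, 'k) mpoly" where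
  "poly_subst f p =
     (\<Sum>m\<in>keys p. mconst (lookup p m) * (\<Prod>i\<in>UNIV. f i ^ lookup m i))"

lemma lin_act_eq: "lin_act M = poly_subst (\<lambda>i. \<Sum>j\<in>UNIV. mconst (M $ i $ j) * mvar j)"
  by (rule ext) (simp add: lin_act_def poly_subst_def)

lemma poly_subst_0 [simp]: "poly_subst f 0 = 0"
  by (simp add: poly_subst_def)

lemma poly_subst_single: "poly_subst f (single m c) = mconst c * (\<Prod>i\<in>UNIV. f i ^ lookup m i)"
  by (cases "c = 0") (simp_all add: poly_subst_def)

lemma poly_subst_add: "poly_subst f (p + q) = poly_subst f p + poly_subst f q"
  unfolding poly_subst_def
  by (rule setsum_keys_plus_distrib) (simp_all add: mconst_add distrib_right)

lemma poly_subst_mult: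
  "poly_subst f (p * q) = poly_subst f p * poly_subst f q"
proof (induction p rule: mpoly_add_induct)
  case zero
  then show ?case by simp
next
  case (single a b)
  show ?case
  proof (induction q rule: mpoly_add_induct)
    case (single c d)
    show ?case
      by (simp add: mult_single poly_subst_single mconst_mult lookup_add power_add prod.distrib
          ac_simps)
  qed (simp_all add: distrib_left poly_subst_add)
qed (simp_all add: distrib_right poly_subst_add)

lemma poly_subst_mconst [simp]: "poly_subst f (mconst c) = mconst c"
  by (simp add: mconst_def poly_subst_single)

lemma poly_subst_1 [simp]: "poly_subst f 1 = 1"
  using poly_subst_mconst[of f 1] by simp

lemma poly_subst_mvar [simp]: "poly_subst f (mvar i) = f i"
proof -
  have "poly_subst f (mvar i) = (\<Prod>j\<in>UNIV. f j ^ lookup (single i 1) j)"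
    by (simp add: mvar_def poly_subst_single)
  also have "\<dots> = (\<Prod>j\<in>UNIV. if j = i then f j else 1)"
    by (rule prod.cong) (auto simp: lookup_single when_def)
  finally show ?thesis by simp
qed

lemma poly_subst_sum: "poly_subst f (\<Sum>i\<in>I. g i) = (\<Sum>i\<in>I. poly_subst f (g i))"
  by (induction I rule: infinite_finite_induct) (simp_all add: poly_subst_add)

lemma poly_subst_prod:
  "poly_subst f (\<Prod>i\<in>I. g i) = (\<Prod>i\<in>I. poly_subst f (g i))"
  by (induction I rule: infinite_finite_induct) (simp_all add: poly_subst_mult)

lemma poly_subst_power: "poly_subst f (p ^ k) = poly_subst f p ^ k"
  by (induction k) (simp_all add: poly_subst_mult)

lemma poly_subst_poly_subst:
  fixes p :: "('n::finite, 'k::field) mpoly" and f :: "'n \<Rightarrow> ('m::finite, 'k::field) mpoly"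
  shows "poly_subst g (poly_subst f p) = poly_subst (\<lambda>i. poly_subst g (f i)) p"
  by (induction p rule: mpoly_induct) (simp_all add: poly_subst_add poly_subst_mult)

lemma poly_subst_id: "poly_subst mvar p = (p :: ('n::finite, 'k::field) mpoly)"
  by (induction p rule: mpoly_induct) (simp_all add: poly_subst_add poly_subst_mult)

section \<open>Homogeneous components\<close>

definition mdeg :: "('n::finite \<Rightarrow>\<^sub>0 nat) \<Rightarrow> nat" where
  "mdeg m = (\<Sum>i\<in>UNIV. lookup m i)"

lemma mdeg_0 [simp]: "mdeg 0 = 0"
  by (simp add: mdeg_def)

lemma mdeg_add: "mdeg (a + b) = mdeg a + mdeg b"
  by (simp add: mdeg_def lookup_add sum.distrib)

lemma mdeg_single [simp]: "mdeg (single i k) = k"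
  by (simp add: mdeg_def lookup_single when_def)

lemma lookup_le_mdeg: "lookup m i \<le> mdeg m"
  unfolding mdeg_def by (rule member_le_sum) auto

lemma homogeneous_iff: "homogeneous d p \<longleftrightarrow> (\<forall>m\<in>keys p. mdeg m = d)"
  by (simp add: homogeneous_def mdeg_def)

lemma homogeneous_0 [simp]: "homogeneous d 0"
  by (simp add: homogeneous_iff)

lemma homogeneous_single: "homogeneous (mdeg m) (single m c)"
  by (simp add: homogeneous_iff)

lemma homogeneous_mconst: "homogeneous 0 (mconst c)"
  using homogeneous_single[of 0 c] by (simp add: mconst_def)

lemma homogeneous_1: "homogeneous 0 1"
  using homogeneous_mconst[of 1] by simp

lemma homogeneous_mvar: "homogeneous 1 (mvar i)"
  using homogeneous_single[of "single i 1" 1] by (simp add: mvar_def)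

lemma homogeneous_add: "homogeneous d p \<Longrightarrow> homogeneous d q \<Longrightarrow> homogeneous d (p + q)"
  using Poly_Mapping.keys_add[of p q] by (auto simp: homogeneous_iff)

lemma homogeneous_mult:
  "homogeneous d p \<Longrightarrow> homogeneous e q \<Longrightarrow> homogeneous (d + e) (p * q)"
  using Poly_Mapping.keys_mult[of p q] by (fastforce simp: homogeneous_iff mdeg_add)

lemma homogeneous_power: "homogeneous d p \<Longrightarrow> homogeneous (k * d) (p ^ k)"
  by (induction k) (auto simp: homogeneous_1 intro: homogeneous_mult)

lemma homogeneous_sum: "(\<And>i. i \<in> I \<Longrightarrow> homogeneous d (p i)) \<Longrightarrow> homogeneous d (\<Sum>i\<in>I. p i)"
  by (induction I rule: infinite_finite_induct) (auto intro: homogeneous_add)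

lemma homogeneous_prod:
  "(\<And>i. i \<in> I \<Longrightarrow> homogeneous (d i) (p i)) \<Longrightarrow> homogeneous (\<Sum>i\<in>I. d i) (\<Prod>i\<in>I. p i)"
  by (induction I rule: infinite_finite_induct) (auto simp: homogeneous_1 intro: homogeneous_mult)

lemma homogeneous_unique: "homogeneous d p \<Longrightarrow> homogeneous e p \<Longrightarrow> p \<noteq> 0 \<Longrightarrow> d = e"
  unfolding homogeneous_iff by (metis ex_in_conv Poly_Mapping.keys_eq_empty)

text \<open>The degree is an integer because the numerator degree prescribed by \<open>k\<close> and
  a pole order can be negative; the component is then \<open>0\<close>.\<close>

lift_definition hcomp :: "int \<Rightarrow> ('n::finite, 'k::field) mpoly \<Rightarrow> ('n, 'k) mpoly"
  is "\<lambda>d p m. if int (mdeg m) = d then p m else 0"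
  by (erule rev_finite_subset) auto

lemma lookup_hcomp: "lookup (hcomp d p) m = (if int (mdeg m) = d then lookup p m else 0)"
  by transfer simp

lemma hcomp_0 [simp]: "hcomp d 0 = 0"
  by (rule poly_mapping_eqI) (simp add: lookup_hcomp)

lemma hcomp_add: "hcomp d (p + q) = hcomp d p + hcomp d q"
  by (rule poly_mapping_eqI) (simp add: lookup_hcomp lookup_add)

lemma hcomp_sum: "hcomp d (\<Sum>i\<in>I. p i) = (\<Sum>i\<in>I. hcomp d (p i))"
  by (induction I rule: infinite_finite_induct) (simp_all add: hcomp_add)

lemma homogeneous_hcomp: "homogeneous (nat d) (hcomp d p)"
  by (auto simp: homogeneous_iff in_keys_iff lookup_hcomp split: if_splits)

lemma hcomp_homogeneous: "homogeneous e p \<Longrightarrow> hcomp d p = (if int e = d then p else 0)"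
  by (rule poly_mapping_eqI) (auto simp: lookup_hcomp homogeneous_iff in_keys_iff)

lemma hcomp_neg: "d < 0 \<Longrightarrow> hcomp d p = 0"
  by (rule poly_mapping_eqI) (auto simp: lookup_hcomp)

lemma hcomp_single: "hcomp d (single m c) = (if int (mdeg m) = d then single m c else 0)"
  by (rule hcomp_homogeneous[OF homogeneous_single])

lemma hcomp_mult:
  assumes "homogeneous e q"
  shows "hcomp d (q * p) = q * hcomp (d - int e) p"
proof (induction p rule: mpoly_add_induct)
  case (single a b)
  have "homogeneous (e + mdeg a) (q * single a b)"
    by (intro homogeneous_mult assms homogeneous_single)
  then show ?case by (auto simp: hcomp_homogeneous hcomp_single)
qed (simp_all add: hcomp_add distrib_left)

lemma finite_hcomp_nonzero: "finite {d. hcomp d p \<noteq> 0}"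
proof (rule finite_subset)
  show "{d. hcomp d p \<noteq> 0} \<subseteq> (\<lambda>m. int (mdeg m)) ` keys p"
  proof safe
    fix d assume "hcomp d p \<noteq> 0"
    then obtain m where "lookup (hcomp d p) m \<noteq> 0"
      by (metis poly_mapping_eqI lookup_zero)
    then show "d \<in> (\<lambda>m. int (mdeg m)) ` keys p"
      by (auto simp: lookup_hcomp in_keys_iff split: if_splits)
  qed
qed simp

lemma hcomp_poly_subst:
  assumes "\<And>i. homogeneous 1 (f i)"
  shows "hcomp d (poly_subst f p) = poly_subst f (hcomp d (p :: ('n::finite, 'k::field) mpoly))"
proof (induction p rule: mpoly_add_induct)
  case (single a b)
  have "homogeneous (0 + (\<Sum>i\<in>UNIV. lookup a i * 1)) (mconst b * (\<Prod>i\<in>UNIV. f i ^ lookup a i))"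
    by (intro homogeneous_mult homogeneous_mconst homogeneous_prod homogeneous_power assms)
  then have "homogeneous (mdeg a) (poly_subst f (single a b))"
    by (simp add: poly_subst_single mdeg_def)
  then show ?case by (auto simp: hcomp_homogeneous hcomp_single)
qed (simp_all add: hcomp_add poly_subst_add)

lemma lookup_monom_mult:
  fixes p :: "('n::finite, 'k::field) mpoly"
  shows "lookup (single c 1 * p) m =
    (if \<forall>i. lookup c i \<le> lookup m i then lookup p (m - c) else 0)"
proof (induction p rule: mpoly_add_induct)
  case (single a b)
  show ?case
  proof (cases "\<forall>i. lookup c i \<le> lookup m i")
    case True
    then have "c + (m - c) = m"
      by (intro poly_mapping_eqI) (simp add: lookup_add lookup_minus)
    then show ?thesis
      by (auto simp: mult_single lookup_single when_def True)
  next
    case False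
    then have "c + a \<noteq> m"
      by (auto simp: lookup_add)
    then show ?thesis
      by (auto simp: mult_single lookup_single when_def False)
  qed
qed (simp_all add: distrib_left lookup_add)

section \<open>Leading monomials\<close>

abbreviation (input) lead_monom :: "('n::{finite,linorder}, 'k::field) mpoly \<Rightarrow> 'n \<Rightarrow>\<^sub>0 nat" where
  "lead_monom p \<equiv> Max (keys p)"

lemma lead_monom_in_keys: "p \<noteq> 0 \<Longrightarrow> lead_monom p \<in> keys p"
  by simp

text \<open>The order on exponents is compatible with addition. After the leading term of
  \<open>p\<close> is split off, no product of a term of the rest with a term of \<open>q\<close>
  reaches \<open>a + b\<close>, so nothing cancels there.\<close>

lemma lead_monom_mult:
  fixes p q :: "('n::{finite,linorder}, 'k::field) mpoly"
  assumes "p \<noteq> 0" "q \<noteq> 0"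
  shows "lead_monom (p * q) = lead_monom p + lead_monom q"
proof -
  define a where "a = lead_monom p"
  define b where "b = lead_monom q"
  define p' where "p' = p - single a (lookup p a)"
  have ab: "a \<in> keys p" "b \<in> keys q" "\<And>x. x \<in> keys p \<Longrightarrow> x \<le> a" "\<And>x. x \<in> keys q \<Longrightarrow> x \<le> b"
    using assms by (simp_all add: a_def b_def)
  have p': "x < a" if "x \<in> keys p'" for x
    using that ab(3)[of x]
    by (cases "x = a") (auto simp: p'_def in_keys_iff lookup_minus lookup_single when_def)
  have "a + b \<notin> keys (p' * q)"
  proof
    assume "a + b \<in> keys (p' * q)"
    then obtain x y where xy: "a + b = x + y" "x \<in> keys p'" "y \<in> keys q"
      using Poly_Mapping.keys_mult[of p' q] by auto
    then show False
      using add_less_le_mono[OF p'[OF xy(2)] ab(4)[OF xy(3)]] by simp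
  qed
  moreover have "single a (lookup p a) = mconst (lookup p a) * single a 1"
    by (simp add: mconst_def mult_single)
  then have "p * q = mconst (lookup p a) * (single a 1 * q) + p' * q"
    by (simp add: p'_def algebra_simps)
  ultimately have "lookup (p * q) (a + b) = lookup p a * lookup q b"
    by (simp add: lookup_add lookup_mconst_mult lookup_monom_mult in_keys_iff)
  then have "a + b \<in> keys (p * q)"
    using ab by (simp add: in_keys_iff)
  moreover have "x \<le> a + b" if "x \<in> keys (p * q)" for x
    using that Poly_Mapping.keys_mult[of p q] ab by (auto intro: add_mono)
  ultimately show ?thesis
    unfolding a_def b_def by (intro Max_eqI) auto
qed

text \<open>The order on exponents is lexicographic, the smallest variable counting most. Listing
  the exponents along the finitely many variables maps it into the lexicographic order on lists of
  one fixed length, which is well-founded.\<close>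

lemma wfp_less_monom: "wfp ((<) :: ('n::{finite,linorder} \<Rightarrow>\<^sub>0 nat) \<Rightarrow> _ \<Rightarrow> bool)"
proof -
  define L where "L = sorted_list_of_set (UNIV :: 'n set)"
  define v where "v m = map (lookup m) L" for m :: "'n \<Rightarrow>\<^sub>0 nat"
  have L: "sorted_wrt (<) L" "set L = UNIV"
    using strict_sorted_list_of_set[of "UNIV :: 'n set"] by (simp_all add: L_def)
  have "(v f, v g) \<in> lexn less_than (length L)" if "f < g" for f g
  proof -
    from that obtain k where k: "lookup f k < lookup g k" "\<And>k'. k' < k \<Longrightarrow> lookup f k' = lookup g k'"
      by (auto simp: less_poly_mapping.rep_eq less_fun_def)
    obtain j where j: "j < length L" "L ! j = k"
      using L(2) by (metis UNIV_I in_set_conv_nth)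
    have "take j (v f) = take j (v g)"
    proof (rule nth_equalityI)
      fix t assume "t < length (take j (v f))"
      then have "t < j" "t < length L" by (auto simp: v_def)
      moreover from this have "L ! t < k"
        using L(1) j sorted_wrt_nth_less by blast
      ultimately show "take j (v f) ! t = take j (v g) ! t"
        by (simp add: v_def k(2))
    qed (simp add: v_def)
    moreover have "v f ! j < v g ! j"
      using j k by (simp add: v_def)
    moreover have "v f = take j (v f) @ v f ! j # drop (Suc j) (v f)"
      "v g = take j (v g) @ v g ! j # drop (Suc j) (v g)"
      using j by (auto intro!: id_take_nth_drop simp del: map_eq_conv simp: v_def[of f, THEN arg_cong, of length] v_def[of g, THEN arg_cong, of length])
    moreover have "length (v f) = length L" "length (v g) = length L"
      by (simp_all add: v_def)
    ultimately show ?thesis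
      unfolding lexn_conv by (metis (mono_tags, lifting) case_prodI less_than_iff mem_Collect_eq)
  qed
  then have "{(x, y). x < y} \<subseteq> inv_image (lexn less_than (length L)) v"
    by auto
  moreover have "wf (inv_image (lexn less_than (length L)) v)"
    by (intro wf_inv_image wf_lexn) simp
  ultimately show ?thesis
    unfolding wfp_def by (rule wf_subset[rotated])
qed

text \<open>Among the remainders of \<open>f\<close> modulo \<open>s\<close>, take one with minimal leading monomial \<open>m\<close>. Some
  exponent of \<open>m\<close> is then smaller than that of the leading monomial of \<open>s\<close>, and multiplication
  by a polynomial free of that variable cannot repair this.\<close>

lemma dvd_if_dvd_mult_variable_free:
  fixes s f :: "('n::{finite,linorder}, 'k::field) mpoly"
  assumes s: "s \<noteq> 0"
    and t: "\<And>i. \<exists>t. t \<noteq> 0 \<and> (\<forall>m\<in>keys t. lookup m i = 0) \<and> s dvd t * f"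
  shows "s dvd f"
proof (rule ccontr)
  assume ndvd: "\<not> s dvd f"
  then have ne: "f - q * s \<noteq> 0" for q
    by (metis dvd_triv_right eq_iff_diff_eq_0)
  define S where "S = range (\<lambda>q. lead_monom (f - q * s))"
  obtain m where m: "m \<in> S" "\<And>x. x < m \<Longrightarrow> x \<notin> S"
    using wfp_less_monom[unfolded wfp_def, THEN wfE_min, of _ S]
    unfolding S_def by (metis (mono_tags, lifting) case_prodI mem_Collect_eq rangeI)
  then obtain q where q: "m = lead_monom (f - q * s)"
    by (auto simp: S_def)
  define r where "r = f - q * s"
  have r: "r \<noteq> 0" "m = lead_monom r"
    using ne q by (auto simp: r_def)
  define a where "a = lead_monom s"
  show False
  proof (cases "\<forall>i. lookup a i \<le> lookup m i")
    case True
    \<comment> \<open>One step of division with remainder: \<open>h * s\<close> has the same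
      coefficient at \<open>m\<close> as \<open>r\<close>, so the new remainder has a smaller
      leading monomial, against the minimality of \<open>m\<close>.\<close>
    define c where "c = lookup r m / lookup s a"
    define h where "h = mconst c * single (m - a) 1"
    have ma: "m - a + a = m"
      using True by (intro poly_mapping_eqI) (simp add: lookup_add lookup_minus)
    have la: "lookup s a \<noteq> 0"
      using s lead_monom_in_keys[OF s] by (simp add: a_def in_keys_iff)
    have mm: "m - (m - a) = a"
      by (metis ma add_diff_cancel_left')
    have "lookup (h * s) m = c * lookup s a"
      unfolding h_def mult.assoc lookup_mconst_mult lookup_monom_mult
      using True by (auto simp: mm lookup_minus)
    then have 0: "lookup (r - h * s) m = 0"
      using la by (simp add: lookup_minus c_def)
    have h0: "x = m - a" if "x \<in> keys h" for x
      using that by (auto simp: h_def in_keys_iff lookup_mconst_mult lookup_single when_def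
          split: if_splits)
    have le: "x \<le> m" if "x \<in> keys (r - h * s)" for x
    proof -
      have "x \<in> keys r \<or> x \<in> keys (h * s)"
        using that by (auto simp: in_keys_iff lookup_minus)
      then show ?thesis
      proof
        assume "x \<in> keys r"
        then show ?thesis using r by simp
      next
        assume "x \<in> keys (h * s)"
        then obtain y where "x = m - a + y" "y \<in> keys s"
          using Poly_Mapping.keys_mult[of h s] h0 by auto
        then show ?thesis
          using add_left_mono[of y a "m - a"] by (simp add: ma) (simp add: a_def)
      qed
    qed
    have eq: "f - (q + h) * s = r - h * s"
      by (simp add: r_def algebra_simps)
    have "lead_monom (r - h * s) \<in> keys (r - h * s)"
      using ne[of "q + h"] unfolding eq by (rule lead_monom_in_keys)
    then have "lead_monom (r - h * s) < m"
      using le 0 by (auto simp: in_keys_iff order.strict_iff_order simp del: Max_in)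
    moreover have "lead_monom (r - h * s) \<in> S"
      unfolding S_def eq[symmetric] by (rule rangeI)
    ultimately show False using m(2) by blast
  next
    case False
    then obtain i where i: "lookup m i < lookup a i"
      by (auto simp: not_le)
    obtain t where t: "t \<noteq> 0" "\<And>m. m \<in> keys t \<Longrightarrow> lookup m i = 0" "s dvd t * f"
      using assms(2)[of i] by auto
    have "s dvd t * r"
      unfolding r_def right_diff_distrib using t(3) by (intro dvd_diff) auto
    then obtain g where g: "t * r = s * g" by (elim dvdE)
    have "g \<noteq> 0" using g t(1) r(1) by auto
    then have "lead_monom t + m = a + lead_monom g"
      using lead_monom_mult[OF t(1) r(1)] lead_monom_mult[OF s, of g] g
      by (simp add: a_def r(2))
    then have "lookup (lead_monom t) i + lookup m i = lookup a i + lookup (lead_monom g) i"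
      by (metis lookup_add)
    then show False
      using i t(2)[OF lead_monom_in_keys[OF t(1)]] by simp
  qed
qed

section \<open>Algebraic dependence\<close>

interpretation mpoly_vs: vector_space "\<lambda>(c::'k::field) (p :: ('n::finite, 'k) mpoly). mconst c * p"
  by unfold_locales (simp_all add: mconst_add mconst_mult algebra_simps)

text \<open>The relation is indexed by \<open>M\<close> and not by the image, since different
  monomials in the \<open>y j\<close> may have equal values; such a coincidence is itself a relation
  with coefficients \<open>1\<close> and \<open>-1\<close>.\<close>

lemma (in vector_space) nontrivial_relation:
  assumes M: "finite M" and T: "finite T" "card T < card M" and v: "v ` M \<subseteq> span T"
  shows "\<exists>c. (\<exists>m\<in>M. c m \<noteq> 0) \<and> (\<Sum>m\<in>M. scale (c m) (v m)) = 0"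
proof (cases "inj_on v M")
  case True
  have "dependent (v ` M)"
    using independent_span_bound[OF T(1) _ v] T(2) card_image[OF True] by fastforce
  then obtain u where u: "\<exists>x\<in>v ` M. u x \<noteq> 0" "(\<Sum>x\<in>v ` M. scale (u x) x) = 0"
    using M by (auto simp: dependent_finite)
  then have "(\<Sum>m\<in>M. scale (u (v m)) (v m)) = 0"
    by (simp add: sum.reindex[OF True])
  with u(1) show ?thesis by (intro exI[of _ "u \<circ> v"]) auto
next
  case False
  then obtain a b where ab: "a \<in> M" "b \<in> M" "a \<noteq> b" "v a = v b"
    by (auto simp: inj_on_def)
  define c where "c m = (if m = a then 1 else if m = b then -1 else 0 :: 'a)" for m
  have "(\<Sum>m\<in>M. scale (c m) (v m)) = (\<Sum>m\<in>{a, b}. scale (c m) (v m))"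
    using M ab by (intro sum.mono_neutral_right) (auto simp: c_def)
  also have "\<dots> = 0" using ab by (simp add: c_def)
  finally show ?thesis
    using ab(1) by (intro exI[of _ c]) (auto simp: c_def)
qed

section \<open>Counting monomials with bounded exponents\<close>

definition monom_box :: "'n set \<Rightarrow> nat \<Rightarrow> ('n::finite \<Rightarrow>\<^sub>0 nat) set" where
  "monom_box I d = {m. (\<forall>i\<in>I. lookup m i \<le> d) \<and> (\<forall>i\<in>-I. lookup m i = 0)}"

lemma bij_monom_box:
  "bij_betw (\<lambda>m. restrict (lookup m) I) (monom_box I d) (PiE I (\<lambda>_. {..d}))"
proof (rule bij_betwI[where g = "\<lambda>f. Abs_poly_mapping (\<lambda>i. if i \<in> I then f i else 0)"])
  show "(\<lambda>m. restrict (lookup m) I) \<in> monom_box I d \<rightarrow> PiE I (\<lambda>_. {..d})"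
    by (auto simp: monom_box_def)
  show "(\<lambda>f. Abs_poly_mapping (\<lambda>i. if i \<in> I then f i else 0)) \<in> PiE I (\<lambda>_. {..d}) \<rightarrow> monom_box I d"
    by (auto simp: monom_box_def PiE_def Pi_def)
  show "Abs_poly_mapping (\<lambda>i. if i \<in> I then restrict (lookup m) I i else 0) = m"
    if "m \<in> monom_box I d" for m
    using that by (intro poly_mapping_eqI) (auto simp: monom_box_def)
  show "restrict (lookup (Abs_poly_mapping (\<lambda>i. if i \<in> I then f i else 0))) I = f"
    if "f \<in> PiE I (\<lambda>_. {..d})" for f
    using that by (auto simp: fun_eq_iff PiE_def extensional_def)
qed

lemma finite_monom_box: "finite (monom_box I d)"
  using bij_betw_finite[OF bij_monom_box[of I d]] by (simp add: finite_PiE)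

lemma card_monom_box: "card (monom_box I d) = (d + 1) ^ card I"
  using bij_betw_same_card[OF bij_monom_box[of I d]] by (simp add: card_PiE)

text \<open>The numerical core of the dependence argument: monomials in \<open>k\<close> variables,
  even with exponents stretched by the constant \<open>c\<close>, are eventually fewer than those in
  \<open>k + 1\<close> variables.\<close>

lemma power_growth:
  fixes c k :: nat
  assumes "c > 0"
  shows "\<exists>D. (c * D + 1) ^ k < (D + 1) ^ Suc k"
proof -
  define D where "D = c ^ k"
  have "(c * D + 1) ^ k \<le> (c * (D + 1)) ^ k"
    using assms by (intro power_mono) auto
  also have "\<dots> = c ^ k * (D + 1) ^ k"
    by (rule power_mult_distrib)
  also have "\<dots> < (D + 1) * (D + 1) ^ k"
    by (intro mult_strict_right_mono) (auto simp: D_def)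
  finally show ?thesis by auto
qed

lemma mpoly_in_span_monoms:
  "p \<in> mpoly_vs.span ((\<lambda>m. single m 1) ` keys (p :: ('n::finite, 'k::field) mpoly))"
proof -
  have "p = (\<Sum>m\<in>keys p. mconst (lookup p m) * single m 1)"
    by (rule poly_mapping_eqI)
      (simp add: lookup_sum lookup_mconst_mult lookup_single when_def in_keys_iff if_distrib cong: if_cong)
  also have "\<dots> \<in> mpoly_vs.span ((\<lambda>m. single m 1) ` keys p)"
    by (intro mpoly_vs.span_sum mpoly_vs.span_scale mpoly_vs.span_base imageI)
  finally show ?thesis .
qed

text \<open>The total degree adds under multiplication, which bounds the exponents in any monomial
  in the \<open>y j\<close>.\<close>

definition free_of :: "'n set \<Rightarrow> nat \<Rightarrow> ('n::finite, 'k::field) mpoly set" where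
  "free_of J d = {p. \<forall>m\<in>keys p. (\<forall>j\<in>J. lookup m j = 0) \<and> mdeg m \<le> d}"

lemma free_of_mult: "p \<in> free_of J d \<Longrightarrow> q \<in> free_of J e \<Longrightarrow> p * q \<in> free_of J (d + e)"
  using Poly_Mapping.keys_mult[of p q]
  by (fastforce simp: free_of_def mdeg_add lookup_add intro: add_mono)

lemma free_of_1: "1 \<in> free_of J d"
  by (simp add: free_of_def)

lemma free_of_power: "p \<in> free_of J d \<Longrightarrow> p ^ k \<in> free_of J (k * d)"
  by (induction k) (auto simp: free_of_1 intro: free_of_mult)

lemma free_of_prod:
  "finite I \<Longrightarrow> (\<And>i. i \<in> I \<Longrightarrow> p i \<in> free_of J (d i)) \<Longrightarrow> (\<Prod>i\<in>I. p i) \<in> free_of J (\<Sum>i\<in>I. d i)"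
  by (induction I rule: finite_induct) (auto simp: free_of_1 intro: free_of_mult)

text \<open>With \<open>n\<close> variables in all, the \<open>n - 1\<close> polynomials
  \<open>y j\<close>, \<open>j \<noteq> i\<close>, live in \<open>n - 2\<close> variables. Their
  \<open>(D + 1) ^ (n - 1)\<close> monomials with exponents up to \<open>D\<close> lie in a space
  spanned by \<open>(n * e * D + 1) ^ (n - 2)\<close> monomials, so for large \<open>D\<close> they
  are linearly dependent.\<close>

lemma algebraic_relation:
  fixes y :: "'n::finite \<Rightarrow> ('n, 'k::field) mpoly"
  assumes ab: "a \<noteq> b" and y: "\<And>j m. m \<in> keys (y j) \<Longrightarrow> lookup m a = 0 \<and> lookup m b = 0"
  shows "\<exists>t. t \<noteq> 0 \<and> (\<forall>m\<in>keys t. lookup m i = 0) \<and> poly_subst y t = 0"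
proof -
  \<comment> \<open>A common degree bound; the successor keeps it positive, as
    \<open>power_growth\<close> requires of the factor \<open>n * e\<close>.\<close>
  define e where "e = Suc (Max (mdeg ` (\<Union>j. keys (y j)) \<union> {0}))"
  have "mdeg m \<le> e" if "m \<in> keys (y j)" for m j
    unfolding e_def using that by (intro le_SucI Max_ge) auto
  then have ye: "y j \<in> free_of {a, b} e" for j
    using y by (auto simp: free_of_def)
  have ym: "(\<Prod>j\<in>UNIV. y j ^ lookup m j) \<in> free_of {a, b} (mdeg m * e)" for m
    using free_of_prod[of UNIV "\<lambda>j. y j ^ lookup m j" "{a, b}" "\<lambda>j. lookup m j * e"]
      free_of_power[OF ye] by (simp add: mdeg_def sum_distrib_right)
  define n where "n = CARD('n)"
  define I where "I = UNIV - {i}"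
  define J where "J = UNIV - {a, b}"
  have n: "card I = Suc (n - 2)" "card J = n - 2"
  proof -
    have "card {a, b} \<le> n"
      unfolding n_def by (intro card_mono) auto
    then have "2 \<le> n" using ab by simp
    then show "card I = Suc (n - 2)"
      by (simp add: I_def card_Diff_singleton n_def[symmetric])
    show "card J = n - 2"
      using ab by (simp add: J_def card_Diff_subset n_def)
  qed
  obtain D where D: "(n * e * D + 1) ^ (n - 2) < (D + 1) ^ Suc (n - 2)"
    using power_growth[of "n * e" "n - 2"] by (auto simp: n_def e_def)
  define M where "M = monom_box I D"
  define N where "N = monom_box J (n * e * D)"
  define T where "T = (\<lambda>m. single m (1::'k)) ` N"
  define v where "v m = (\<Prod>j\<in>UNIV. y j ^ lookup m j)" for m
  have fin: "finite M" "finite N"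
    by (auto simp: M_def N_def finite_monom_box)
  have "card T \<le> card N"
    unfolding T_def by (rule card_image_le[OF fin(2)])
  also have "\<dots> < card M"
    using D by (simp add: M_def N_def card_monom_box n)
  finally have card: "card T < card M" .
  have "v m \<in> mpoly_vs.span T" if m: "m \<in> M" for m
  proof -
    have le: "lookup m j \<le> D" for j
      using m by (cases "j \<in> I") (auto simp: M_def monom_box_def)
    have "mdeg m \<le> n * D"
      unfolding mdeg_def n_def using sum_bounded_above[of UNIV "lookup m" D] le by simp
    then have "mdeg m * e \<le> n * e * D"
      by (metis mult.assoc mult.commute mult_le_mono1)
    then have "lookup x a = 0" "lookup x b = 0" "lookup x j \<le> n * e * D"
      if "x \<in> keys (v m)" for x j
      using ym[of m] that lookup_le_mdeg[of x j]
      unfolding v_def free_of_def by (blast intro: order_trans)+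
    then have "keys (v m) \<subseteq> N"
      by (auto simp: N_def monom_box_def J_def)
    then show ?thesis
      using mpoly_in_span_monoms[of "v m"] mpoly_vs.span_mono[of "(\<lambda>m. single m 1) ` keys (v m)" T]
      by (auto simp: T_def)
  qed
  then obtain c where c: "\<exists>m\<in>M. c m \<noteq> 0" "(\<Sum>m\<in>M. mconst (c m) * v m) = 0"
    using mpoly_vs.nontrivial_relation[OF fin(1) _ card, of v] fin(2)
    by (force simp: T_def)
  define t where "t = (\<Sum>m\<in>M. single m (c m))"
  have t: "lookup t m = (if m \<in> M then c m else 0)" for m
    using fin by (simp add: t_def lookup_sum lookup_single when_def)
  have "t \<noteq> 0"
    using c(1) t by (metis lookup_zero)
  moreover have "\<forall>m\<in>keys t. lookup m i = 0"
    by (auto simp: in_keys_iff t M_def monom_box_def I_def split: if_splits)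
  moreover have "poly_subst y t = 0"
    using c(2) by (simp add: t_def poly_subst_sum poly_subst_single v_def)
  ultimately show ?thesis by blast
qed

lemma free_of_variables_subst:
  fixes p :: "('n::finite, 'k::field) mpoly"
  assumes "\<And>j m. m \<in> keys (s j) \<Longrightarrow> \<forall>a\<in>J. lookup m a = 0"
  shows "m \<in> keys (poly_subst s p) \<Longrightarrow> \<forall>a\<in>J. lookup m a = 0"
proof (induction p arbitrary: m rule: mpoly_induct)
  case (const c)
  have "poly_subst s (mconst c) = single 0 c"
    by (simp add: mconst_def poly_subst_single)
  with const show ?case by (auto split: if_splits)
next
  case (var i)
  then show ?case using assms by simp
next
  case (add p q)
  then show ?case using Poly_Mapping.keys_add[of "poly_subst s p" "poly_subst s q"]
    by (auto simp: poly_subst_add)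
next
  case (mult p q)
  then show ?case using Poly_Mapping.keys_mult[of "poly_subst s p" "poly_subst s q"]
    by (fastforce simp: poly_subst_mult lookup_add)
qed

text \<open>A nonzero minor allows \<open>l1 = l2 = 0\<close> to be solved for the variables
  \<open>a\<close> and \<open>b\<close>. The resulting substitution \<open>s\<close> removes these
  two variables and changes a polynomial only by an element of the ideal of \<open>l1\<close> and
  \<open>l2\<close>, so a relation between the \<open>poly_subst s (y j)\<close> is a relation
  between the \<open>y j\<close> modulo that ideal.\<close>

lemma algebraic_relation_mod_linear_forms:
  fixes y :: "'n::finite \<Rightarrow> ('n, 'k::field) mpoly" and u v :: "'n \<Rightarrow> 'k"
  defines "l1 \<equiv> (\<Sum>j\<in>UNIV. mconst (u j) * mvar j)" and "l2 \<equiv> (\<Sum>j\<in>UNIV. mconst (v j) * mvar j)"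
  assumes minor: "u a * v b - u b * v a \<noteq> 0"
  shows "\<exists>t \<alpha> \<beta>. t \<noteq> 0 \<and> (\<forall>m\<in>keys t. lookup m i = 0) \<and> poly_subst y t = \<alpha> * l1 + \<beta> * l2"
proof -
  define d where "d = u a * v b - u b * v a"
  have d: "d \<noteq> 0" using minor by (simp add: d_def)
  have ab: "a \<noteq> b" using minor by auto
  \<comment> \<open>Cramer's rule: \<open>ea\<close> and \<open>eb\<close> span the same space as
    \<open>u\<close> and \<open>v\<close>, and their coefficients at \<open>a\<close>,
    \<open>b\<close> form the identity matrix.\<close>
  define ea where "ea j = (v b * u j - u b * v j) / d" for j
  define eb where "eb j = (u a * v j - v a * u j) / d" for j
  define s where "s j = (if j = a then mvar a - (\<Sum>j\<in>UNIV. mconst (ea j) * mvar j)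
     else if j = b then mvar b - (\<Sum>j\<in>UNIV. mconst (eb j) * mvar j) else mvar j)" for j
  have e: "ea a = 1" "ea b = 0" "eb a = 0" "eb b = 1"
    using d by (simp_all add: ea_def eb_def d_def algebra_simps)
  have lk_mvar: "lookup (mvar j) m = (if m = single j 1 then 1 else 0)" for j :: 'n and m
    by (auto simp: mvar_def lookup_single when_def)
  have lk_sum: "lookup (\<Sum>j\<in>UNIV. mconst (f j) * mvar j) m = (\<Sum>j\<in>UNIV. if m = single j 1 then f j else 0)"
    for f :: "'n \<Rightarrow> 'k" and m
    by (simp add: lookup_sum lookup_mconst_mult lk_mvar if_distrib cong: if_cong)
  have single_eq: "single j (1::nat) = single j' 1 \<longleftrightarrow> j = j'" for j j' :: 'n
    by (metis lookup_single_eq lookup_single_not_eq one_neq_zero)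
  have lk_single: "lookup (\<Sum>j\<in>UNIV. mconst (f j) * mvar j) (single j' 1) = f j'"
    for f :: "'n \<Rightarrow> 'k" and j'
    unfolding lk_sum single_eq by simp
  have key_single: "\<exists>j. m = single j 1" if "lookup (\<Sum>j\<in>UNIV. mconst (f j) * mvar j) m \<noteq> 0"
    for f :: "'n \<Rightarrow> 'k" and m
  proof (rule ccontr)
    assume "\<nexists>j. m = single j 1"
    then have "(\<Sum>j\<in>UNIV. if m = single j 1 then f j else 0) = 0"
      by (intro sum.neutral) auto
    with that show False unfolding lk_sum by simp
  qed
  have s_free: "lookup m c = 0" if m: "m \<in> keys (s j)" and c: "c \<in> {a, b}" for j m c
  proof -
    have "\<exists>j. m = single j 1"
    proof (rule ccontr)
      assume "\<nexists>j. m = single j 1"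
      then have "lookup (s j) m = 0"
        using key_single[of _ m] by (auto simp: s_def lookup_minus lk_mvar)
      with m show False by (simp add: in_keys_iff)
    qed
    then obtain j' where j': "m = single j' 1" by blast
    have "lookup (s j) (single a 1) = 0" "lookup (s j) (single b 1) = 0"
      using ab by (cases "j = a"; cases "j = b";
          simp add: s_def lookup_minus lk_single lk_mvar single_eq e del: One_nat_def)+
    then have "j' \<notin> {a, b}" using m by (auto simp: j' in_keys_iff)
    then show ?thesis using c by (auto simp: j' lookup_single when_def)
  qed
  have lin: "(\<Sum>j\<in>UNIV. mconst (c1 * u j + c2 * v j) * mvar j) = mconst c1 * l1 + mconst c2 * l2" for c1 c2
    by (simp add: l1_def l2_def mconst_add mconst_mult sum.distrib sum_distrib_left algebra_simps)
  have ea': "ea = (\<lambda>j. v b / d * u j + (- u b / d) * v j)"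
    and eb': "eb = (\<lambda>j. (- v a / d) * u j + u a / d * v j)"
    by (simp_all add: ea_def eb_def fun_eq_iff diff_divide_distrib)
  have lin_e: "(\<Sum>j\<in>UNIV. mconst (ea j) * mvar j) = mconst (v b / d) * l1 + mconst (- u b / d) * l2"
    "(\<Sum>j\<in>UNIV. mconst (eb j) * mvar j) = mconst (- v a / d) * l1 + mconst (u a / d) * l2"
    by (simp_all only: ea' eb' lin)
  have s_eq: "\<exists>\<alpha> \<beta>. mvar j - s j = \<alpha> * l1 + \<beta> * l2" for j
  proof (cases "j = a \<or> j = b")
    case True
    then have "mvar j - s j = (\<Sum>j\<in>UNIV. mconst (ea j) * mvar j) \<or>
        mvar j - s j = (\<Sum>j\<in>UNIV. mconst (eb j) * mvar j)"
      by (auto simp: s_def)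
    then show ?thesis unfolding lin_e by blast
  next
    case False
    then show ?thesis by (auto simp: s_def intro!: exI[of _ 0])
  qed
  \<comment> \<open>The identity and the substitution \<open>s\<close> agree modulo
    \<open>l1\<close>, \<open>l2\<close> on the variables, and both are ring homomorphisms.\<close>
  have s_ideal: "\<exists>\<alpha> \<beta>. p - poly_subst s p = \<alpha> * l1 + \<beta> * l2" for p
  proof (induction p rule: mpoly_induct)
    case (const c)
    show ?case by (auto intro!: exI[of _ 0])
  next
    case (var j)
    show ?case using s_eq by simp
  next
    case (add p q)
    then obtain \<alpha> \<beta> \<alpha>' \<beta>' where *: "p - poly_subst s p = \<alpha> * l1 + \<beta> * l2"
      "q - poly_subst s q = \<alpha>' * l1 + \<beta>' * l2" by blast
    have "(p + q) - poly_subst s (p + q) = (p - poly_subst s p) + (q - poly_subst s q)"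
      by (simp add: poly_subst_add)
    also have "\<dots> = (\<alpha> + \<alpha>') * l1 + (\<beta> + \<beta>') * l2"
      unfolding * by (simp add: algebra_simps)
    finally show ?case by blast
  next
    case (mult p q)
    then obtain \<alpha> \<beta> \<alpha>' \<beta>' where *: "p - poly_subst s p = \<alpha> * l1 + \<beta> * l2"
      "q - poly_subst s q = \<alpha>' * l1 + \<beta>' * l2" by blast
    have "p * q - poly_subst s (p * q) =
        p * (q - poly_subst s q) + (p - poly_subst s p) * poly_subst s q"
      by (simp add: poly_subst_mult algebra_simps)
    also have "\<dots> = (p * \<alpha>' + \<alpha> * poly_subst s q) * l1 + (p * \<beta>' + \<beta> * poly_subst s q) * l2"
      unfolding * by (simp add: algebra_simps)
    finally show ?case by blast
  qed
  have s_free': "\<forall>c\<in>{a, b}. lookup m c = 0" if "m \<in> keys (s j)" for m j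
    using s_free[OF that] by simp
  have free: "\<forall>c\<in>{a, b}. lookup m c = 0" if "m \<in> keys (poly_subst s p)" for m p
    using free_of_variables_subst[of s "{a, b}" m p, OF s_free' that] .
  have "lookup m a = 0 \<and> lookup m b = 0" if "m \<in> keys (poly_subst s (y j))" for m j
    using free[OF that] by simp
  then have "\<exists>t. t \<noteq> 0 \<and> (\<forall>m\<in>keys t. lookup m i = 0) \<and>
      poly_subst (\<lambda>j. poly_subst s (y j)) t = 0"
    by (rule algebraic_relation[OF ab])
  then obtain t where t: "t \<noteq> 0" "\<forall>m\<in>keys t. lookup m i = 0"
    "poly_subst (\<lambda>j. poly_subst s (y j)) t = 0"
    by blast
  moreover obtain \<alpha> \<beta> where "poly_subst y t - poly_subst s (poly_subst y t) = \<alpha> * l1 + \<beta> * l2"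
    using s_ideal by blast
  ultimately have "poly_subst y t = \<alpha> * l1 + \<beta> * l2"
    by (simp add: poly_subst_poly_subst)
  with t show ?thesis by blast
qed

section \<open>Traces of a cyclic group of ring automorphisms\<close>

text \<open>Instantiated by the action on polynomials, by a power of it that generates the p-part,
  and by the extension to the fraction field. The number \<open>q\<close> need only be a multiple of
  the order, so \<open>tr\<close> and \<open>norm_prod\<close> count with multiplicity.\<close>

locale finite_order_endo =
  fixes f :: "'a::idom \<Rightarrow> 'a" and q :: nat
  assumes add: "f (x + y) = f x + f y" and mult: "f (x * y) = f x * f y" and one: "f 1 = 1"
    and q: "q > 0" and order: "(f ^^ q) x = x"
begin

definition tr :: "'a \<Rightarrow> 'a" where
  "tr x = (\<Sum>l<q. (f ^^ l) x)"

definition norm_prod :: "'a \<Rightarrow> 'a" where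
  "norm_prod x = (\<Prod>l<q. (f ^^ l) x)"

lemma zero: "f 0 = 0"
  by (metis add add.right_neutral add_left_cancel)

lemma uminus: "f (- x) = - f x"
  using add[of x "- x"] by (simp add: zero add_eq_0_iff)

lemma diff: "f (x - y) = f x - f y"
  using add[of x "- y"] by (simp add: uminus)

lemma pow_add: "(f ^^ l) (x + y) = (f ^^ l) x + (f ^^ l) y"
  by (induction l) (simp_all add: add)

lemma pow_mult: "(f ^^ l) (x * y) = (f ^^ l) x * (f ^^ l) y"
  by (induction l) (simp_all add: mult)

lemma pow_zero: "(f ^^ l) 0 = 0"
  by (induction l) (simp_all add: zero)

lemma pow_one: "(f ^^ l) 1 = 1"
  by (induction l) (simp_all add: one)

lemma pow_fixed: "f x = x \<Longrightarrow> (f ^^ l) x = x"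
  by (induction l) simp_all

lemma sum: "f (\<Sum>i\<in>I. g i) = (\<Sum>i\<in>I. f (g i))"
  by (induction I rule: infinite_finite_induct) (simp_all add: add zero)

lemma prod: "f (\<Prod>i\<in>I. g i) = (\<Prod>i\<in>I. f (g i))"
  by (induction I rule: infinite_finite_induct) (simp_all add: mult one)

lemma f_tr: "f (tr x) = tr x"
proof -
  have "x + f (tr x) = (\<Sum>l<Suc q. (f ^^ l) x)"
    by (simp add: tr_def sum sum.lessThan_Suc_shift del: sum.lessThan_Suc)
  also have "\<dots> = x + tr x"
    by (simp add: tr_def order)
  finally show ?thesis by simp
qed

text \<open>As for the trace, applying \<open>f\<close> shifts the factors cyclically. The
  comparison cancels \<open>x\<close>, which is why \<open>x = 0\<close> is treated apart.\<close>

lemma f_norm_prod: "f (norm_prod x) = norm_prod x"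
proof (cases "x = 0")
  case True
  have "norm_prod 0 = 0"
    using q by (auto simp: norm_prod_def pow_zero)
  then show ?thesis using True zero by simp
next
  case False
  have "x * f (norm_prod x) = (\<Prod>l<Suc q. (f ^^ l) x)"
    by (simp add: norm_prod_def prod prod.lessThan_Suc_shift del: prod.lessThan_Suc)
  also have "\<dots> = x * norm_prod x"
    by (simp add: norm_prod_def order)
  finally show ?thesis using False by simp
qed

lemma tr_zero: "tr 0 = 0"
  by (simp add: tr_def pow_zero)

lemma tr_add: "tr (x + y) = tr x + tr y"
  by (simp add: tr_def pow_add sum.distrib)

lemma tr_mult_fixed: "f s = s \<Longrightarrow> tr (x * s) = tr x * s"
  by (simp add: tr_def pow_mult pow_fixed sum_distrib_right)

text \<open>Modulo \<open>t = tr b\<close> the norm of \<open>a * t + v\<close> is the norm of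
  \<open>v\<close>, so both differ by some \<open>t * s\<close>. Norms and traces are fixed by
  \<open>f\<close>, hence so is \<open>t * s\<close>, and cancelling a nonzero \<open>t\<close>
  shows that \<open>s\<close> is fixed. Then \<open>t * s = tr (b * s)\<close> is again a
  trace.\<close>

lemma norm_prod_trace:
  "\<exists>c. norm_prod (\<Sum>(a, b)\<leftarrow>xs. a * tr b) = tr c"
proof (induction xs)
  case Nil
  have "norm_prod 0 = tr 0"
    using q by (auto simp: norm_prod_def pow_zero tr_zero)
  then show ?case by auto
next
  case (Cons ab xs)
  obtain a b where ab: "ab = (a, b)" by force
  define t where "t = tr b"
  define v where "v = (\<Sum>(a, b)\<leftarrow>xs. a * tr b)"
  obtain c where c: "norm_prod v = tr c"
    using Cons.IH by (auto simp: v_def)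
  have "norm_prod (a * t + v) = (\<Prod>l<q. (f ^^ l) a * t + (f ^^ l) v)"
    by (simp add: norm_prod_def pow_add pow_mult pow_fixed f_tr t_def)
  moreover have "t dvd (\<Prod>l\<in>L. g l * t + h l) - (\<Prod>l\<in>L. h l)" if "finite L" for L :: "nat set" and g h
    using that
  proof (induction L rule: finite_induct)
    case (insert l L)
    define A where "A = (\<Prod>l\<in>L. g l * t + h l)"
    define B where "B = (\<Prod>l\<in>L. h l)"
    have "(\<Prod>l\<in>insert l L. g l * t + h l) - (\<Prod>l\<in>insert l L. h l) = (g l * t + h l) * A - h l * B"
      using insert.hyps by (simp add: A_def B_def)
    also have "\<dots> = t * (g l * A) + h l * (A - B)"
      by (simp add: algebra_simps)
    finally show ?case
      using insert.IH by (simp add: A_def B_def)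
  qed simp
  from this[of "{..<q}" "\<lambda>l. (f ^^ l) a" "\<lambda>l. (f ^^ l) v"]
  obtain s where "(\<Prod>l<q. (f ^^ l) a * t + (f ^^ l) v) - norm_prod v = t * s"
    by (auto simp: norm_prod_def elim: dvdE)
  ultimately have s: "norm_prod (a * t + v) = tr c + t * s"
    by (simp add: c diff_eq_eq add.commute)
  have eq: "(\<Sum>(a, b)\<leftarrow>ab # xs. a * tr b) = a * t + v"
    by (simp add: ab t_def v_def)
  show ?case
  proof (cases "t = 0")
    case True
    then show ?thesis using s unfolding eq by auto
  next
    case False
    have "tr c + t * s = f (tr c + t * s)"
      using f_norm_prod[of "a * t + v"] s by simp
    also have "\<dots> = tr c + t * f s"
      by (simp add: add mult f_tr t_def)
    finally have "f s = s" using False by simp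
    then have "tr (c + b * s) = norm_prod (a * t + v)"
      unfolding s by (simp add: tr_add tr_mult_fixed t_def)
    then show ?thesis unfolding eq by (intro exI[of _ "c + b * s"]) simp
  qed
qed

lemma pow_trace_of_combination:
  assumes "f w = w" "w = (\<Sum>(a, b)\<leftarrow>xs. a * tr b)"
  shows "\<exists>c. w ^ q = tr c"
proof -
  have "norm_prod w = w ^ q"
    using assms(1) by (simp add: norm_prod_def pow_fixed)
  then show ?thesis using norm_prod_trace[of xs] assms(2) by auto
qed

text \<open>The image of the tensor square of the ring in the functions of the exponent
  \<open>l\<close>, an elementary tensor of \<open>a\<close> and \<open>b\<close> giving
  \<open>a * (f ^^ l) b\<close>. These functions form a ring, and summing one of them over
  \<open>l < q\<close> gives an element of the ideal generated by the traces.\<close>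

definition bilinear_values :: "(nat \<Rightarrow> 'a) \<Rightarrow> bool" where
  "bilinear_values \<phi> \<longleftrightarrow> (\<exists>xs. \<forall>l. \<phi> l = (\<Sum>(a, b)\<leftarrow>xs. a * (f ^^ l) b))"

lemma bilinear_values_mult:
  assumes "bilinear_values \<phi>" "bilinear_values \<psi>"
  shows "bilinear_values (\<lambda>l. \<phi> l * \<psi> l)"
proof -
  obtain xs ys where
    x: "\<And>l. \<phi> l = (\<Sum>(a, b)\<leftarrow>xs. a * (f ^^ l) b)" and y: "\<And>l. \<psi> l = (\<Sum>(a, b)\<leftarrow>ys. a * (f ^^ l) b)"
    using assms by (auto simp: bilinear_values_def)
  define zs where "zs = concat (map (\<lambda>(a, b). map (\<lambda>(c, d). (a * c, b * d)) ys) xs)"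
  have "\<phi> l * \<psi> l = (\<Sum>(a, b)\<leftarrow>zs. a * (f ^^ l) b)" for l
  proof -
    have "(\<Sum>(c, d)\<leftarrow>map (\<lambda>(c, d). (a * c, b * d)) ys. c * (f ^^ l) d) = a * (f ^^ l) b * \<psi> l" for a b
      unfolding y by (induction ys) (auto simp: pow_mult algebra_simps)
    then show ?thesis
      unfolding x zs_def by (induction xs) (auto simp: algebra_simps)
  qed
  then show ?thesis unfolding bilinear_values_def by blast
qed

lemma bilinear_values_one: "bilinear_values (\<lambda>l. 1)"
  unfolding bilinear_values_def by (rule exI[of _ "[(1, 1)]"]) (simp add: pow_one)

lemma bilinear_values_prod:
  "finite L \<Longrightarrow> (\<And>g. g \<in> L \<Longrightarrow> bilinear_values (\<phi> g)) \<Longrightarrow> bilinear_values (\<lambda>l. \<Prod>g\<in>L. \<phi> g l)"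
  by (induction L rule: finite_induct) (auto intro: bilinear_values_mult bilinear_values_one)

text \<open>The product of the functions \<open>l \<mapsto> \<alpha> g * (f\<^sup>g z - f\<^sup>l z) + \<beta> g * (f\<^sup>g z' - f\<^sup>l z')\<close> vanishes
  for \<open>0 < l < q\<close> and equals \<open>w\<close> for \<open>l = 0\<close>, so summing over \<open>l\<close> puts \<open>w\<close> into the ideal
  generated by the traces; the norm then moves a power of \<open>w\<close> into the traces themselves.\<close>

lemma pow_is_trace:
  assumes w: "w = (\<Prod>g\<in>{1..<q}. \<alpha> g * ((f ^^ g) (z g) - z g) + \<beta> g * ((f ^^ g) (z' g) - z' g))"
    and fixed: "f w = w"
  shows "\<exists>c. w ^ q = tr c"
proof -
  define \<phi> where "\<phi> g l = \<alpha> g * ((f ^^ g) (z g) - (f ^^ l) (z g)) +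
    \<beta> g * ((f ^^ g) (z' g) - (f ^^ l) (z' g))" for g l
  have "bilinear_values (\<phi> g)" for g
    unfolding bilinear_values_def \<phi>_def
    by (rule exI[of _ "[(\<alpha> g * (f ^^ g) (z g) + \<beta> g * (f ^^ g) (z' g), 1), (- \<alpha> g, z g), (- \<beta> g, z' g)]"])
      (simp add: pow_one algebra_simps)
  then have "bilinear_values (\<lambda>l. \<Prod>g\<in>{1..<q}. \<phi> g l)"
    by (intro bilinear_values_prod) auto
  then obtain xs where xs: "\<And>l. (\<Prod>g\<in>{1..<q}. \<phi> g l) = (\<Sum>(a, b)\<leftarrow>xs. a * (f ^^ l) b)"
    by (auto simp: bilinear_values_def)
  have "(\<Prod>g\<in>{1..<q}. \<phi> g l) = (if l = 0 then w else 0)" if "l < q" for l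
  proof (cases "l = 0")
    case True
    then show ?thesis by (simp add: w \<phi>_def)
  next
    case False
    then have "\<phi> l l = 0" "l \<in> {1..<q}" using that by (auto simp: \<phi>_def)
    then show ?thesis using False by (auto intro: prod_zero)
  qed
  then have "w = (\<Sum>l<q. \<Sum>(a, b)\<leftarrow>xs. a * (f ^^ l) b)"
    using q by (simp flip: xs)
  also have "\<dots> = (\<Sum>(a, b)\<leftarrow>xs. a * tr b)"
    by (induction xs) (auto simp: sum.distrib tr_def sum_distrib_left)
  finally show ?thesis
    using pow_trace_of_combination fixed by blast
qed

end

section \<open>From the trace of a subgroup to the trace of the whole cyclic group\<close>

lemma sum_lessThan_mult:
  fixes m q :: nat
  shows "(\<Sum>i<m * q. g i) = (\<Sum>j<m. \<Sum>l<q. g (j + m * l) :: 'a::comm_monoid_add)"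
proof (induction q)
  case (Suc q)
  have "{..<m * Suc q} = {..<m * q} \<union> {m * q..<m * q + m}"
    by auto
  then have "(\<Sum>i<m * Suc q. g i) = (\<Sum>i<m * q. g i) + (\<Sum>i\<in>{m * q..<m * q + m}. g i)"
    by (simp add: sum.union_disjoint ivl_disj_int)
  also have "(\<Sum>i\<in>{m * q..<m * q + m}. g i) = (\<Sum>j<m. g (j + m * q))"
    using sum.shift_bounds_nat_ivl[of g 0 "m * q" m] by (simp add: add.commute atLeast0LessThan)
  finally show ?case
    by (simp add: Suc.IH sum.distrib)
qed simp

text \<open>Transitivity of the trace: with exponents written as \<open>j + m * l\<close>, the inner
  sum is the subgroup trace \<open>w\<close>, and each of the \<open>m\<close> cosets contributes
  \<open>w\<close> once more because \<open>w\<close> is fixed by \<open>f\<close>.\<close>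

lemma full_trace_of_subgroup_trace:
  fixes f :: "'a::comm_ring_1 \<Rightarrow> 'a"
  assumes add: "\<And>x y. f (x + y) = f x + f y" and fixed: "f w = w"
    and w: "w = (\<Sum>l<q. ((f ^^ m) ^^ l) c)"
  shows "(\<Sum>i<m * q. (f ^^ i) c) = of_nat m * w"
proof -
  have zero: "f 0 = 0" by (metis add add.right_neutral add_left_cancel)
  have pow_add: "(f ^^ l) (x + y) = (f ^^ l) x + (f ^^ l) y" for l x y
    by (induction l) (simp_all add: add)
  have pow_zero: "(f ^^ l) 0 = 0" for l
    by (induction l) (simp_all add: zero)
  have pow_sum: "(f ^^ l) (\<Sum>i\<in>I. g i) = (\<Sum>i\<in>I. (f ^^ l) (g i))" for l g and I :: "nat set"
    by (induction I rule: infinite_finite_induct) (simp_all add: pow_add pow_zero)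
  have pow_fixed: "(f ^^ l) w = w" for l
    by (induction l) (simp_all add: fixed)
  have "(\<Sum>i<m * q. (f ^^ i) c) = (\<Sum>j<m. \<Sum>l<q. (f ^^ j) (((f ^^ m) ^^ l) c))"
    by (simp add: sum_lessThan_mult funpow_add funpow_mult)
  also have "\<dots> = (\<Sum>j<m. (f ^^ j) w)"
    by (simp only: w[symmetric] flip: pow_sum)
  also have "\<dots> = of_nat m * w"
    by (simp add: pow_fixed)
  finally show ?thesis .
qed

section \<open>Powers of linear substitutions\<close>

lemma mconst_sum: "mconst (\<Sum>i\<in>I. g i) = (\<Sum>i\<in>I. mconst (g i))"
  by (induction I rule: infinite_finite_induct) (simp_all add: mconst_add)

text \<open>Substitutions compose in reversed order, so this is an action from the right; for the
  powers of one matrix the order is immaterial.\<close>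

lemma lin_act_mult: "lin_act (A ** B) p = lin_act B (lin_act A p)"
proof -
  have "poly_subst (\<lambda>i. \<Sum>j\<in>UNIV. mconst (B $ i $ j) * mvar j) (\<Sum>j\<in>UNIV. mconst (A $ i $ j) * mvar j) =
    (\<Sum>k\<in>UNIV. mconst ((A ** B) $ i $ k) * mvar k)" for i
  proof -
    have "(\<Sum>j\<in>UNIV. mconst (A $ i $ j) * (\<Sum>k\<in>UNIV. mconst (B $ j $ k) * mvar k)) =
        (\<Sum>j\<in>UNIV. \<Sum>k\<in>UNIV. mconst (A $ i $ j * B $ j $ k) * mvar k)"
      by (simp only: sum_distrib_left mconst_mult mult.assoc)
    also have "\<dots> = (\<Sum>k\<in>UNIV. \<Sum>j\<in>UNIV. mconst (A $ i $ j * B $ j $ k) * mvar k)"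
      by (rule sum.swap)
    also have "\<dots> = (\<Sum>k\<in>UNIV. mconst ((A ** B) $ i $ k) * mvar k)"
      by (simp only: matrix_matrix_mult_def mconst_sum sum_distrib_right vec_lambda_beta)
    finally show ?thesis
      by (simp only: poly_subst_sum poly_subst_mult poly_subst_mconst poly_subst_mvar)
  qed
  then show ?thesis
    by (simp add: lin_act_eq poly_subst_poly_subst)
qed

lemma lin_act_1: "lin_act (mat 1) p = (p :: ('a::finite, 'b::field) mpoly)"
proof -
  have "(\<Sum>j\<in>UNIV. mconst (mat 1 $ i $ j) * mvar j) = (mvar i :: ('a, 'b) mpoly)" for i
  proof -
    have "(\<Sum>j\<in>UNIV. mconst (mat 1 $ i $ j) * mvar j) =
        (\<Sum>j\<in>UNIV. if i = j then mvar j else 0 :: ('a, 'b) mpoly)"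
      by (intro sum.cong) (auto simp: mat_def)
    then show ?thesis by simp
  qed
  then show ?thesis by (simp add: lin_act_eq poly_subst_id)
qed

lemma GL_simps [simp]: "\<one>\<^bsub>GL\<^esub> = mat 1" "A \<otimes>\<^bsub>GL\<^esub> B = A ** B" "A \<in> carrier GL \<longleftrightarrow> invertible A"
  by (simp_all add: GL_def)

lemma group_GL: "group (GL :: ('k::field ^ 'n ^ 'n) monoid)"
proof (rule groupI)
  fix x :: "'k ^ 'n ^ 'n" assume "x \<in> carrier GL"
  then obtain z where z: "x ** z = mat 1" "z ** x = mat 1"
    by (auto simp: invertible_def)
  then have "invertible z"
    unfolding invertible_def by blast
  with z show "\<exists>z\<in>carrier GL. z \<otimes>\<^bsub>GL\<^esub> x = \<one>\<^bsub>GL\<^esub>" by auto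
next
  show "\<one>\<^bsub>GL\<^esub> \<in> carrier GL"
    by (auto simp: invertible_def)
qed (simp_all add: invertible_mult matrix_mul_assoc)

lemma lin_act_pow: "lin_act (A [^]\<^bsub>GL\<^esub> (k::nat)) p = (lin_act A ^^ k) p"
  by (induction k arbitrary: p) (simp_all add: lin_act_1 lin_act_mult)

text \<open>The exponent \<open>N\<close> is the exact order, so that the powers strictly between
  \<open>0\<close> and \<open>N\<close> are nontrivial. Finiteness forces two natural powers of the
  generator to agree; integer powers are then reduced modulo the least positive exponent giving the
  identity.\<close>

lemma finite_cyclic_GL:
  fixes G :: "('k::field ^ 'n ^ 'n) set"
  assumes "subgroup G GL" "finite G" "cyclic_group (GL\<lparr>carrier := G\<rparr>)"
  shows "\<exists>A N. N > 0 \<and> G = (\<lambda>i. A [^]\<^bsub>GL\<^esub> (i::nat)) ` {..<N} \<and> A [^]\<^bsub>GL\<^esub> N = mat 1 \<and>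
    (\<forall>i. 0 < i \<and> i < N \<longrightarrow> A [^]\<^bsub>GL\<^esub> i \<noteq> mat 1)"
proof -
  interpret GL: group "GL :: ('k ^ 'n ^ 'n) monoid" by (rule group_GL)
  interpret H: group "GL\<lparr>carrier := G\<rparr>"
    using assms(1) group_GL by (rule subgroup.subgroup_is_group)
  obtain A where A: "A \<in> G" "G = range (\<lambda>n::int. A [^]\<^bsub>GL\<lparr>carrier := G\<rparr>\<^esub> n)"
    using assms(3) unfolding H.cyclic_group by auto
  have AH: "A \<in> carrier (GL\<lparr>carrier := G\<rparr>)"
    using A(1) by simp
  have "finite (range (\<lambda>n::nat. A [^]\<^bsub>GL\<lparr>carrier := G\<rparr>\<^esub> n))"
    using assms(2) A(1) by (rule_tac finite_subset[of _ G]) (auto intro: H.nat_pow_closed[simplified])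
  then have "\<not> inj (\<lambda>n::nat. A [^]\<^bsub>GL\<lparr>carrier := G\<rparr>\<^esub> n)"
    using finite_imageD by blast
  then obtain a b :: nat where ab: "A [^]\<^bsub>GL\<lparr>carrier := G\<rparr>\<^esub> a = A [^]\<^bsub>GL\<lparr>carrier := G\<rparr>\<^esub> b" "a < b"
    unfolding inj_def by (metis linorder_neqE_nat)
  have "A [^]\<^bsub>GL\<lparr>carrier := G\<rparr>\<^esub> a \<otimes>\<^bsub>GL\<lparr>carrier := G\<rparr>\<^esub> A [^]\<^bsub>GL\<lparr>carrier := G\<rparr>\<^esub> (b - a) =
      A [^]\<^bsub>GL\<lparr>carrier := G\<rparr>\<^esub> a"
    using A(1) ab by (subst H.nat_pow_mult) auto
  then have "A [^]\<^bsub>GL\<lparr>carrier := G\<rparr>\<^esub> (b - a) = mat 1"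
    using A(1) H.nat_pow_closed by (subst (asm) H.l_cancel_one) auto
  then have ex: "\<exists>n::nat. n > 0 \<and> A [^]\<^bsub>GL\<^esub> n = mat 1"
    using ab(2) by (intro exI[of _ "b - a"]) (simp add: GL.nat_pow_consistent[of A _ G])
  define N where "N = (LEAST n::nat. n > 0 \<and> A [^]\<^bsub>GL\<^esub> n = mat 1)"
  have N: "N > 0" "A [^]\<^bsub>GL\<^esub> N = mat 1"
    using LeastI_ex[OF ex] by (auto simp: N_def)
  have min: "A [^]\<^bsub>GL\<^esub> i \<noteq> mat 1" if "0 < i" "i < N" for i
    using not_less_Least[of i "\<lambda>n::nat. n > 0 \<and> A [^]\<^bsub>GL\<^esub> n = mat 1"] that by (auto simp: N_def)
  have "G = (\<lambda>i. A [^]\<^bsub>GL\<^esub> (i::nat)) ` {..<N}"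
  proof
    have "A [^]\<^bsub>GL\<lparr>carrier := G\<rparr>\<^esub> n \<in> (\<lambda>i. A [^]\<^bsub>GL\<^esub> (i::nat)) ` {..<N}" for n :: int
    proof -
      define r where "r = nat (n mod int N)"
      have r: "r < N" "n = int N * (n div int N) + int r"
        using N(1) by (simp_all add: r_def nat_less_iff)
      have "A [^]\<^bsub>GL\<lparr>carrier := G\<rparr>\<^esub> n =
          (A [^]\<^bsub>GL\<lparr>carrier := G\<rparr>\<^esub> int N) [^]\<^bsub>GL\<lparr>carrier := G\<rparr>\<^esub> (n div int N)
            \<otimes>\<^bsub>GL\<lparr>carrier := G\<rparr>\<^esub> A [^]\<^bsub>GL\<lparr>carrier := G\<rparr>\<^esub> int r"
        using H.int_pow_mult[OF AH, of "int N * (n div int N)" "int r"] r(2)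
        unfolding H.int_pow_pow[OF AH] by metis
      also have "A [^]\<^bsub>GL\<lparr>carrier := G\<rparr>\<^esub> int N = \<one>\<^bsub>GL\<lparr>carrier := G\<rparr>\<^esub>"
        using N(2) by (simp add: int_pow_int flip: GL.nat_pow_consistent)
      also have "\<one>\<^bsub>GL\<lparr>carrier := G\<rparr>\<^esub> [^]\<^bsub>GL\<lparr>carrier := G\<rparr>\<^esub> (n div int N)
            \<otimes>\<^bsub>GL\<lparr>carrier := G\<rparr>\<^esub> A [^]\<^bsub>GL\<lparr>carrier := G\<rparr>\<^esub> int r = A [^]\<^bsub>GL\<^esub> r"
        unfolding H.int_pow_one by (simp add: int_pow_int flip: GL.nat_pow_consistent)
      finally show ?thesis using r(1) by auto
    qed
    then show "G \<subseteq> (\<lambda>i. A [^]\<^bsub>GL\<^esub> (i::nat)) ` {..<N}"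
      by (subst A(2)) auto
    show "(\<lambda>i. A [^]\<^bsub>GL\<^esub> (i::nat)) ` {..<N} \<subseteq> G"
      using H.nat_pow_closed[of A] A(1) by (auto simp flip: GL.nat_pow_consistent)
  qed
  with N min show ?thesis by blast
qed

section \<open>Two independent forms from a non-transvection\<close>

text \<open>If all minors vanish, \<open>E = A - 1\<close> has rank one, so \<open>E ** E\<close> is
  \<open>E\<close> times its trace \<open>c\<close>. As \<open>A\<close> is no transvection,
  \<open>c\<close> is nonzero, and \<open>1 + c\<close> is an eigenvalue of \<open>A\<close>
  different from 1. But it is a root of unity of order dividing \<open>q\<close>, and 1 is the only
  one in the field.\<close>

lemma minor_of_non_transvection:
  fixes A :: "'k::field ^ 'n ^ 'n::finite"
  assumes A: "invertible A" "A \<noteq> mat 1" "q > 0" "A [^]\<^bsub>GL\<^esub> (q::nat) = mat 1" "\<not> transvection A"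
    and q: "\<And>x::'k. x ^ q = 1 \<Longrightarrow> x = 1"
  shows "\<exists>i j a b. (A - mat 1) $ i $ a * (A - mat 1) $ j $ b - (A - mat 1) $ i $ b * (A - mat 1) $ j $ a \<noteq> 0"
proof (rule ccontr)
  define E where "E = A - mat 1"
  assume "\<not> ?thesis"
  then have minors: "E $ i $ a * E $ j $ b = E $ i $ b * E $ j $ a" for i j a b
    by (auto simp: E_def)
  have "E \<noteq> 0" using A(2) by (simp add: E_def)
  then obtain i0 j0 where ij: "E $ i0 $ j0 \<noteq> 0"
    by (auto simp: vec_eq_iff)
  have row_E: "row i E = (E $ i $ j0 / E $ i0 $ j0) *s row i0 E" for i
  proof (rule vec_eq_iff[THEN iffD2], intro allI)
    fix a
    show "row i E $ a = ((E $ i $ j0 / E $ i0 $ j0) *s row i0 E) $ a"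
      using minors[of i a i0 j0] ij by (simp add: row_def eq_divide_eq)
  qed
  have "row i E \<in> vec.span {row i0 E}" for i
    by (subst row_E, rule vec.span_scale, rule vec.span_base, rule singletonI)
  then have rows: "rows E \<subseteq> vec.span {row i0 E}"
    by (auto simp: rows_def)
  have "row i0 E \<noteq> 0"
    using ij by (auto simp: vec_eq_iff row_def)
  then have "vec.dim (rows E) = 1"
    by (intro vec.dim_unique[of "{row i0 E}"] rows) (auto simp: rows_def vec.dependent_single)
  then have "pseudoreflection A"
    using A by (auto simp: pseudoreflection_def row_rank_def_gen E_def)
  then have EE: "E ** E \<noteq> 0"
    using A(5) by (simp add: transvection_def E_def)
  define c where "c = (\<Sum>l\<in>UNIV. E $ l $ l)"
  define sE where "sE s = (\<chi> i j. s * E $ i $ j)" for s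
  have E2: "E ** E = sE c"
  proof -
    have "(\<Sum>l\<in>UNIV. E $ i $ l * E $ l $ j) = (\<Sum>l\<in>UNIV. E $ l $ l * E $ i $ j)" for i j
      by (intro sum.cong refl) (metis minors mult.commute)
    then show ?thesis
      by (auto simp: vec_eq_iff matrix_matrix_mult_def c_def sum_distrib_right sE_def)
  qed
  then have "c \<noteq> 0"
    using EE by (auto simp: vec_eq_iff sE_def)
  \<comment> \<open>Here \<open>s\<close> is the geometric sum of the powers of \<open>1 + c\<close>
    below \<open>n\<close>; multiplying by \<open>c\<close> gives it a closed form.\<close>
  have "\<exists>s. A [^]\<^bsub>GL\<^esub> n = mat 1 + sE s \<and> c * s = (1 + c) ^ n - 1" for n :: nat
  proof (induction n)
    case 0
    show ?case by (intro exI[of _ 0]) (simp add: sE_def vec_eq_iff)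
  next
    case (Suc n)
    then obtain s where s: "A [^]\<^bsub>GL\<^esub> n = mat 1 + sE s" "c * s = (1 + c) ^ n - 1"
      by blast
    have AE: "A = mat 1 + E" by (simp add: E_def)
    have sE: "sE s ** E = (\<chi> i j. s * (E ** E) $ i $ j)"
      by (simp add: vec_eq_iff matrix_matrix_mult_def sum_distrib_left mult.assoc sE_def)
    have "A [^]\<^bsub>GL\<^esub> Suc n = (mat 1 + sE s) ** (mat 1 + E)"
      by (simp add: s(1) flip: AE)
    also have "\<dots> = mat 1 + sE s + E + sE s ** E"
    proof -
      have "(X + Y) ** Z = X ** Z + Y ** Z" for X Y Z :: "'k ^ 'n ^ 'n"
        by (simp add: vec_eq_iff matrix_matrix_mult_def distrib_right sum.distrib)
      then show ?thesis
        by (simp add: matrix_add_ldistrib)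
    qed
    also have "\<dots> = mat 1 + sE (s + 1 + s * c)"
      unfolding sE E2 by (simp add: vec_eq_iff algebra_simps sE_def)
    finally have "A [^]\<^bsub>GL\<^esub> Suc n = mat 1 + sE (s + 1 + s * c)" .
    moreover have "c * (s + 1 + s * c) = (c * s) * (1 + c) + c"
      by (simp add: algebra_simps)
    then have "c * (s + 1 + s * c) = (1 + c) ^ Suc n - 1"
      unfolding s(2) by (simp add: algebra_simps)
    ultimately show ?case by blast
  qed
  then obtain s where s: "A [^]\<^bsub>GL\<^esub> q = mat 1 + sE s" "c * s = (1 + c) ^ q - 1"
    by blast
  from s(1) A(4) have "s = 0"
    using ij by (auto simp: vec_eq_iff sE_def)
  with s(2) have "(1 + c) ^ q = 1" by simp
  then show False using q[of "1 + c"] \<open>c \<noteq> 0\<close> by simp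
qed

text \<open>In characteristic p, \<open>q\<close> is the largest power of p dividing
  \<open>N\<close>: Frobenius turns \<open>x ^ q - 1\<close> into \<open>(x - 1) ^ q\<close>, and
  the remaining factor \<open>m\<close> is prime to p. In characteristic zero \<open>q = 1\<close>,
  so \<open>m\<close> is all of \<open>N\<close>.\<close>

lemma unipotent_part:
  assumes "N > 0"
  obtains m q where "N = m * q" "q > 0" "of_nat m \<noteq> (0 :: 'k::field)" "\<And>x::'k. x ^ q = 1 \<Longrightarrow> x = 1"
proof (cases "CHAR('k) = 0")
  case True
  then have "of_nat N \<noteq> (0 :: 'k)"
    using assms by (simp add: of_nat_eq_0_iff_char_dvd)
  then show ?thesis by (intro that[of N 1]) simp_all
next
  case False
  define p where "p = CHAR('k)"
  have p: "prime p"
    using False by (simp add: p_def prime_CHAR_semidom)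
  have "N \<noteq> 0" "\<not> is_unit p" using assms p by auto
  then obtain m where m: "N = p ^ multiplicity p N * m" "\<not> p dvd m"
    using multiplicity_decompose'[of N p] by metis
  define q where "q = p ^ multiplicity p N"
  have "x = 1" if "x ^ q = 1" for x :: 'k
  proof -
    have "((x - 1) + 1) ^ q = (x - 1) ^ q + 1 ^ q"
      by (rule freshmans_dream'[of _ "multiplicity p N"]) (use p in \<open>simp_all add: q_def p_def\<close>)
    then have "(x - 1) ^ q = 0" using that by simp
    then show ?thesis by simp
  qed
  moreover have "N = m * q"
    using m(1) unfolding q_def by (metis mult.commute)
  moreover have "q > 0"
    using p by (simp add: q_def prime_gt_0_nat)
  moreover have "of_nat m \<noteq> (0 :: 'k)"
    using m(2) by (simp add: p_def of_nat_eq_0_iff_char_dvd)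
  ultimately show ?thesis
    using that by blast
qed

section \<open>Traces in K[y] that avoid a prescribed variable\<close>

lemma lin_act_add: "lin_act A (p + q) = lin_act A p + lin_act A q"
  by (simp add: lin_act_eq poly_subst_add)

lemma lin_act_times: "lin_act A (p * q) = lin_act A p * lin_act A q"
  by (simp add: lin_act_eq poly_subst_mult)

lemma lin_act_mconst [simp]: "lin_act A (mconst c) = mconst c"
  by (simp add: lin_act_eq)

lemma lin_act_one [simp]: "lin_act A 1 = 1"
  by (simp add: lin_act_eq)

lemma lin_act_mvar: "lin_act A (mvar i) = (\<Sum>j\<in>UNIV. mconst (A $ i $ j) * mvar j)"
  by (simp add: lin_act_eq)

lemma lin_act_mvar_diff:
  "lin_act A (mvar i) - mvar i = (\<Sum>j\<in>UNIV. mconst ((A - mat 1) $ i $ j) * mvar j)"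
proof -
  have "lin_act A (mvar i) - mvar i = lin_act A (mvar i) - lin_act (mat 1) (mvar i)"
    by (simp add: lin_act_1)
  also have "\<dots> = (\<Sum>j\<in>UNIV. mconst ((A - mat 1) $ i $ j) * mvar j)"
    unfolding lin_act_mvar by (simp add: sum_subtractf mconst_diff left_diff_distrib)
  finally show ?thesis .
qed

lemma variable_free_mult:
  assumes "\<forall>m\<in>keys p. lookup m i = 0" "\<forall>m\<in>keys q. lookup m i = 0"
  shows "\<forall>m\<in>keys (p * q). lookup m i = 0"
  using assms Poly_Mapping.keys_mult[of p q] by (fastforce simp: lookup_add)

lemma variable_free_power:
  "\<forall>m\<in>keys p. lookup m i = 0 \<Longrightarrow> \<forall>m\<in>keys (p ^ k). lookup m i = 0"
proof (induction k)
  case (Suc k)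
  then show ?case unfolding power_Suc by (intro variable_free_mult) auto
qed simp

lemma variable_free_prod:
  "finite L \<Longrightarrow> (\<And>l. l \<in> L \<Longrightarrow> \<forall>m\<in>keys (t l). lookup m i = 0) \<Longrightarrow>
    \<forall>m\<in>keys (\<Prod>l\<in>L. t l). lookup m i = 0"
proof (induction L rule: finite_induct)
  case (insert l L)
  have "\<forall>m\<in>keys (t l * (\<Prod>l\<in>L. t l)). lookup m i = 0"
    by (intro variable_free_mult insert.IH insert.prems) auto
  then show ?case using insert.hyps by simp
qed simp

text \<open>Each nontrivial element of the p-part provides two independent forms and hence a
  relation polynomial \<open>t l\<close> free of the variable \<open>i\<close>. The product of all
  of them has the shape required by \<open>pow_is_trace\<close>, so its \<open>q\<close>-th power is
  a trace for the p-part. Products and powers stay nonzero and free of the variable.\<close>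

lemma variable_free_trace:
  fixes A :: "'k::field ^ 'n::{finite,linorder} ^ 'n::{finite,linorder}"
  assumes N: "N > 0" "A [^]\<^bsub>GL\<^esub> N = mat 1"
    "\<And>i. 0 < i \<Longrightarrow> i < N \<Longrightarrow> A [^]\<^bsub>GL\<^esub> i \<noteq> mat 1"
    and A: "invertible A" and nt: "\<And>i. i < N \<Longrightarrow> \<not> transvection (A [^]\<^bsub>GL\<^esub> i)"
    and y: "\<And>j::'n. lin_act A (y j) = y j"
  shows "\<exists>t c. t \<noteq> 0 \<and> (\<forall>m\<in>keys t. lookup m i = 0) \<and>
    poly_subst y t = (\<Sum>i<N. (lin_act A ^^ i) c)"
proof -
  interpret GL: group "GL :: ('k ^ 'n::{finite,linorder} ^ 'n::{finite,linorder}) monoid" by (rule group_GL)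
  have AG: "A \<in> carrier GL" using A by simp
  obtain m q where mq: "N = m * q" "q > 0" "of_nat m \<noteq> (0 :: 'k)" "\<And>x::'k. x ^ q = 1 \<Longrightarrow> x = 1"
    using unipotent_part[OF N(1), where 'k = 'k] by blast
  have m0: "m > 0" using mq(1) N(1) by auto
  define f where "f = lin_act (A [^]\<^bsub>GL\<^esub> m)"
  have f: "f = lin_act A ^^ m"
    by (rule ext) (simp add: f_def lin_act_pow)
  have fpow: "(f ^^ l) p = lin_act (A [^]\<^bsub>GL\<^esub> (m * l)) p" for l p
    by (simp add: f lin_act_pow funpow_mult)
  interpret f: finite_order_endo f q
  proof
    show "(f ^^ q) x = x" for x
      using N(2) by (simp add: fpow mq(1)[symmetric] lin_act_1)
  qed (simp_all add: f_def lin_act_add lin_act_times mq)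
  have "\<exists>t \<alpha> \<beta> i1 i2. t \<noteq> 0 \<and> (\<forall>m\<in>keys t. lookup m i = 0) \<and>
      poly_subst y t = \<alpha> * ((f ^^ l) (mvar i1) - mvar i1) + \<beta> * ((f ^^ l) (mvar i2) - mvar i2)"
    if l: "l \<in> {1..<q}" for l
  proof -
    define M where "M = A [^]\<^bsub>GL\<^esub> (m * l)"
    \<comment> \<open>The exponent stays strictly below the exact order, so \<open>M\<close> is not
      the identity and the absence of transvections applies to it.\<close>
    have ml: "0 < m * l" "m * l < N" using l m0 by (auto simp: mq(1))
    have "M [^]\<^bsub>GL\<^esub> q = (A [^]\<^bsub>GL\<^esub> N) [^]\<^bsub>GL\<^esub> l"
      unfolding M_def using AG by (simp only: GL.nat_pow_pow mq(1) ac_simps)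
    also have "\<dots> = mat 1"
      unfolding N(2) using GL.nat_pow_one[of l] by (simp only: GL_simps)
    finally have M: "M [^]\<^bsub>GL\<^esub> q = mat 1" .
    have "invertible M"
      using GL.nat_pow_closed[OF AG] unfolding M_def by simp
    then obtain i1 i2 a b where
      "(M - mat 1) $ i1 $ a * (M - mat 1) $ i2 $ b - (M - mat 1) $ i1 $ b * (M - mat 1) $ i2 $ a \<noteq> 0"
      using minor_of_non_transvection[of M q] M N(3)[OF ml] nt[OF ml(2)] mq(2,4)
      unfolding M_def[symmetric] by blast
    from algebraic_relation_mod_linear_forms[OF this, of i y]
    show ?thesis
      unfolding fpow M_def[symmetric] lin_act_mvar_diff by blast
  qed
  then obtain t \<alpha> \<beta> i1 i2 where t: "\<And>l. l \<in> {1..<q} \<Longrightarrow> t l \<noteq> 0"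
    "\<And>l. l \<in> {1..<q} \<Longrightarrow> \<forall>m\<in>keys (t l). lookup m i = 0"
    "\<And>l. l \<in> {1..<q} \<Longrightarrow> poly_subst y (t l) =
      \<alpha> l * ((f ^^ l) (mvar (i1 l)) - mvar (i1 l)) + \<beta> l * ((f ^^ l) (mvar (i2 l)) - mvar (i2 l))"
    by metis
  define T where "T = (\<Prod>l\<in>{1..<q}. t l)"
  define w where "w = poly_subst y T"
  have "w = (\<Prod>l\<in>{1..<q}. \<alpha> l * ((f ^^ l) (mvar (i1 l)) - mvar (i1 l)) +
      \<beta> l * ((f ^^ l) (mvar (i2 l)) - mvar (i2 l)))"
    unfolding w_def T_def poly_subst_prod by (intro prod.cong refl t(3))
  moreover have fixed: "lin_act A w = w"
    unfolding w_def lin_act_eq poly_subst_poly_subst using y[unfolded lin_act_eq] by simp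
  moreover have "(lin_act A ^^ j) w = w" for j
    by (induction j) (simp_all add: fixed)
  then have "f w = w"
    by (simp only: f)
  ultimately have "\<exists>c. w ^ q = f.tr c"
    by (intro f.pow_is_trace)
  then obtain c where c: "w ^ q = f.tr c" ..
  have fixed': "lin_act A (w ^ q) = w ^ q"
    using fixed by (simp add: lin_act_eq poly_subst_power)
  have "(\<Sum>i<m * q. (lin_act A ^^ i) c) = of_nat m * w ^ q"
  proof (rule full_trace_of_subgroup_trace[OF lin_act_add fixed'])
    show "w ^ q = (\<Sum>l<q. ((lin_act A ^^ m) ^^ l) c)"
      unfolding c f.tr_def by (simp only: f)
  qed
  moreover have "(lin_act A ^^ i) (mconst k * c) = mconst k * (lin_act A ^^ i) c" for i k
    by (induction i) (simp_all add: lin_act_times)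
  \<comment> \<open>The full trace of \<open>c\<close> is \<open>m\<close> times the wanted element;
    \<open>m\<close> is invertible, so rescaling \<open>c\<close> removes the factor.\<close>
  ultimately have "(\<Sum>i<N. (lin_act A ^^ i) (mconst (1 / of_nat m) * c)) =
      mconst (1 / of_nat m) * (of_nat m * w ^ q)"
    by (simp add: mq(1) flip: sum_distrib_left)
  also have "\<dots> = w ^ q"
    unfolding mconst_of_nat[symmetric] mult.assoc[symmetric] mconst_mult[symmetric]
    using mq(3) by simp
  finally have "poly_subst y (T ^ q) = (\<Sum>i<N. (lin_act A ^^ i) (mconst (1 / of_nat m) * c))"
    by (simp add: w_def poly_subst_power)
  moreover have "T ^ q \<noteq> 0"
    using t(1) by (simp add: T_def)
  moreover have "\<forall>m\<in>keys (T ^ q). lookup m i = 0"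
    unfolding T_def by (intro variable_free_power variable_free_prod t(2)) auto
  ultimately show ?thesis by blast
qed

section \<open>The fraction field as a vector space\<close>

definition emb :: "'a::idom \<Rightarrow> 'a fract" where
  "emb p = Fract p 1"

lemma Fract_emb: "Fract a b = emb a / emb b"
  by (simp add: emb_def)

lemma emb_add: "emb (p + q) = emb p + emb q"
  by (simp add: emb_def)

lemma emb_mult: "emb (p * q) = emb p * emb q"
  by (simp add: emb_def)

lemma emb_0 [simp]: "emb 0 = 0"
  by (simp add: emb_def Zero_fract_def)

lemma emb_1 [simp]: "emb 1 = 1"
  by (simp add: emb_def One_fract_def)

lemma emb_eq_iff [simp]: "emb p = emb q \<longleftrightarrow> p = q"
  by (simp add: emb_def eq_fract)

lemma emb_eq_0_iff [simp]: "emb p = 0 \<longleftrightarrow> p = 0"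
  using emb_eq_iff[of p 0] by (simp del: emb_eq_iff)

lemma emb_power: "emb (p ^ n) = emb p ^ n"
  by (induction n) (simp_all add: emb_mult)

lemma emb_prod: "emb (\<Prod>i\<in>I. f i) = (\<Prod>i\<in>I. emb (f i))"
  by (induction I rule: infinite_finite_induct) (simp_all add: emb_mult)

lemma emb_sum: "emb (\<Sum>i\<in>I. f i) = (\<Sum>i\<in>I. emb (f i))"
  by (induction I rule: infinite_finite_induct) (simp_all add: emb_add)

interpretation fract_vs: vector_space
  "\<lambda>(c::'k::field) (q :: ('n::{finite,linorder}, 'k) mpoly fract). emb (mconst c) * q"
  by unfold_locales (simp_all only: mconst_add mconst_mult mconst_1 emb_add emb_mult emb_1
      distrib_left distrib_right mult.assoc mult_1_left)

text \<open>A basis of \<open>V\<close> stays independent after adjoining \<open>u\<close>, so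
  values on it can be prescribed. Membership in a subspace is thereby tested by functionals, without
  forming quotients.\<close>

lemma separating_functional:
  fixes V :: "('n::{finite,linorder}, 'k::field) mpoly fract set"
  assumes V: "fract_vs.subspace V" and u: "u \<notin> V"
  shows "\<exists>\<mu> :: ('n, 'k) mpoly fract \<Rightarrow> 'k. (\<forall>x z. \<mu> (x + z) = \<mu> x + \<mu> z) \<and>
    (\<forall>c x. \<mu> (emb (mconst c) * x) = c * \<mu> x) \<and> (\<forall>x\<in>V. \<mu> x = 0) \<and> \<mu> u = 1"
proof -
  interpret vector_space_pair
    "\<lambda>(c::'k) (q :: ('n, 'k) mpoly fract). emb (mconst c) * q" "(*) :: 'k \<Rightarrow> 'k \<Rightarrow> 'k"
    by (intro vector_space_pair.intro fract_vs.vector_space_axioms, unfold_locales)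
      (simp_all only: distrib_left distrib_right mult.assoc mult_1_left)
  obtain B where B: "B \<subseteq> V" "fract_vs.independent B" "V \<subseteq> fract_vs.span B"
    by (rule fract_vs.basis_exists[of V])
  have "fract_vs.span B \<subseteq> V"
    using B(1) V by (rule fract_vs.span_minimal)
  then have "u \<notin> fract_vs.span B" using u by auto
  then have indep: "fract_vs.independent (insert u B)" "u \<notin> B"
    using B(2) fract_vs.span_base by (auto simp: fract_vs.independent_insert)
  obtain \<mu> where \<mu>: "Vector_Spaces.linear (\<lambda>(c::'k) (q :: ('n, 'k) mpoly fract). emb (mconst c) * q) (*) \<mu>"
    "\<And>x. x \<in> insert u B \<Longrightarrow> \<mu> x = (if x = u then 1 else 0)"
    using linear_independent_extend[OF indep(1), of "\<lambda>x. if x = u then 1 else 0"] by blast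
  interpret \<mu>: Vector_Spaces.linear "\<lambda>(c::'k) (q :: ('n, 'k) mpoly fract). emb (mconst c) * q" "(*) :: 'k \<Rightarrow> 'k \<Rightarrow> 'k" \<mu>
    by (rule \<mu>(1))
  have "\<mu> x = 0" if "x \<in> fract_vs.span B" for x
    using that
  proof (induction rule: fract_vs.span_induct_alt)
    case base
    show ?case by (rule \<mu>.zero)
  next
    case (step c x y)
    then show ?case using \<mu>(2)[of x] indep(2) by (auto simp: \<mu>.add \<mu>.scale)
  qed
  then show ?thesis
    using B(3) \<mu>(2)[of u] by (intro exI[of _ \<mu>]) (auto simp: \<mu>.add \<mu>.scale)
qed

section \<open>Cech cochains of a graded subring\<close>

lemma localized_eq: "localized S f = {emb r / emb f ^ d | r d. r \<in> S}"
  by (simp add: localized_def Fract_emb emb_power)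

text \<open>Applied to the full polynomial ring and to the invariants. The parameters may vanish
  here, so that the degenerate case shares these facts.\<close>

locale cech_subring =
  fixes y :: "'n::{finite,linorder} \<Rightarrow> ('n, 'k::field) mpoly" and S :: "('n, 'k) mpoly set"
  assumes y_in: "y i \<in> S" and S_add: "p \<in> S \<Longrightarrow> q \<in> S \<Longrightarrow> p + q \<in> S"
    and S_mult: "p \<in> S \<Longrightarrow> q \<in> S \<Longrightarrow> p * q \<in> S" and S_const: "mconst c \<in> S"
begin

lemma S_0: "0 \<in> S" and S_1: "1 \<in> S"
  using S_const[of 0] S_const[of 1] by simp_all

lemma S_power: "p \<in> S \<Longrightarrow> p ^ n \<in> S"
  by (induction n) (auto simp: S_1 intro: S_mult)

lemma S_prod: "(\<And>i. i \<in> I \<Longrightarrow> g i \<in> S) \<Longrightarrow> (\<Prod>i\<in>I. g i) \<in> S"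
  by (induction I rule: infinite_finite_induct) (auto simp: S_1 intro: S_mult)

lemma S_subst: "poly_subst y t \<in> S"
  by (induction t rule: mpoly_induct)
    (auto simp: S_const y_in poly_subst_add poly_subst_mult intro: S_add S_mult)

abbreviation "bd \<equiv> cech_boundaries y S"
abbreviation "Y \<equiv> cech_prod y"

lemma Y_in: "Y \<in> S"
  by (simp add: cech_prod_def S_prod y_in)

lemma subspace_localized:
  assumes "f \<in> S"
  shows "fract_vs.subspace (localized S f)"
proof (rule fract_vs.subspaceI)
  show "0 \<in> localized S f"
    unfolding localized_eq by (auto intro!: exI[of _ 0] simp: S_0)
next
  fix x z assume "x \<in> localized S f" "z \<in> localized S f"
  then obtain r d r' d' where x: "x = emb r / emb f ^ d" "r \<in> S"
    and z: "z = emb r' / emb f ^ d'" "r' \<in> S"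
    unfolding localized_eq by blast
  show "x + z \<in> localized S f"
  proof (cases "f = 0")
    \<comment> \<open>With \<open>f = 0\<close> a fraction is its numerator if \<open>d = 0\<close>,
      and \<open>0\<close> otherwise, since division by zero yields \<open>0\<close>.\<close>
    case True
    have "x = emb (if d = 0 then r else 0)" "z = emb (if d' = 0 then r' else 0)"
      using True by (simp_all add: x(1) z(1))
    then have "x + z = emb ((if d = 0 then r else 0) + (if d' = 0 then r' else 0)) / emb f ^ 0"
      by (simp only: emb_add power_0 div_by_1)
    moreover have "(if d = 0 then r else 0) + (if d' = 0 then r' else 0) \<in> S"
      using x z S_0 by (intro S_add) auto
    ultimately show ?thesis
      unfolding localized_eq by blast
  next
    case False
    have "x + z = emb (r * f ^ d' + r' * f ^ d) / emb f ^ (d + d')"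
      using False by (simp add: x z emb_add emb_mult emb_power power_add field_simps)
    moreover have "r * f ^ d' + r' * f ^ d \<in> S"
      using x z assms by (intro S_add S_mult S_power) auto
    ultimately show ?thesis
      unfolding localized_eq by blast
  qed
next
  fix c x assume "x \<in> localized S f"
  then obtain r d where x: "x = emb r / emb f ^ d" "r \<in> S"
    unfolding localized_eq by blast
  have "emb (mconst c) * x = emb (mconst c * r) / emb f ^ d" "mconst c * r \<in> S"
    using x S_mult S_const by (simp_all add: emb_mult)
  then show "emb (mconst c) * x \<in> localized S f"
    unfolding localized_eq by blast
qed

lemma subspace_bd: "fract_vs.subspace bd"
proof (rule fract_vs.subspaceI)
  have sub: "fract_vs.subspace (localized S (\<Prod>j\<in>UNIV - {i}. y j))" for i
    by (intro subspace_localized S_prod y_in)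
  show "0 \<in> bd"
    unfolding cech_boundaries_def
    by (auto intro!: exI[of _ "\<lambda>_. 0"] fract_vs.subspace_0[OF sub])
  fix x assume "x \<in> bd"
  then obtain w where w: "x = (\<Sum>i\<in>UNIV. w i)" "\<And>i. w i \<in> localized S (\<Prod>j\<in>UNIV - {i}. y j)"
    unfolding cech_boundaries_def by blast
  show "emb (mconst c) * x \<in> bd" for c
    unfolding cech_boundaries_def w(1) sum_distrib_left using fract_vs.subspace_scale[OF sub w(2)]
    by (intro CollectI exI[of _ "\<lambda>i. emb (mconst c) * w i"]) auto
  fix z assume "z \<in> bd"
  then obtain v where v: "z = (\<Sum>i\<in>UNIV. v i)" "\<And>i. v i \<in> localized S (\<Prod>j\<in>UNIV - {i}. y j)"
    unfolding cech_boundaries_def by blast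
  show "x + z \<in> bd"
    unfolding cech_boundaries_def w(1) v(1) sum.distrib[symmetric]
    using fract_vs.subspace_add[OF sub w(2) v(2)]
    by (intro CollectI exI[of _ "\<lambda>i. w i + v i"]) auto
qed

end

locale cech_data = cech_subring y S
  for y :: "'n::{finite,linorder} \<Rightarrow> ('n, 'k::field) mpoly" and e :: "'n \<Rightarrow> nat" and S +
  assumes y_hom: "homogeneous (e i) (y i)" and e_pos: "e i > 0" and y_nz: "y i \<noteq> 0"
    and S_hcomp: "p \<in> S \<Longrightarrow> hcomp d p \<in> S"
begin

lemma Y_nz: "Y \<noteq> 0"
  by (simp add: cech_prod_def y_nz)

definition E :: nat where
  "E = (\<Sum>i\<in>UNIV. e i)"

lemma Y_hom: "homogeneous E Y"
  unfolding cech_prod_def E_def by (intro homogeneous_prod y_hom)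

text \<open>A fraction without a pole along \<open>y i\<close> is a boundary.
  \<open>localized\<close> admits only powers of the whole product of the other parameters, so all
  exponents are first raised to the common bound \<open>L\<close>.\<close>

lemma monomial_quotient_in_bd:
  assumes "r \<in> S"
  shows "emb r / (\<Prod>j\<in>UNIV - {i}. emb (y j) ^ c j) \<in> bd"
proof -
  define L where "L = (\<Sum>j\<in>UNIV. c j)"
  have cL: "c j \<le> L" for j
    unfolding L_def by (rule member_le_sum) auto
  define s where "s = r * (\<Prod>j\<in>UNIV - {i}. y j ^ (L - c j))"
  have s: "s \<in> S"
    unfolding s_def by (intro S_mult assms S_prod S_power y_in)
  have eq: "emb r / (\<Prod>j\<in>UNIV - {i}. emb (y j) ^ c j) = emb s / emb (\<Prod>j\<in>UNIV - {i}. y j) ^ L"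
  proof -
    have "emb (\<Prod>j\<in>UNIV - {i}. y j) ^ L =
        (\<Prod>j\<in>UNIV - {i}. emb (y j) ^ c j) * (\<Prod>j\<in>UNIV - {i}. emb (y j) ^ (L - c j))"
      using cL by (simp add: emb_prod prod_power_distrib[symmetric] prod.distrib[symmetric] power_add[symmetric])
    then show ?thesis
      by (simp add: s_def emb_mult emb_prod emb_power y_nz)
  qed
  have zero: "0 \<in> localized S (\<Prod>j\<in>UNIV - {l}. y j)" for l
    by (intro fract_vs.subspace_0 subspace_localized S_prod y_in)
  define w where "w l = (if l = i then emb s / emb (\<Prod>j\<in>UNIV - {i}. y j) ^ L else 0)" for l
  have "w l \<in> localized S (\<Prod>j\<in>UNIV - {l}. y j)" for l
    using zero[of l] s by (auto simp: w_def localized_eq)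
  moreover have "emb r / (\<Prod>j\<in>UNIV - {i}. emb (y j) ^ c j) = (\<Sum>l\<in>UNIV. w l)"
    by (simp add: eq w_def)
  ultimately show ?thesis
    unfolding cech_boundaries_def by blast
qed

section \<open>Polynomials dual to functionals on top Cech classes\<close>

text \<open>Every parameter occurs at least once, because fractions missing one are boundaries.
  Exponent \<open>b = 0\<close> thus corresponds to the simple pole along all parameters.\<close>

definition y_denom :: "('n \<Rightarrow>\<^sub>0 nat) \<Rightarrow> ('n, 'k) mpoly fract" where
  "y_denom b = (\<Prod>i\<in>UNIV. emb (y i) ^ Suc (lookup b i))"

definition y_deg :: "int \<Rightarrow> ('n \<Rightarrow>\<^sub>0 nat) \<Rightarrow> int" where
  "y_deg k b = k + (\<Sum>i\<in>UNIV. int (e i * Suc (lookup b i)))"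

text \<open>This is the inverse system description: the functional \<open>\<mu>\<close> on the degree \<open>k\<close> part of the top
  Cech cohomology corresponds to the linear map \<open>r \<mapsto> dual_poly \<mu> k r\<close> over the polynomial ring
  in the parameters \<open>y i\<close>, whose variables act by lowering the pole order.\<close>

definition dual_poly :: "(('n, 'k) mpoly fract \<Rightarrow> 'k) \<Rightarrow> int \<Rightarrow> ('n, 'k) mpoly \<Rightarrow> ('n, 'k) mpoly" where
  "dual_poly \<mu> k r = Abs_poly_mapping (\<lambda>b. \<mu> (emb (hcomp (y_deg k b) r) / y_denom b))"

lemma lookup_le_y_deg: "int (lookup b i) \<le> y_deg k b - k"
proof -
  have "lookup b i \<le> e i * Suc (lookup b i)"
    using e_pos[of i] by (cases "e i") auto
  also have "\<dots> \<le> (\<Sum>i\<in>UNIV. e i * Suc (lookup b i))"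
    by (rule member_le_sum) auto
  finally have "int (lookup b i) \<le> int (\<Sum>i\<in>UNIV. e i * Suc (lookup b i))"
    by (rule of_nat_mono)
  then show ?thesis by (simp add: y_deg_def)
qed

lemma finite_y_deg: "finite {b. y_deg k b = d}"
proof (rule finite_subset)
  show "{b. y_deg k b = d} \<subseteq> monom_box UNIV (nat (d - k))"
  proof
    fix b assume "b \<in> {b. y_deg k b = d}"
    then have "lookup b i \<le> nat (d - k)" for i
      using lookup_le_y_deg[of b i k] by simp
    then show "b \<in> monom_box UNIV (nat (d - k))"
      by (simp add: monom_box_def)
  qed
qed (rule finite_monom_box)

text \<open>The family of coefficients really is a polynomial: only finitely many homogeneous
  components of \<open>r\<close> are nonzero, and since all \<open>e i\<close> are positive, each
  numerator degree belongs to finitely many pole orders.\<close>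

lemma lookup_dual_poly:
  assumes "\<mu> 0 = 0"
  shows "lookup (dual_poly \<mu> k r) b = \<mu> (emb (hcomp (y_deg k b) r) / y_denom b)"
proof -
  have "{b. \<mu> (emb (hcomp (y_deg k b) r) / y_denom b) \<noteq> 0} \<subseteq> (\<Union>d\<in>{d. hcomp d r \<noteq> 0}. {b. y_deg k b = d})"
    using assms by auto
  moreover have "finite (\<Union>d\<in>{d. hcomp d r \<noteq> 0}. {b. y_deg k b = d})"
    using finite_hcomp_nonzero finite_y_deg by blast
  ultimately have "finite {b. \<mu> (emb (hcomp (y_deg k b) r) / y_denom b) \<noteq> 0}"
    by (rule finite_subset)
  then show ?thesis
    unfolding dual_poly_def by (simp add: lookup_Abs_poly_mapping)
qed

end

lemma (in cech_data) dual_poly_add: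
  assumes "\<And>x z. \<mu> (x + z) = \<mu> x + \<mu> z" "\<mu> 0 = 0"
  shows "dual_poly \<mu> k (r + s) = dual_poly \<mu> k r + dual_poly \<mu> k s"
  by (rule poly_mapping_eqI)
    (simp add: lookup_dual_poly[of \<mu>, OF assms(2)] lookup_add hcomp_add emb_add add_divide_distrib assms(1))

locale cech_functional = cech_data y e S
  for y :: "'n::{finite,linorder} \<Rightarrow> ('n, 'k::field) mpoly" and e S +
  fixes \<mu> :: "('n, 'k) mpoly fract \<Rightarrow> 'k" and k :: int
  assumes \<mu>_add: "\<mu> (x + z) = \<mu> x + \<mu> z" and \<mu>_scale: "\<mu> (emb (mconst c) * x) = c * \<mu> x"
    and \<mu>_bd: "x \<in> cech_boundaries y S \<Longrightarrow> \<mu> x = 0"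
begin

lemma \<mu>_0: "\<mu> 0 = 0"
  using \<mu>_scale[of 0 0] by simp

abbreviation "dual \<equiv> dual_poly \<mu> k"

lemmas lookup_dual = lookup_dual_poly[where \<mu> = \<mu>, OF \<mu>_0]

lemma dual_add: "dual (r + s) = dual r + dual s"
  by (rule dual_poly_add) (simp_all add: \<mu>_add \<mu>_0)

lemma dual_0: "dual 0 = 0"
  by (rule poly_mapping_eqI) (simp add: lookup_dual \<mu>_0)

lemma dual_sum: "dual (\<Sum>i\<in>I. r i) = (\<Sum>i\<in>I. dual (r i))"
  by (induction I rule: infinite_finite_induct) (simp_all add: dual_add dual_0)

lemma dual_const: "dual (mconst c * r) = mconst c * dual r"
proof (rule poly_mapping_eqI)
  fix b
  have "hcomp d (mconst c * r) = mconst c * hcomp d r" for d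
    using hcomp_mult[OF homogeneous_mconst, of d c r] by simp
  then show "lookup (dual (mconst c * r)) b = lookup (mconst c * dual r) b"
    using \<mu>_scale by (simp add: lookup_dual lookup_mconst_mult emb_mult flip: times_divide_eq_right)
qed

text \<open>Multiplying the numerator by \<open>y i\<close> cancels one factor of the denominator,
  which moves coefficients from \<open>b - single i 1\<close> to \<open>b\<close>, just as
  multiplication by \<open>mvar i\<close> does. If \<open>b\<close> does not involve
  \<open>i\<close>, the pole along \<open>y i\<close> disappears, the fraction is a boundary, and
  \<open>\<mu>\<close> gives \<open>0\<close>, the coefficient of a multiple of
  \<open>mvar i\<close> there.\<close>

lemma dual_var:
  assumes r: "r \<in> S"
  shows "dual (y i * r) = mvar i * dual r"
proof (rule poly_mapping_eqI)
  fix b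
  have hc: "hcomp d (y i * r) = y i * hcomp (d - int (e i)) r" for d
    by (rule hcomp_mult[OF y_hom])
  have mv: "mvar i = single (single i 1) 1"
    by (simp add: mvar_def)
  show "lookup (dual (y i * r)) b = lookup (mvar i * dual r) b"
  proof (cases "lookup b i = 0")
    case True
    define h where "h = hcomp (y_deg k b - int (e i)) r"
    have "y_denom b = emb (y i) * (\<Prod>j\<in>UNIV - {i}. emb (y j) ^ Suc (lookup b j))"
      using True unfolding y_denom_def by (subst prod.remove[of _ i]) auto
    then have "emb (y i * h) / y_denom b = emb h / (\<Prod>j\<in>UNIV - {i}. emb (y j) ^ Suc (lookup b j))"
      using y_nz[of i] by (simp add: emb_mult)
    also have "\<dots> \<in> bd"
      unfolding h_def by (intro monomial_quotient_in_bd S_hcomp r)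
    finally have "\<mu> (emb (y i * h) / y_denom b) = 0"
      by (rule \<mu>_bd)
    moreover have "lookup (mvar i * dual r) b = 0"
      unfolding mv lookup_monom_mult using True by (auto simp: lookup_single when_def)
    ultimately show ?thesis
      unfolding lookup_dual hc h_def by simp
  next
    case False
    define b' where "b' = b - single i 1"
    have b: "b = b' + single i 1"
      using False unfolding b'_def
      by (intro poly_mapping_eqI) (auto simp: lookup_add lookup_minus lookup_single when_def)
    have "y_denom b = emb (y i) * y_denom b'"
    proof -
      have "y_denom b = (\<Prod>j\<in>UNIV. emb (y j) ^ Suc (lookup b' j) * emb (y j) ^ lookup (single i 1) j)"
        by (simp add: y_denom_def b lookup_add power_add mult_ac)
      also have "\<dots> = y_denom b' * (\<Prod>j\<in>UNIV. emb (y j) ^ lookup (single i 1) j)"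
        by (simp add: y_denom_def prod.distrib)
      also have "(\<Prod>j\<in>UNIV. emb (y j) ^ lookup (single i 1) j) = (\<Prod>j\<in>UNIV. if j = i then emb (y j) else 1)"
        by (intro prod.cong) (auto simp: lookup_single when_def)
      finally show ?thesis by simp
    qed
    moreover have "y_deg k b - int (e i) = y_deg k b'"
    proof -
      have "(\<Sum>j\<in>UNIV. int (e j * Suc (lookup b j))) =
          (\<Sum>j\<in>UNIV. int (e j * Suc (lookup b' j)) + (if j = i then int (e j) else 0))"
        by (intro sum.cong) (auto simp: b lookup_add lookup_single when_def algebra_simps)
      then show ?thesis by (simp add: y_deg_def sum.distrib)
    qed
    moreover have "lookup (mvar i * dual r) b = lookup (dual r) b'"
      unfolding mv lookup_monom_mult b'_def using False by (auto simp: lookup_single when_def)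
    ultimately show ?thesis
      using y_nz[of i] by (simp add: lookup_dual hc emb_mult)
  qed
qed

lemma dual_subst: "r \<in> S \<Longrightarrow> dual (poly_subst y t * r) = t * dual r"
proof (induction t arbitrary: r rule: mpoly_induct)
  case (const c)
  then show ?case by (simp add: dual_const)
next
  case (var i)
  then show ?case by (simp add: dual_var)
next
  case (add p q)
  then show ?case by (simp add: poly_subst_add distrib_right dual_add)
next
  case (mult p q)
  then show ?case by (simp add: poly_subst_mult mult.assoc S_mult S_subst)
qed

definition const_exp :: "nat \<Rightarrow> 'n \<Rightarrow>\<^sub>0 nat" where
  "const_exp d = (\<Sum>i\<in>UNIV. single i d)"

lemma lookup_const_exp: "lookup (const_exp d) i = d"
  by (simp add: const_exp_def lookup_sum lookup_single when_def)

text \<open>The way back from the polynomial to \<open>\<mu>\<close>: with equal exponents the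
  denominator is a power of \<open>Y\<close>, so \<open>dual\<close> determines \<open>\<mu>\<close>
  on every fraction of degree \<open>k\<close> whose denominator is a positive power of
  \<open>Y\<close>.\<close>

lemma lookup_dual_const_exp:
  assumes "homogeneous j r" "int j - int (Suc d * E) = k"
  shows "lookup (dual r) (const_exp d) = \<mu> (emb r / emb Y ^ Suc d)"
proof -
  have "y_deg k (const_exp d) = k + int (Suc d * E)"
    by (simp add: y_deg_def E_def lookup_const_exp sum_distrib_left mult.commute)
  then have "hcomp (y_deg k (const_exp d)) r = r"
    using assms by (simp add: hcomp_homogeneous)
  moreover have "y_denom (const_exp d) = emb Y ^ Suc d"
    by (simp add: y_denom_def lookup_const_exp cech_prod_def emb_prod prod.distrib
        flip: prod_power_distrib)
  ultimately show ?thesis by (simp add: lookup_dual)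
qed

end

section \<open>Extension of the automorphism to the fraction field\<close>

context finite_order_endo
begin

lemma f_eq_0_iff [simp]: "f x = 0 \<longleftrightarrow> x = 0"
proof
  assume "f x = 0"
  then have "(f ^^ (q - 1)) (f x) = 0" by (simp add: pow_zero)
  moreover have "(f ^^ (q - 1)) (f x) = (f ^^ Suc (q - 1)) x"
    by (simp only: funpow_Suc_right comp_apply)
  ultimately show "x = 0" using q order[of x] by simp
qed (simp add: zero)

text \<open>The description is unique because \<open>f\<close> is injective, being of finite order:
  denominators stay nonzero, and equality of fractions is preserved by cross-multiplication.\<close>

definition frac :: "'a fract \<Rightarrow> 'a fract" where
  "frac x = (THE z. \<forall>a b. b \<noteq> 0 \<longrightarrow> x = emb a / emb b \<longrightarrow> z = emb (f a) / emb (f b))"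

lemma frac_eq:
  assumes "b \<noteq> 0"
  shows "frac (emb a / emb b) = emb (f a) / emb (f b)"
  unfolding frac_def
proof (rule the_equality)
  show "\<forall>a' b'. b' \<noteq> 0 \<longrightarrow> emb a / emb b = emb a' / emb b' \<longrightarrow>
      emb (f a) / emb (f b) = emb (f a') / emb (f b')"
  proof (intro allI impI)
    fix a' b' assume *: "b' \<noteq> 0" "emb a / emb b = emb a' / emb b'"
    then have "emb (a * b') = emb (a' * b)"
      using assms by (simp add: frac_eq_eq emb_mult)
    then have "f a * f b' = f a' * f b"
      by (simp only: emb_eq_iff flip: mult)
    then have "emb (f a) * emb (f b') = emb (f a') * emb (f b)"
      by (simp only: flip: emb_mult)
    then show "emb (f a) / emb (f b) = emb (f a') / emb (f b')"
      using assms * by (simp add: frac_eq_eq)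
  qed
qed (use assms in blast)

lemma frac_emb: "frac (emb a) = emb (f a)"
  using frac_eq[of 1 a] by (simp add: one)

lemma fract_emb_cases:
  obtains a b where "x = emb a / emb b" "b \<noteq> (0::'a)"
  by (cases x rule: Fract_cases) (auto simp: Fract_emb)

lemma finite_order_endo_frac: "finite_order_endo frac q"
proof
  fix x z :: "'a fract"
  obtain a b where x: "x = emb a / emb b" "b \<noteq> 0" by (rule fract_emb_cases)
  obtain c d where z: "z = emb c / emb d" "d \<noteq> 0" by (rule fract_emb_cases)
  have "x + z = emb (a * d + c * b) / emb (b * d)"
    using x z by (simp add: add_frac_eq emb_add emb_mult)
  then have "frac (x + z) = emb (f (a * d + c * b)) / emb (f (b * d))"
    using x z by (simp only: frac_eq no_zero_divisors not_False_eq_True)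
  also have "\<dots> = emb (f a) / emb (f b) + emb (f c) / emb (f d)"
    using x z by (simp add: add mult add_frac_eq emb_add emb_mult)
  finally show "frac (x + z) = frac x + frac z"
    using x z by (simp only: frac_eq not_False_eq_True)
  have "x * z = emb (a * c) / emb (b * d)"
    using x z by (simp add: emb_mult)
  then have "frac (x * z) = emb (f (a * c)) / emb (f (b * d))"
    using x z by (simp only: frac_eq no_zero_divisors not_False_eq_True)
  then show "frac (x * z) = frac x * frac z"
    using x z by (simp add: frac_eq mult emb_mult)
next
  show "frac 1 = 1"
    using frac_emb[of 1] by (simp add: one)
next
  fix x :: "'a fract"
  obtain a b where x: "x = emb a / emb b" "b \<noteq> 0" by (rule fract_emb_cases)
  have pow_nz: "(f ^^ l) b \<noteq> 0" for l
    using x(2) by (induction l) auto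
  have "(frac ^^ l) x = emb ((f ^^ l) a) / emb ((f ^^ l) b)" for l
    by (induction l) (simp_all add: x frac_eq pow_nz)
  then show "(frac ^^ q) x = x"
    by (simp add: order x)
qed (rule q)

text \<open>Under an invariant functional the adjoint of \<open>f ^^ i\<close> is
  \<open>f ^^ (q - i)\<close>; summed up, the trace is its own adjoint.\<close>

lemma tr_reverse: "(\<Sum>i<q. (f ^^ (q - i)) x) = tr x"
proof -
  have "(\<Sum>i<q. (f ^^ (q - i)) x) = (\<Sum>i<q. (f ^^ Suc (q - Suc i)) x)"
    by (intro sum.cong) (auto simp: Suc_diff_Suc simp del: funpow.simps)
  also have "\<dots> = (\<Sum>i<q. (f ^^ Suc i) x)"
    by (rule sum.nat_diff_reindex)
  also have "\<dots> = f (tr x)"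
    by (simp add: tr_def sum)
  finally show ?thesis by (simp add: f_tr)
qed

end

section \<open>Homogeneous elements of the localization at the product of the parameters\<close>

context cech_data
begin

lemma E_pos: "E > 0"
  unfolding E_def using e_pos by (simp add: sum_pos)

text \<open>As \<open>Y\<close> is nonzero, its degree is unique and the quantified degree of the
  denominator can only be \<open>E\<close>.\<close>

lemma localized_deg_eq:
  "localized_deg S Y k = {emb r / emb Y ^ d | r d j. r \<in> S \<and> homogeneous j r \<and> int j - int (d * E) = k}"
proof -
  have "e' = E" if "homogeneous e' Y" for e'
    using homogeneous_unique[OF that Y_hom Y_nz] .
  then show ?thesis
    unfolding localized_deg_def Fract_emb emb_power using Y_hom by blast
qed

lemma localized_deg_memI:
  "r \<in> S \<Longrightarrow> homogeneous j r \<Longrightarrow> int j - int (d * E) = k \<Longrightarrow> emb r / emb Y ^ d \<in> localized_deg S Y k"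
  unfolding localized_deg_eq by blast

lemma emb_Y_nz: "emb Y \<noteq> 0"
  by (simp add: Y_nz)

lemma emb_divide_Y_shift: "emb r / emb Y ^ d = emb (r * Y ^ l) / emb Y ^ (d + l)"
  using emb_Y_nz by (simp add: emb_mult emb_power power_add)

lemma homogeneous_Y_shift: "homogeneous j r \<Longrightarrow> homogeneous (j + l * E) (r * Y ^ l)"
  by (intro homogeneous_mult homogeneous_power Y_hom)

lemma subspace_localized_deg: "fract_vs.subspace (localized_deg S Y k)"
proof (rule fract_vs.subspaceI)
  \<comment> \<open>To exhibit \<open>0\<close> in degree \<open>k\<close>, numerator degrees being
    natural numbers, the pole order is taken to be \<open>\<bar>k\<bar>\<close>; since
    \<open>E \<ge> 1\<close>, the numerator degree is then nonnegative.\<close>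
  have "int (nat (k + \<bar>k\<bar> * int E)) = k + \<bar>k\<bar> * int E"
  proof -
    have "\<bar>k\<bar> * 1 \<le> \<bar>k\<bar> * int E"
      using E_pos by (intro mult_left_mono) auto
    then show ?thesis by simp
  qed
  then show "0 \<in> localized_deg S Y k"
    using localized_deg_memI[OF S_0 homogeneous_0, of "nat (k + \<bar>k\<bar> * int E)" "nat \<bar>k\<bar>" k]
    by simp
next
  fix x z assume "x \<in> localized_deg S Y k" "z \<in> localized_deg S Y k"
  then obtain r d j r' d' j' where x: "x = emb r / emb Y ^ d" "r \<in> S" "homogeneous j r" "int j - int (d * E) = k"
    and z: "z = emb r' / emb Y ^ d'" "r' \<in> S" "homogeneous j' r'" "int j' - int (d' * E) = k"
    unfolding localized_deg_eq by blast
  have "x + z = emb (r * Y ^ d' + r' * Y ^ d) / emb Y ^ (d + d')"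
    unfolding x(1) z(1) emb_divide_Y_shift[of r d d'] emb_divide_Y_shift[of r' d' d]
    by (simp add: emb_add add_divide_distrib add.commute)
  moreover have "r * Y ^ d' + r' * Y ^ d \<in> S"
    using x z by (intro S_add S_mult S_power Y_in) auto
  moreover have "j + d' * E = j' + d * E"
  proof -
    have "int (j + d' * E) = int (j' + d * E)"
      using x(4) z(4) by simp
    then show ?thesis by (simp only: of_nat_eq_iff)
  qed
  then have "homogeneous (j + d' * E) (r * Y ^ d' + r' * Y ^ d)"
    using homogeneous_Y_shift[OF x(3), of d'] homogeneous_Y_shift[OF z(3), of d]
    by (auto intro: homogeneous_add)
  moreover have "int (j + d' * E) - int ((d + d') * E) = k"
    using x(4) by (simp add: algebra_simps)
  ultimately show "x + z \<in> localized_deg S Y k"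
    by (simp only:) (rule localized_deg_memI)
next
  fix c x assume "x \<in> localized_deg S Y k"
  then obtain r d j where x: "x = emb r / emb Y ^ d" "r \<in> S" "homogeneous j r" "int j - int (d * E) = k"
    unfolding localized_deg_eq by blast
  have eq: "emb (mconst c) * x = emb (mconst c * r) / emb Y ^ d"
    by (simp add: x emb_mult)
  have "homogeneous j (mconst c * r)"
    using homogeneous_mult[OF homogeneous_mconst x(3)] by simp
  then show "emb (mconst c) * x \<in> localized_deg S Y k"
    unfolding eq by (rule localized_deg_memI[OF S_mult[OF S_const x(2)] _ x(4)])
qed

lemma y_denom_memI:
  assumes "h \<in> S" "homogeneous j h" "int j = y_deg k b"
  shows "emb h / y_denom b \<in> localized_deg S Y k"
proof -
  define L where "L = (\<Sum>i\<in>UNIV. Suc (lookup b i))"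
  have bL: "Suc (lookup b i) \<le> L" for i
    unfolding L_def by (rule member_le_sum) auto
  define P where "P = (\<Prod>i\<in>UNIV. y i ^ (L - Suc (lookup b i)))"
  have "y_denom b * emb P = (\<Prod>i\<in>UNIV. emb (y i) ^ Suc (lookup b i) * emb (y i) ^ (L - Suc (lookup b i)))"
    by (simp only: y_denom_def P_def emb_prod emb_power prod.distrib)
  also have "\<dots> = (\<Prod>i\<in>UNIV. emb (y i) ^ L)"
    using bL by (simp only: power_add[symmetric] le_add_diff_inverse)
  also have "\<dots> = emb Y ^ L"
    by (simp add: cech_prod_def emb_prod prod_power_distrib)
  finally have denom: "y_denom b * emb P = emb Y ^ L" .
  have "P \<noteq> 0"
    by (simp add: P_def y_nz)
  then have eq: "emb h / y_denom b = emb (h * P) / emb Y ^ L"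
    unfolding denom[symmetric] emb_mult by simp
  have "homogeneous (j + (\<Sum>i\<in>UNIV. (L - Suc (lookup b i)) * e i)) (h * P)"
    unfolding P_def by (intro homogeneous_mult assms homogeneous_prod homogeneous_power y_hom)
  moreover have "int (j + (\<Sum>i\<in>UNIV. (L - Suc (lookup b i)) * e i)) - int (L * E) = k"
  proof -
    have "int ((L - Suc (lookup b i)) * e i) = int (L * e i) - int (e i * Suc (lookup b i))" for i
      using bL[of i] by (simp only: diff_mult_distrib of_nat_diff mult_le_mono1 mult.commute[of "e i"])
    then have "int (\<Sum>i\<in>UNIV. (L - Suc (lookup b i)) * e i) = int (L * E) - (\<Sum>i\<in>UNIV. int (e i * Suc (lookup b i)))"
      by (simp only: of_nat_sum sum_subtractf sum_distrib_left E_def)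
    then show ?thesis
      using assms(3) by (simp add: y_deg_def)
  qed
  moreover have "h * P \<in> S"
    unfolding P_def by (intro S_mult assms S_prod S_power y_in)
  ultimately show ?thesis
    unfolding eq by (intro localized_deg_memI)
qed

lemma hcomp_y_denom_mem:
  assumes "r \<in> S"
  shows "emb (hcomp (y_deg k b) r) / y_denom b \<in> localized_deg S Y k"
proof (cases "y_deg k b < 0")
  case True
  then show ?thesis
    using fract_vs.subspace_0[OF subspace_localized_deg] by (simp add: hcomp_neg)
next
  case False
  then show ?thesis
    by (intro y_denom_memI[of _ "nat (y_deg k b)"] S_hcomp assms homogeneous_hcomp) auto
qed

end

section \<open>The trace on top Cech cohomology\<close>

lemma (in finite_order_endo) tr_frac:
  assumes "f b = b" "b \<noteq> 0"
  shows "finite_order_endo.tr frac q (emb a / emb b) = emb (tr a) / emb b"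
proof -
  interpret F: finite_order_endo frac q by (rule finite_order_endo_frac)
  have "(frac ^^ l) (emb a / emb b) = emb ((f ^^ l) a) / emb b" for l
    by (induction l) (simp_all add: frac_eq assms)
  then show ?thesis
    by (simp add: F.tr_def tr_def emb_sum sum_divide_distrib)
qed

text \<open>Used with \<open>g\<close> the trace, with \<open>g\<close> the difference of the
  automorphism and the identity, and with the identity map itself.\<close>

lemma subspace_image_plus:
  fixes D W :: "('n::{finite,linorder}, 'k::field) mpoly fract set"
  assumes D: "fract_vs.subspace D" and W: "fract_vs.subspace W"
    and add: "\<And>x z. g (x + z) = g x + g z"
    and scale: "\<And>c x. g (emb (mconst c) * x) = emb (mconst c) * g x"
  shows "fract_vs.subspace {g u + w | u w. u \<in> D \<and> w \<in> W}"
proof (rule fract_vs.subspaceI)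
  have "g 0 = 0" using scale[of 0 0] by simp
  then show "0 \<in> {g u + w | u w. u \<in> D \<and> w \<in> W}"
    using fract_vs.subspace_0[OF D] fract_vs.subspace_0[OF W] by force
  fix x assume "x \<in> {g u + w | u w. u \<in> D \<and> w \<in> W}"
  then obtain u w where x: "x = g u + w" "u \<in> D" "w \<in> W" by blast
  show "emb (mconst c) * x \<in> {g u + w | u w. u \<in> D \<and> w \<in> W}" for c
    using x fract_vs.subspace_scale[OF D x(2), of c] fract_vs.subspace_scale[OF W x(3), of c]
    unfolding x(1) distrib_left scale[symmetric] by blast
  fix z assume "z \<in> {g u + w | u w. u \<in> D \<and> w \<in> W}"
  then obtain u' w' where z: "z = g u' + w'" "u' \<in> D" "w' \<in> W" by blast
  have "x + z = g (u + u') + (w + w')"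
    by (simp add: x z add ac_simps)
  then show "x + z \<in> {g u + w | u w. u \<in> D \<and> w \<in> W}"
    using fract_vs.subspace_add[OF D x(2) z(2)] fract_vs.subspace_add[OF W x(3) z(3)] by blast
qed

text \<open>The assumption \<open>variable_free\<close> is all that the comparison retains from the
  absence of transvections; it is the conclusion of \<open>variable_free_trace\<close>.\<close>

locale cyclic_cech =
  fixes y :: "'n::{finite,linorder} \<Rightarrow> ('n, 'k::field) mpoly" and e :: "'n \<Rightarrow> nat"
    and A :: "'k ^ 'n::{finite,linorder} ^ 'n::{finite,linorder}" and N :: nat
  assumes hom: "homogeneous (e i) (y i)" and pos: "e i > 0" and nz: "y i \<noteq> 0"
    and N_pos: "N > 0" and A_order: "(lin_act A ^^ N) p = p"
    and y_fixed: "lin_act A (y i) = y i"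
    and variable_free: "\<exists>t c. t \<noteq> 0 \<and> (\<forall>m\<in>keys t. lookup m i = 0) \<and>
      poly_subst y t = (\<Sum>l<N. (lin_act A ^^ l) c)"
begin

abbreviation "f \<equiv> lin_act A"
abbreviation "RG \<equiv> {p. f p = p}"

lemma hcomp_f: "hcomp d (f p) = f (hcomp d p)"
  unfolding lin_act_eq
proof (rule hcomp_poly_subst)
  show "homogeneous 1 (\<Sum>j\<in>UNIV. mconst (A $ i $ j) * mvar j)" for i
    using homogeneous_mult[OF homogeneous_mconst homogeneous_mvar]
    by (intro homogeneous_sum) simp
qed

sublocale f: finite_order_endo f N
  by unfold_locales (simp_all add: lin_act_add lin_act_times N_pos A_order)

sublocale F: finite_order_endo f.frac N
  by (rule f.finite_order_endo_frac)

sublocale U: cech_data y e UNIV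
  by unfold_locales (simp_all add: hom pos nz)

sublocale I: cech_data y e RG
  by unfold_locales
    (simp_all add: hom pos nz y_fixed lin_act_add lin_act_times hcomp_f[symmetric])

abbreviation "Y \<equiv> cech_prod y"

lemma variable_free_tr:
  "\<exists>t c. t \<noteq> 0 \<and> (\<forall>m\<in>keys t. lookup m i = 0) \<and> poly_subst y t = f.tr c"
  using variable_free by (simp add: f.tr_def)

lemma f_Y: "f Y = Y"
  using I.Y_in by simp

lemma F_div: "b \<noteq> 0 \<Longrightarrow> f b = b \<Longrightarrow> f.frac (emb r / emb b) = emb (f r) / emb b"
  by (simp add: f.frac_eq)

lemma F_tr_div: "F.tr (emb r / emb Y ^ d) = emb (f.tr r) / emb Y ^ d"
proof -
  have "f (Y ^ d) = Y ^ d"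
    by (induction d) (simp_all add: lin_act_times f_Y)
  then show ?thesis
    using f.tr_frac[of "Y ^ d" r] U.Y_nz by (simp add: emb_power)
qed

lemma hcomp_tr: "hcomp d (f.tr p) = f.tr (hcomp d p)"
proof -
  have "hcomp d ((f ^^ l) p) = (f ^^ l) (hcomp d p)" for l
    by (induction l) (simp_all add: hcomp_f)
  then show ?thesis by (simp add: f.tr_def hcomp_sum)
qed

lemma F_const: "f.frac (emb (mconst c) * x) = emb (mconst c) * f.frac x"
  by (simp add: F.mult f.frac_emb)

lemma F_tr_const: "F.tr (emb (mconst c) * x) = emb (mconst c) * F.tr x"
  using F.tr_mult_fixed[of "emb (mconst c)" x] by (simp add: f.frac_emb mult.commute)

lemma y_denom_eq: "\<exists>D. D \<noteq> 0 \<and> f D = D \<and> U.y_denom b = emb D \<and> I.y_denom b = emb D"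
proof (intro exI conjI)
  show "(\<Prod>i\<in>UNIV. y i ^ Suc (lookup b i)) \<noteq> 0"
    by (simp add: nz)
  have "(\<Prod>i\<in>UNIV. y i ^ Suc (lookup b i)) \<in> RG"
    by (intro I.S_prod I.S_power I.y_in)
  then show "f (\<Prod>i\<in>UNIV. y i ^ Suc (lookup b i)) = (\<Prod>i\<in>UNIV. y i ^ Suc (lookup b i))"
    by (simp only: mem_Collect_eq)
qed (simp_all only: U.y_denom_def I.y_denom_def emb_prod emb_power)

text \<open>The trace from R to R^G need not be onto, but one nonzero element \<open>t\<close> of
  K[y] kills its cokernel, which top cohomology does not see. On functionals: if
  \<open>\<mu>\<close> vanishes on traces, \<open>t * M.dual a\<close> is the dual of a trace for
  invariant \<open>a\<close>, hence zero, and \<open>t\<close> can be cancelled.\<close>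

lemma trace_surjective:
  assumes x: "x \<in> localized_deg RG Y k"
  shows "\<exists>u\<in>localized_deg UNIV Y k. \<exists>w\<in>cech_boundaries y RG. x = F.tr u + w"
proof (rule ccontr)
  assume neg: "\<not> ?thesis"
  define V where "V = {F.tr u + w | u w. u \<in> localized_deg UNIV Y k \<and> w \<in> cech_boundaries y RG}"
  have V: "fract_vs.subspace V"
    unfolding V_def
    by (intro subspace_image_plus U.subspace_localized_deg I.subspace_bd F.tr_add F_tr_const)
  have not_V: "x \<notin> V"
    using neg by (auto simp: V_def)
  obtain \<mu> where \<mu>: "\<forall>x z. \<mu> (x + z) = \<mu> x + \<mu> z"
    "\<forall>c x. \<mu> (emb (mconst c) * x) = c * \<mu> x" "\<forall>x\<in>V. \<mu> x = 0" "\<mu> x = 1"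
    using separating_functional[OF V not_V] by blast
  have tr0: "F.tr u \<in> V" if "u \<in> localized_deg UNIV Y k" for u
    using that fract_vs.subspace_0[OF I.subspace_bd] unfolding V_def by force
  have bd0: "w \<in> V" if "w \<in> cech_boundaries y RG" for w
    using that fract_vs.subspace_0[OF U.subspace_localized_deg[of k]] F.tr_zero unfolding V_def by force
  interpret M: cech_functional y e RG \<mu> k
    by unfold_locales (simp_all add: \<mu> bd0)
  have dual_tr: "M.dual (f.tr r) = 0" for r
  proof (rule poly_mapping_eqI)
    fix b
    define h where "h = hcomp (U.y_deg k b) r"
    obtain D where D: "D \<noteq> 0" "f D = D" "U.y_denom b = emb D" "I.y_denom b = emb D"
      using y_denom_eq by blast
    have "U.y_deg k b = I.y_deg k b"
      by (simp only: U.y_deg_def I.y_deg_def)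
    then have "lookup (M.dual (f.tr r)) b = \<mu> (emb (f.tr h) / emb D)"
      unfolding M.lookup_dual D(4) by (simp add: h_def hcomp_tr)
    also have "emb (f.tr h) / emb D = F.tr (emb h / emb D)"
      by (rule f.tr_frac[symmetric]) (use D in auto)
    also have "\<mu> \<dots> = 0"
      unfolding D(3)[symmetric] h_def by (intro bspec[OF \<mu>(3)] tr0 U.hcomp_y_denom_mem UNIV_I)
    finally show "lookup (M.dual (f.tr r)) b = lookup 0 b" by simp
  qed
  obtain t c where tc: "t \<noteq> 0" "poly_subst y t = f.tr c"
    using variable_free_tr by blast
  have dual0: "M.dual a = 0" if "a \<in> RG" for a
  proof -
    have "t * M.dual a = M.dual (f.tr c * a)"
      using M.dual_subst[OF that, of t] tc(2) by simp
    also have "f.tr c * a = f.tr (c * a)"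
      using that by (simp add: f.tr_mult_fixed)
    finally show ?thesis using tc(1) by (simp add: dual_tr)
  qed
  obtain a d j where a: "x = emb a / emb Y ^ d" "a \<in> RG" "homogeneous j a" "int j - int (d * I.E) = k"
    using x unfolding I.localized_deg_eq by blast
  \<comment> \<open>The pole order may be zero, whereas a coefficient of the dual polynomial belongs
    to a positive one; hence one extra factor \<open>Y\<close>.\<close>
  have "x = emb (a * Y ^ 1) / emb Y ^ Suc d"
    unfolding a(1) I.emb_divide_Y_shift[of a d 1] by simp
  moreover have "lookup (M.dual (a * Y ^ 1)) (M.const_exp d) = \<mu> (emb (a * Y ^ 1) / emb Y ^ Suc d)"
    using a(4) by (intro M.lookup_dual_const_exp[OF I.homogeneous_Y_shift[OF a(3)]]) (simp add: algebra_simps)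
  moreover have "a * Y ^ 1 \<in> RG"
    using a(2) I.Y_in by (simp add: lin_act_times)
  ultimately show False
    using dual0 \<mu>(4) by simp
qed

text \<open>Let \<open>\<mu>\<close> separate \<open>u\<close> from the elements of the stated form.
  With denominators cleared, the hypothesis on \<open>F.tr u\<close> reads
  \<open>f.tr r' = (\<Sum>i\<in>UNIV. y i ^ Suc M * b i)\<close> with invariant \<open>b i\<close>.
  The functional induced on the invariants then puts \<open>M.dual r'\<close> into the ideal of the
  powers \<open>mvar i ^ Suc M\<close>, so its coefficient at \<open>M.const_exp M\<close> is zero.
  This coefficient is \<open>\<mu> u = 1\<close>.\<close>

lemma trace_kernel:
  assumes u: "u \<in> localized_deg UNIV Y k" and tr_u: "F.tr u \<in> cech_boundaries y RG"
  shows "\<exists>v\<in>localized_deg UNIV Y k. \<exists>w\<in>cech_boundaries y UNIV. u = (f.frac v - v) + w"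
proof (rule ccontr)
  assume neg: "\<not> ?thesis"
  define V where "V = {(f.frac v - v) + w | v w. v \<in> localized_deg UNIV Y k \<and> w \<in> cech_boundaries y UNIV}"
  have V: "fract_vs.subspace V"
    unfolding V_def
    by (intro subspace_image_plus U.subspace_localized_deg U.subspace_bd)
      (simp_all add: F.add F_const right_diff_distrib)
  have not_V: "u \<notin> V"
    using neg by (auto simp: V_def)
  obtain \<mu> where \<mu>: "\<forall>x z. \<mu> (x + z) = \<mu> x + \<mu> z"
    "\<forall>c x. \<mu> (emb (mconst c) * x) = c * \<mu> x" "\<forall>x\<in>V. \<mu> x = 0" "\<mu> u = 1"
    using separating_functional[OF V not_V] by blast
  have F0: "f.frac v - v \<in> V" if "v \<in> localized_deg UNIV Y k" for v
    using that fract_vs.subspace_0[OF U.subspace_bd] unfolding V_def by force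
  have bd0: "w \<in> V" if "w \<in> cech_boundaries y UNIV" for w
    using that fract_vs.subspace_0[OF U.subspace_localized_deg[of k]] F.zero unfolding V_def by force
  interpret M: cech_functional y e UNIV \<mu> k
    by unfold_locales (simp_all add: \<mu> bd0)
  have dual_f: "M.dual (f r) = M.dual r" for r
  proof (rule poly_mapping_eqI)
    fix b
    define h where "h = hcomp (U.y_deg k b) r"
    obtain D where D: "D \<noteq> 0" "f D = D" "U.y_denom b = emb D"
      using y_denom_eq by blast
    define v where "v = emb h / emb D"
    have "v \<in> localized_deg UNIV Y k"
      unfolding v_def D(3)[symmetric] h_def by (intro U.hcomp_y_denom_mem UNIV_I)
    then have "\<mu> (f.frac v - v) = 0"
      by (intro bspec[OF \<mu>(3)] F0)
    moreover have "\<mu> (f.frac v) = \<mu> (f.frac v - v) + \<mu> v"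
      using \<mu>(1) by (metis diff_add_cancel)
    moreover have "lookup (M.dual (f r)) b = \<mu> (f.frac v)"
      unfolding M.lookup_dual D(3) v_def by (simp only: hcomp_f h_def F_div[OF D(1,2)])
    moreover have "lookup (M.dual r) b = \<mu> v"
      unfolding M.lookup_dual D(3) v_def h_def ..
    ultimately show "lookup (M.dual (f r)) b = lookup (M.dual r) b" by simp
  qed
  have dual_pow: "M.dual ((f ^^ l) r) = M.dual r" for l r
    by (induction l) (simp_all add: dual_f)
  \<comment> \<open>Since \<open>M.dual\<close> is invariant, applying \<open>f ^^ (N - l)\<close>
    to the whole product moves \<open>f ^^ l\<close> from the first factor to the second.\<close>
  have adjoint: "M.dual (f.tr x * z) = M.dual (x * f.tr z)" for x z
  proof -
    have "M.dual ((f ^^ l) x * z) = M.dual (x * (f ^^ (N - l)) z)" if "l < N" for l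
    proof -
      have "(f ^^ (N - l)) ((f ^^ l) x) = x"
        using that A_order[of x] by (simp flip: funpow_add[THEN fun_cong, unfolded comp_apply])
      then have "x * (f ^^ (N - l)) z = (f ^^ (N - l)) ((f ^^ l) x * z)"
        by (simp only: f.pow_mult)
      then show ?thesis by (simp only: dual_pow)
    qed
    then have "M.dual (f.tr x * z) = (\<Sum>l<N. M.dual (x * (f ^^ (N - l)) z))"
      unfolding f.tr_def sum_distrib_right M.dual_sum by (intro sum.cong) auto
    also have "\<dots> = M.dual (x * (\<Sum>l<N. (f ^^ (N - l)) z))"
      by (simp only: M.dual_sum sum_distrib_left)
    finally show ?thesis by (simp only: f.tr_reverse)
  qed
  have dual_subst: "M.dual (poly_subst y t * r) = t * M.dual r" for t r
    by (rule M.dual_subst) simp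
  obtain s s' where s: "s \<noteq> 0" "poly_subst y s = f.tr s'"
    using variable_free_tr by blast
  have s_dvd: "s dvd M.dual (s' * a)" if a: "a \<in> RG" for a
  proof (rule dvd_if_dvd_mult_variable_free[OF s(1)])
    fix i
    obtain t c where t: "t \<noteq> 0" "\<forall>m\<in>keys t. lookup m i = 0" "poly_subst y t = f.tr c"
      using variable_free_tr by blast
    have "t * M.dual (s' * a) = M.dual (f.tr c * (s' * a))"
      by (simp only: t(3) flip: dual_subst)
    also have "\<dots> = M.dual (c * f.tr (s' * a))"
      by (rule adjoint)
    also have "f.tr (s' * a) = f.tr s' * a"
      using a by (intro f.tr_mult_fixed) simp
    also have "c * (f.tr s' * a) = poly_subst y s * (c * a)"
      by (simp only: s(2) ac_simps)
    also have "M.dual \<dots> = s * M.dual (c * a)"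
      by (rule dual_subst)
    finally have "s dvd t * M.dual (s' * a)"
      by simp
    then show "\<exists>t. t \<noteq> 0 \<and> (\<forall>m\<in>keys t. lookup m i = 0) \<and> s dvd t * M.dual (s' * a)"
      using t by blast
  qed
  obtain r d j where r: "u = emb r / emb Y ^ d" "homogeneous j r" "int j - int (d * U.E) = k"
    using u unfolding U.localized_deg_eq by blast
  obtain w where w: "F.tr u = (\<Sum>i\<in>UNIV. w i)" "\<And>i. w i \<in> localized RG (\<Prod>l\<in>UNIV - {i}. y l)"
    using tr_u unfolding cech_boundaries_def by blast
  have "\<forall>i. \<exists>a d. w i = emb a / emb (\<Prod>l\<in>UNIV - {i}. y l) ^ d \<and> a \<in> RG"
    using w(2) unfolding localized_eq by blast
  from choice[OF this] obtain a
    where "\<forall>i. \<exists>d. w i = emb (a i) / emb (\<Prod>l\<in>UNIV - {i}. y l) ^ d \<and> a i \<in> RG" ..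
  from choice[OF this] obtain ds where "\<forall>i. w i = emb (a i) / emb (\<Prod>l\<in>UNIV - {i}. y l) ^ ds i \<and> a i \<in> RG" ..
  then have a: "w i = emb (a i) / emb (\<Prod>l\<in>UNIV - {i}. y l) ^ ds i" "a i \<in> RG" for i
    by simp_all
  \<comment> \<open>One exponent that dominates the pole orders of \<open>u\<close> and of all
    boundary terms, so that everything is written over \<open>Y ^ Suc M\<close>.\<close>
  define M where "M = d + (\<Sum>i\<in>UNIV. ds i)"
  have M: "d \<le> Suc M" "ds i \<le> Suc M" for i
    using member_le_sum[of i UNIV ds] by (auto simp: M_def)
  define b where "b i = a i * (\<Prod>l\<in>UNIV - {i}. y l) ^ (Suc M - ds i)" for i
  have b_inv: "b i \<in> RG" for i
    unfolding b_def by (intro I.S_mult a I.S_power I.S_prod I.y_in)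
  define r' where "r' = r * Y ^ (Suc M - d)"
  have u_eq: "u = emb r' / emb Y ^ Suc M"
    unfolding r(1) r'_def U.emb_divide_Y_shift[of r d "Suc M - d"] using M(1) by simp
  have "emb (f.tr r') = F.tr u * emb Y ^ Suc M"
    unfolding u_eq F_tr_div using U.emb_Y_nz by simp
  also have "\<dots> = (\<Sum>i\<in>UNIV. emb (y i ^ Suc M * b i))"
    unfolding w(1) sum_distrib_right
  proof (intro sum.cong refl)
    fix i
    define Q where "Q = (\<Prod>l\<in>UNIV - {i}. y l)"
    have Q: "Q \<noteq> 0" by (simp add: Q_def nz)
    have Y: "Y = y i * Q"
      unfolding cech_prod_def Q_def by (simp add: prod.remove)
    have "emb Q ^ Suc M = emb Q ^ ds i * emb Q ^ (Suc M - ds i)"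
      using M(2)[of i] by (simp only: power_add[symmetric] le_add_diff_inverse)
    then show "w i * emb Y ^ Suc M = emb (y i ^ Suc M * b i)"
      unfolding a(1) b_def Q_def[symmetric] Y emb_mult emb_power power_mult_distrib
      using Q by simp
  qed
  also have "\<dots> = emb (\<Sum>i\<in>UNIV. y i ^ Suc M * b i)"
    by (simp only: emb_sum)
  finally have tr_r': "f.tr r' = (\<Sum>i\<in>UNIV. y i ^ Suc M * b i)"
    by simp
  have "\<exists>g. M.dual (s' * b i) = s * g" for i
    using s_dvd[OF b_inv[of i]] by (elim dvdE) blast
  \<comment> \<open>Here \<open>g i\<close> is the value at \<open>b i\<close> of the functional
    induced on the invariants.\<close>
  then obtain g where g: "\<And>i. M.dual (s' * b i) = s * g i" by metis
  have "s * M.dual r' = M.dual (f.tr s' * r')"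
    by (simp only: s(2) flip: dual_subst)
  also have "\<dots> = M.dual (s' * f.tr r')"
    by (rule adjoint)
  also have "s' * f.tr r' = (\<Sum>i\<in>UNIV. poly_subst y (mvar i ^ Suc M) * (s' * b i))"
    by (simp only: tr_r' sum_distrib_left poly_subst_power poly_subst_mvar mult.left_commute)
  also have "M.dual \<dots> = (\<Sum>i\<in>UNIV. mvar i ^ Suc M * (s * g i))"
    by (simp only: M.dual_sum dual_subst g)
  also have "\<dots> = s * (\<Sum>i\<in>UNIV. mvar i ^ Suc M * g i)"
    by (simp only: sum_distrib_left mult.left_commute)
  finally have dual_r': "M.dual r' = (\<Sum>i\<in>UNIV. mvar i ^ Suc M * g i)"
    using s(1) by simp
  \<comment> \<open>Every exponent of \<open>M.const_exp M\<close> is \<open>M\<close>, one short of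
    what divisibility by \<open>mvar i ^ Suc M\<close> demands.\<close>
  have "lookup (mvar i ^ Suc M * g i) (M.const_exp M) = 0" for i
  proof -
    have "\<not> lookup (single i (Suc M)) i \<le> lookup (M.const_exp M) i"
      by (simp add: M.lookup_const_exp)
    then have "\<not> (\<forall>l. lookup (single i (Suc M)) l \<le> lookup (M.const_exp M) l)"
      by blast
    then show ?thesis
      unfolding mvar_power lookup_monom_mult by (rule if_not_P)
  qed
  then have "lookup (M.dual r') (M.const_exp M) = 0"
    by (simp only: dual_r' lookup_sum sum.neutral_const)
  moreover have "lookup (M.dual r') (M.const_exp M) = \<mu> (emb r' / emb Y ^ Suc M)"
  proof (rule M.lookup_dual_const_exp)
    show "homogeneous (j + (Suc M - d) * U.E) r'"
      unfolding r'_def by (rule U.homogeneous_Y_shift[OF r(2)])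
    have "int ((Suc M - d) * U.E) = int (Suc M * U.E) - int (d * U.E)"
      using M(1) by (simp only: diff_mult_distrib of_nat_diff mult_le_mono1)
    then show "int (j + (Suc M - d) * U.E) - int (Suc M * U.E) = k"
      using r(3) by simp
  qed
  ultimately show False
    using \<mu>(4) u_eq by simp
qed

end

section \<open>Finiteness of the graded pieces\<close>

lemma lookup_mult_0:
  fixes p q :: "('n::finite, 'k::field) mpoly"
  shows "lookup (p * q) 0 = lookup p 0 * lookup q 0"
proof (induction p rule: mpoly_add_induct)
  case (single a b)
  have eq: "single a b * q = mconst b * (single a 1 * q)"
    by (simp add: mconst_def mult_single flip: mult.assoc)
  have "a = 0 \<longleftrightarrow> (\<forall>i. lookup a i \<le> 0)"
    by (auto intro: poly_mapping_eqI)
  then show ?case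
    unfolding eq lookup_mconst_mult lookup_monom_mult by (auto simp: lookup_single when_def)
qed (simp_all add: distrib_right lookup_add)

text \<open>The coefficients are integer polynomials in the roots, so every ring homomorphism passes
  through. It serves for \<open>f\<close>, which permutes the roots, and for the constant
  coefficient, which annihilates them.\<close>

lemma linear_factors_hom:
  fixes g :: "'a::comm_ring_1 \<Rightarrow> 'b::comm_ring_1"
  assumes add: "\<And>x y. g (x + y) = g x + g y" and mult: "\<And>x y. g (x * y) = g x * g y"
    and one: "g 1 = 1" and fin: "finite L"
  shows "g (coeff (\<Prod>l\<in>L. [:- v l, 1:]) i) = coeff (\<Prod>l\<in>L. [:- g (v l), 1:]) i"
proof -
  have zero: "g 0 = 0" by (metis add add.right_neutral add_left_cancel)
  have minus: "g (- x) = - g x" for x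
    by (metis add add.right_inverse minus_unique zero)
  have diff: "g (x - z) = g x - g z" for x z
    using add[of x "- z"] by (simp add: minus)
  show ?thesis using fin
  proof (induction L arbitrary: i rule: finite_induct)
    case empty
    then show ?case by (simp add: one zero coeff_1)
  next
    case (insert l L)
    have "g (coeff ([:- v l, 1:] * p) i) = coeff ([:- g (v l), 1:] * p') i"
      if "\<And>i. g (coeff p i) = coeff p' i" for p p'
      by (cases i) (simp_all add: add mult minus diff zero that)
    from this[OF insert.IH] show ?case using insert.hyps by simp
  qed
qed

lemma prod_linear_factors:
  "finite L \<Longrightarrow> degree (\<Prod>l\<in>L. [:- v l, 1:]) = card L \<and> lead_coeff (\<Prod>l\<in>L. [:- v l, 1:]) = (1 :: 'a::idom)"
proof (induction L rule: finite_induct)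
  case (insert l L)
  then have "(\<Prod>l\<in>L. [:- v l, 1:]) \<noteq> 0"
    by (metis leading_coeff_0_iff zero_neq_one)
  then have "degree ([:- v l, 1:] * (\<Prod>l\<in>L. [:- v l, 1:])) = 1 + card L"
    using insert by (subst degree_mult_eq) auto
  moreover have "lead_coeff ([:- v l, 1:] * (\<Prod>l\<in>L. [:- v l, 1:])) = 1"
    unfolding lead_coeff_mult insert.IH[THEN conjunct2] by simp
  ultimately show ?case using insert.hyps by simp
qed simp

text \<open>In the binomial expansion with exponent \<open>s + t\<close>, each term contains the
  \<open>s\<close>-th power of the first summand or the \<open>t\<close>-th power of the
  second.\<close>

lemma radical_sum:
  fixes J :: "'a::comm_ring_1 set"
  assumes add: "\<And>x y. x \<in> J \<Longrightarrow> y \<in> J \<Longrightarrow> x + y \<in> J" and mult: "\<And>x r. x \<in> J \<Longrightarrow> r * x \<in> J"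
    and zero: "0 \<in> J" and fin: "finite I" and p: "\<And>i. i \<in> I \<Longrightarrow> \<exists>t. p i ^ t \<in> J"
  shows "\<exists>t. (\<Sum>i\<in>I. p i) ^ t \<in> J"
  using fin p
proof (induction I rule: finite_induct)
  case empty
  then show ?case using zero by (intro exI[of _ 1]) simp
next
  case (insert i I)
  obtain s where s: "p i ^ s \<in> J" using insert.prems by blast
  obtain t where t: "(\<Sum>i\<in>I. p i) ^ t \<in> J" using insert by blast
  define x where "x = p i"
  define z where "z = (\<Sum>i\<in>I. p i)"
  have sum: "(\<Sum>k\<in>K. h k) \<in> J" if "\<And>k. k \<in> K \<Longrightarrow> h k \<in> J" for h and K :: "nat set"
    using that by (induction K rule: infinite_finite_induct) (auto simp: zero intro: add)
  have "of_nat ((s + t) choose k) * x ^ k * z ^ (s + t - k) \<in> J" if "k \<le> s + t" for k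
  proof (cases "s \<le> k")
    case True
    then have "x ^ k = x ^ (k - s) * x ^ s" by (simp flip: power_add)
    then have "of_nat ((s + t) choose k) * x ^ k * z ^ (s + t - k) =
        (of_nat ((s + t) choose k) * x ^ (k - s) * z ^ (s + t - k)) * x ^ s"
      by (simp only: ac_simps)
    then show ?thesis using mult[OF s] by (simp add: x_def)
  next
    case False
    then have "z ^ (s + t - k) = z ^ (s - k) * z ^ t" by (simp flip: power_add)
    then have "of_nat ((s + t) choose k) * x ^ k * z ^ (s + t - k) =
        (of_nat ((s + t) choose k) * x ^ k * z ^ (s - k)) * z ^ t"
      by (simp only: ac_simps)
    then show ?thesis using mult[OF t] by (simp add: z_def)
  qed
  then have "(x + z) ^ (s + t) \<in> J"
    unfolding binomial_ring by (intro sum) auto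
  then show ?case using insert.hyps by (auto simp: x_def z_def)
qed

definition gen_ideal :: "('n::finite \<Rightarrow> 'a::comm_ring_1) \<Rightarrow> 'a set" where
  "gen_ideal y = range (\<lambda>a. \<Sum>i\<in>UNIV. a i * y i)"

lemma gen_ideal_add: "p \<in> gen_ideal y \<Longrightarrow> q \<in> gen_ideal y \<Longrightarrow> p + q \<in> gen_ideal y"
  unfolding gen_ideal_def
proof safe
  fix a b
  show "(\<Sum>i\<in>UNIV. a i * y i) + (\<Sum>i\<in>UNIV. b i * y i) \<in> range (\<lambda>a. \<Sum>i\<in>UNIV. a i * y i)"
    by (rule range_eqI[of _ _ "\<lambda>i. a i + b i"]) (simp add: distrib_right sum.distrib)
qed

lemma gen_ideal_mult: "p \<in> gen_ideal y \<Longrightarrow> r * p \<in> gen_ideal y"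
  unfolding gen_ideal_def
proof safe
  fix a
  show "r * (\<Sum>i\<in>UNIV. a i * y i) \<in> range (\<lambda>a. \<Sum>i\<in>UNIV. a i * y i)"
    by (rule range_eqI[of _ _ "\<lambda>i. r * a i"]) (simp add: sum_distrib_left mult.assoc)
qed

lemma gen_ideal_0: "0 \<in> gen_ideal y"
  unfolding gen_ideal_def by (rule range_eqI[of _ _ "\<lambda>i. 0"]) simp

context cyclic_cech
begin

lemma homogeneous_f: "homogeneous d p \<Longrightarrow> homogeneous d (f p)"
  using homogeneous_hcomp[of "int d" "f p"] by (simp add: hcomp_f hcomp_homogeneous)

text \<open>Each variable is integral over the invariants, being a root of \<open>\<Prod>l<N. X - f\<^sup>l x\<close>, whose lower
  coefficients lie in the radical of the ideal of the parameters.\<close>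

lemma variable_power_in_ideal:
  assumes rad: "\<And>p. p \<in> RG \<Longrightarrow> lookup p 0 = 0 \<Longrightarrow> \<exists>t. p ^ t \<in> gen_ideal y"
  shows "\<exists>t. mvar i ^ t \<in> gen_ideal y"
proof -
  define x :: "('n, 'k) mpoly" where "x = mvar i"
  define p where "p = (\<Prod>l<N. [:- (f ^^ l) x, 1:])"
  have p: "degree p = N" "coeff p N = 1"
    using prod_linear_factors[of "{..<N}" "\<lambda>l. (f ^^ l) x"] by (auto simp: p_def)
  have "coeff p l \<in> RG" for l
  proof -
    have "f (coeff p l) = coeff (\<Prod>l<N. [:- (f ^^ Suc l) x, 1:]) l"
      unfolding p_def using linear_factors_hom[of f "{..<N}" "\<lambda>l. (f ^^ l) x" l]
      by (simp add: f.add f.mult f.one)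
    also have "(\<Prod>l<N. [:- (f ^^ Suc l) x, 1:]) = p"
    proof -
      \<comment> \<open>Adding the factor for \<open>x\<close> in front gives the product over
        \<open>l < Suc N\<close>. Its last factor belongs to \<open>(f ^^ N) x = x\<close>, so the
        two copies cancel.\<close>
      have "[:- x, 1:] * (\<Prod>l<N. [:- (f ^^ Suc l) x, 1:]) = (\<Prod>l<Suc N. [:- (f ^^ l) x, 1:])"
        by (simp only: prod.lessThan_Suc_shift funpow_0)
      also have "\<dots> = [:- x, 1:] * p"
        unfolding p_def prod.lessThan_Suc by (simp add: f.order mult.commute)
      finally show ?thesis
        by (simp only: mult_cancel_left) simp
    qed
    finally show ?thesis by simp
  qed
  \<comment> \<open>All roots are linear forms; at the origin the polynomial therefore becomes the
    pure power of degree \<open>N\<close>.\<close>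
  moreover have "lookup (coeff p l) 0 = 0" if "l < N" for l
  proof -
    have "homogeneous 1 ((f ^^ l) x)" for l
      by (induction l) (simp_all add: x_def homogeneous_mvar[unfolded One_nat_def] homogeneous_f)
    then have 0: "lookup ((f ^^ l) x) 0 = 0" for l
      unfolding homogeneous_iff by (metis in_keys_iff mdeg_0 zero_neq_one)
    have "lookup (coeff p l) 0 = coeff (\<Prod>l<N. [:- lookup ((f ^^ l) x) 0, 1:]) l"
      unfolding p_def
      by (rule linear_factors_hom) (simp_all add: lookup_add lookup_mult_0 lookup_one)
    also have "\<dots> = coeff ([:0, 1:] ^ N) l"
      by (simp add: 0)
    also have "\<dots> = 0"
      using that by (simp add: coeff_linear_poly_power)
    finally show ?thesis .
  qed
  ultimately have "\<exists>t. coeff p l ^ t \<in> gen_ideal y" if "l < N" for l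
    using rad that by blast
  then have "\<exists>t. (- (x ^ l) * coeff p l) ^ t \<in> gen_ideal y" if "l < N" for l
    unfolding power_mult_distrib using that gen_ideal_mult by blast
  then have "\<exists>t. (\<Sum>l<N. - (x ^ l) * coeff p l) ^ t \<in> gen_ideal y"
    by (intro radical_sum gen_ideal_add gen_ideal_mult gen_ideal_0) auto
  moreover have "(\<Sum>l<N. - (x ^ l) * coeff p l) = x ^ N"
  proof -
    have "poly p x = 0"
      unfolding p_def poly_prod using N_pos by (intro prod_zero) (auto intro!: bexI[of _ 0])
    moreover have "poly p x = (\<Sum>l<N. coeff p l * x ^ l) + x ^ N"
      by (simp add: poly_altdef p lessThan_Suc_atMost[symmetric])
    ultimately show ?thesis
      by (simp add: sum_negf mult.commute add_eq_0_iff)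
  qed
  ultimately obtain t where "(x ^ N) ^ t \<in> gen_ideal y"
    by auto
  then show ?thesis
    unfolding x_def power_mult[symmetric] by blast
qed

text \<open>Pigeonhole: a monomial whose degree exceeds the sum of the \<open>t i\<close> contains
  some \<open>mvar i ^ t i\<close>. Thus R modulo the parameters lives in finitely many
  degrees.\<close>

lemma high_degree_in_ideal:
  assumes rad: "\<And>p. p \<in> RG \<Longrightarrow> lookup p 0 = 0 \<Longrightarrow> \<exists>t. p ^ t \<in> gen_ideal y"
  shows "\<exists>D. \<forall>d\<ge>D. \<forall>p. homogeneous d p \<longrightarrow> p \<in> gen_ideal y"
proof -
  have "\<forall>i. \<exists>t. mvar i ^ t \<in> gen_ideal y"
    using variable_power_in_ideal[OF rad] by blast
  from choice[OF this] obtain t where t: "\<forall>i. mvar i ^ t i \<in> gen_ideal y" ..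
  define D where "D = Suc (\<Sum>i\<in>UNIV. t i)"
  have mono: "single m c \<in> gen_ideal y" if "mdeg m \<ge> D" for m c
  proof -
    have "\<exists>i. t i \<le> lookup m i"
    proof (rule ccontr)
      assume "\<not> ?thesis"
      then have "mdeg m \<le> (\<Sum>i\<in>UNIV. t i)"
        unfolding mdeg_def by (intro sum_mono) (simp add: not_le less_imp_le)
      then show False using that by (simp add: D_def)
    qed
    then obtain i where i: "t i \<le> lookup m i" ..
    have "m = (m - single i (t i)) + single i (t i)"
      using i by (intro poly_mapping_eqI) (auto simp: lookup_add lookup_minus lookup_single when_def)
    then have "single m c = single (m - single i (t i)) c * mvar i ^ t i"
      by (simp add: mvar_power mult_single)
    then show ?thesis by (simp only: gen_ideal_mult[OF spec[OF t]])
  qed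
  have sum: "(\<Sum>k\<in>K. h k) \<in> gen_ideal y" if "\<And>k. k \<in> K \<Longrightarrow> h k \<in> gen_ideal y"
    for h and K :: "('n \<Rightarrow>\<^sub>0 nat) set"
    using that by (induction K rule: infinite_finite_induct) (auto simp: gen_ideal_0 intro: gen_ideal_add)
  have "p \<in> gen_ideal y" if "homogeneous d p" "d \<ge> D" for d p
  proof -
    have "p = (\<Sum>m\<in>keys p. single m (lookup p m))"
      by (rule poly_mapping_eqI)
        (simp add: lookup_sum lookup_single when_def in_keys_iff cong: if_cong)
    also have "\<dots> \<in> gen_ideal y"
      using that by (intro sum mono) (auto simp: homogeneous_iff)
    finally show ?thesis .
  qed
  then show ?thesis by blast
qed

text \<open>In fixed degree \<open>k\<close> a high pole forces a numerator of high degree, which is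
  then a combination of the parameters. Each summand cancels one factor of the denominator and has a
  numerator of smaller degree, so the process ends in fractions with all pole orders at most
  \<open>D\<close> and in boundaries.\<close>

lemma bounded_pole_order:
  assumes rad: "\<And>p. p \<in> RG \<Longrightarrow> lookup p 0 = 0 \<Longrightarrow> \<exists>t. p ^ t \<in> gen_ideal y"
  shows "\<exists>D j0. int j0 - int (D * U.E) = k \<and> (\<forall>x\<in>localized_deg UNIV Y k. \<exists>r. homogeneous j0 r \<and>
    x - emb r / emb Y ^ D \<in> cech_boundaries y UNIV)"
proof -
  obtain D0 where D0: "\<And>d p. d \<ge> D0 \<Longrightarrow> homogeneous d p \<Longrightarrow> p \<in> gen_ideal y"
    using high_degree_in_ideal[OF rad] by blast
  \<comment> \<open>If some exponent exceeds \<open>D\<close>, the numerator degree is at least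
    \<open>k + D \<ge> D0\<close>, because all \<open>e i\<close> are positive.\<close>
  define D where "D = nat (int D0 - k)"
  have kDE: "k + int (D * U.E) \<ge> 0"
  proof -
    have "D * 1 \<le> D * U.E" using U.E_pos by (intro mult_left_mono) auto
    then have "int D \<le> int (D * U.E)" by (simp only: of_nat_le_iff mult_1_right)
    moreover have "int D \<ge> int D0 - k" by (simp add: D_def)
    ultimately show ?thesis by linarith
  qed
  define j0 where "j0 = nat (k + int (D * U.E))"
  have j0: "int j0 = k + int (D * U.E)" using kDE by (simp add: j0_def)
  define good where "good = {u + w | u w. u \<in> {emb r / emb Y ^ D | r. homogeneous j0 r} \<and>
    w \<in> cech_boundaries y UNIV}"
  have sub: "fract_vs.subspace {emb r / emb Y ^ D | r. homogeneous j0 r}"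
  proof (rule fract_vs.subspaceI)
    show "0 \<in> {emb r / emb Y ^ D | r. homogeneous j0 r}"
      by (auto intro!: exI[of _ 0])
    fix x assume "x \<in> {emb r / emb Y ^ D | r. homogeneous j0 r}"
    then obtain r where r: "x = emb r / emb Y ^ D" "homogeneous j0 r" by blast
    show "emb (mconst c) * x \<in> {emb r / emb Y ^ D | r. homogeneous j0 r}" for c
      using homogeneous_mult[OF homogeneous_mconst r(2), of c]
      by (auto intro!: exI[of _ "mconst c * r"] simp: r(1) emb_mult)
    fix z assume "z \<in> {emb r / emb Y ^ D | r. homogeneous j0 r}"
    then obtain s where s: "z = emb s / emb Y ^ D" "homogeneous j0 s" by blast
    show "x + z \<in> {emb r / emb Y ^ D | r. homogeneous j0 r}"
      using homogeneous_add[OF r(2) s(2)]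
      by (auto intro!: exI[of _ "r + s"] simp: r(1) s(1) emb_add add_divide_distrib)
  qed
  have good: "fract_vs.subspace (good)"
    unfolding good_def by (rule subspace_image_plus[where g = "\<lambda>x. x", OF sub U.subspace_bd]) simp_all
  have good_bd: "w \<in> good" if "w \<in> cech_boundaries y UNIV" for w
    using that fract_vs.subspace_0[OF sub] unfolding good_def by force
  have main: "emb h / (\<Prod>i\<in>UNIV. emb (y i) ^ c i) \<in> good"
    if "homogeneous j h" "int j - (\<Sum>i\<in>UNIV. int (c i * e i)) = k" for j h c
    using that
  proof (induction j arbitrary: h c rule: less_induct)
    case (less j)
    \<comment> \<open>No pole along \<open>y i\<close> gives a boundary; moderate poles are raised
      to exactly \<open>D\<close>; an excessive pole is reduced by induction, where all exponents
      being positive lets any \<open>y l\<close> be cancelled.\<close>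
    consider i where "c i = 0" | "\<And>i. c i > 0" "\<And>i. c i \<le> D" | i where "\<And>i. c i > 0" "c i > D"
      by (metis neq0_conv not_le)
    then show ?case
    proof cases
      case 1
      have "(\<Prod>j\<in>UNIV. emb (y j) ^ c j) = (\<Prod>j\<in>UNIV - {i}. emb (y j) ^ c j)"
        using 1 by (subst prod.remove[of _ i]) auto
      then show ?thesis
        using U.monomial_quotient_in_bd[of h c i] by (simp add: good_bd)
    next
      case 2
      define P where "P = (\<Prod>i\<in>UNIV. y i ^ (D - c i))"
      have "(\<Prod>i\<in>UNIV. emb (y i) ^ c i) * emb P = (\<Prod>i\<in>UNIV. emb (y i) ^ c i * emb (y i) ^ (D - c i))"
        by (simp only: P_def emb_prod emb_power prod.distrib)
      also have "\<dots> = emb Y ^ D"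
        using 2(2) by (simp only: power_add[symmetric] le_add_diff_inverse cech_prod_def emb_prod prod_power_distrib)
      finally have denom: "(\<Prod>i\<in>UNIV. emb (y i) ^ c i) * emb P = emb Y ^ D" .
      have "P \<noteq> 0" by (simp add: P_def nz)
      then have eq: "emb h / (\<Prod>i\<in>UNIV. emb (y i) ^ c i) = emb (h * P) / emb Y ^ D"
        unfolding denom[symmetric] emb_mult by simp
      have "homogeneous (j + (\<Sum>i\<in>UNIV. (D - c i) * e i)) (h * P)"
        unfolding P_def by (intro homogeneous_mult less.prems homogeneous_prod homogeneous_power hom)
      moreover have "j + (\<Sum>i\<in>UNIV. (D - c i) * e i) = j0"
      proof -
        have "int ((D - c i) * e i) = int (D * e i) - int (c i * e i)" for i
          using 2(2)[of i] by (simp only: diff_mult_distrib of_nat_diff mult_le_mono1)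
        then have "int (\<Sum>i\<in>UNIV. (D - c i) * e i) = int (D * U.E) - (\<Sum>i\<in>UNIV. int (c i * e i))"
          by (simp only: of_nat_sum sum_subtractf sum_distrib_left U.E_def)
        then have "int (j + (\<Sum>i\<in>UNIV. (D - c i) * e i)) = int j0"
          using less.prems(2) j0 by (simp only: of_nat_add)
        then show ?thesis by (simp only: of_nat_eq_iff)
      qed
      ultimately have "homogeneous j0 (h * P)" by simp
      then show ?thesis
        unfolding eq good_def using fract_vs.subspace_0[OF U.subspace_bd] by force
    next
      case 3
      have "int D \<le> int (c i * e i)"
      proof -
        have "c i * 1 \<le> c i * e i" using pos[of i] by (intro mult_left_mono) auto
        then show ?thesis using 3(2) by linarith
      qed
      also have "\<dots> \<le> (\<Sum>i\<in>UNIV. int (c i * e i))"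
        by (rule member_le_sum) auto
      finally have "int D \<le> (\<Sum>i\<in>UNIV. int (c i * e i))" .
      moreover have "int D \<ge> int D0 - k" by (simp add: D_def)
      ultimately have "D0 \<le> j"
        using less.prems(2) by linarith
      then have "h \<in> gen_ideal y"
        using D0 less.prems(1) by blast
      then obtain a where a: "h = (\<Sum>l\<in>UNIV. a l * y l)"
        by (auto simp: gen_ideal_def)
      \<comment> \<open>Only the matching homogeneous part of each coefficient contributes to
        \<open>h\<close>; this keeps the fractions in degree \<open>k\<close>, as the induction
        hypothesis requires.\<close>
      define a' where "a' l = hcomp (int j - int (e l)) (a l)" for l
      have "h = hcomp (int j) h"
        using less.prems(1) by (simp add: hcomp_homogeneous)
      also have "\<dots> = (\<Sum>l\<in>UNIV. y l * a' l)"
        unfolding a a'_def hcomp_sum by (simp only: mult.commute[of "a _"] hcomp_mult[OF hom])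
      finally have h: "h = (\<Sum>l\<in>UNIV. y l * a' l)" .
      have "emb (y l * a' l) / (\<Prod>i\<in>UNIV. emb (y i) ^ c i) \<in> good" for l
      proof (cases "e l \<le> j")
        case True
        define c' where "c' = c(l := c l - 1)"
        have rem: "(\<Prod>i\<in>UNIV. emb (y i) ^ c i) = emb (y l) * (\<Prod>i\<in>UNIV. emb (y i) ^ c' i)"
        proof -
          have "(\<Prod>i\<in>UNIV - {l}. emb (y i) ^ c i) = (\<Prod>i\<in>UNIV - {l}. emb (y i) ^ c' i)"
            by (intro prod.cong) (auto simp: c'_def)
          moreover have "emb (y l) ^ c l = emb (y l) * emb (y l) ^ c' l"
            using 3(1)[of l] by (cases "c l") (auto simp: c'_def)
          ultimately show ?thesis
            by (simp add: prod.remove[of UNIV l] mult.assoc)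
        qed
        have "(\<Sum>i\<in>UNIV. int (c i * e i)) = int (e l) + (\<Sum>i\<in>UNIV. int (c' i * e i))"
        proof -
          have "(\<Sum>i\<in>UNIV - {l}. int (c i * e i)) = (\<Sum>i\<in>UNIV - {l}. int (c' i * e i))"
            by (intro sum.cong) (auto simp: c'_def)
          moreover have "int (c l * e l) = int (e l) + int (c' l * e l)"
            using 3(1)[of l] by (cases "c l") (auto simp: c'_def algebra_simps)
          ultimately show ?thesis
            by (simp only: sum.remove[OF finite UNIV_I, of _ l] add.assoc)
        qed
        then have "int (j - e l) - (\<Sum>i\<in>UNIV. int (c' i * e i)) = k"
          using less.prems(2) True by (simp only: of_nat_diff)
        moreover have "homogeneous (j - e l) (a' l)"
          using homogeneous_hcomp[of "int j - int (e l)" "a l"] True by (simp add: a'_def nat_diff_distrib)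
        moreover have "j - e l < j"
          using True pos[of l] by simp
        ultimately have "emb (a' l) / (\<Prod>i\<in>UNIV. emb (y i) ^ c' i) \<in> good"
          by (intro less.IH)
        then show ?thesis
          unfolding rem emb_mult using nz[of l] by simp
      next
        case False
        then have "a' l = 0" by (simp add: a'_def hcomp_neg)
        then show ?thesis using fract_vs.subspace_0[OF good] by simp
      qed
      then have "(\<Sum>l\<in>UNIV. emb (y l * a' l) / (\<Prod>i\<in>UNIV. emb (y i) ^ c i)) \<in> good"
        by (intro fract_vs.subspace_sum[OF good])
      then show ?thesis
        unfolding h emb_sum sum_divide_distrib .
    qed
  qed
  have "\<exists>r. homogeneous j0 r \<and> x - emb r / emb Y ^ D \<in> cech_boundaries y UNIV"
    if x: "x \<in> localized_deg UNIV Y k" for x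
  proof -
    obtain r d j where r: "x = emb r / emb Y ^ d" "homogeneous j r" "int j - int (d * U.E) = k"
      using x unfolding U.localized_deg_eq by blast
    have "int j - (\<Sum>i\<in>UNIV. int (d * e i)) = k"
      using r(3) by (simp only: U.E_def sum_distrib_left of_nat_sum)
    from main[OF r(2) this]
    have "x \<in> good"
      by (simp add: r(1) cech_prod_def emb_prod prod_power_distrib)
    then show ?thesis
      unfolding good_def by auto
  qed
  moreover have "int j0 - int (D * U.E) = k"
    using j0 by simp
  ultimately show ?thesis by blast
qed

lemma finite_spanning:
  assumes rad: "\<And>p. p \<in> RG \<Longrightarrow> lookup p 0 = 0 \<Longrightarrow> \<exists>t. p ^ t \<in> gen_ideal y"
  shows "\<exists>B. finite B \<and> B \<subseteq> localized_deg UNIV Y k \<and> (\<forall>x\<in>localized_deg UNIV Y k. \<exists>z\<in>fract_vs.span B. x - z \<in> cech_boundaries y UNIV)"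
proof -
  obtain D j0 where j0: "int j0 - int (D * U.E) = k" and D: "\<forall>x\<in>localized_deg UNIV Y k. \<exists>r. homogeneous j0 r \<and>
      x - emb r / emb Y ^ D \<in> cech_boundaries y UNIV"
    using bounded_pole_order[OF rad] by blast
  define M where "M = {m :: 'n \<Rightarrow>\<^sub>0 nat. mdeg m = j0}"
  have "M \<subseteq> monom_box UNIV j0"
    using lookup_le_mdeg by (fastforce simp: M_def monom_box_def)
  then have "finite M" using finite_monom_box finite_subset by blast
  define B where "B = (\<lambda>m. emb (single m 1) / emb Y ^ D) ` M"
  have "emb r / emb Y ^ D \<in> fract_vs.span B" if "homogeneous j0 r" for r
  proof -
    have r_eq: "r = (\<Sum>m\<in>keys r. mconst (lookup r m) * single m 1)"
      by (rule poly_mapping_eqI)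
        (simp add: lookup_sum lookup_mconst_mult lookup_single when_def in_keys_iff if_distrib cong: if_cong)
    have "emb r / emb Y ^ D = (\<Sum>m\<in>keys r. emb (mconst (lookup r m)) * (emb (single m 1) / emb Y ^ D))"
      using arg_cong[OF r_eq, of emb] unfolding emb_sum emb_mult
      by (simp only: sum_divide_distrib times_divide_eq_right)
    also have "\<dots> \<in> fract_vs.span B"
      using that by (intro fract_vs.span_sum fract_vs.span_scale fract_vs.span_base)
        (auto simp: B_def M_def homogeneous_iff)
    finally show ?thesis .
  qed
  then have "\<forall>x\<in>localized_deg UNIV Y k. \<exists>z\<in>fract_vs.span B. x - z \<in> cech_boundaries y UNIV"
    using D by blast
  moreover have "B \<subseteq> localized_deg UNIV Y k"
    unfolding B_def using j0 by (auto simp: M_def intro!: U.localized_deg_memI homogeneous_single)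
  ultimately show ?thesis using \<open>finite M\<close> unfolding B_def by blast
qed

end

section \<open>Quotient spaces as module records\<close>

lemma field_field_ring: "Ring.field (field_ring :: 'k::field ring)"
proof -
  interpret cring "field_ring :: 'k ring"
  proof (rule cringI)
    show "abelian_group (field_ring :: 'k ring)"
    proof (rule abelian_groupI)
      fix x :: 'k
      show "\<exists>z\<in>carrier field_ring. z \<oplus>\<^bsub>field_ring\<^esub> x = \<zero>\<^bsub>field_ring\<^esub>"
        by (auto simp: field_ring_def intro!: exI[of _ "- x"])
    qed (auto simp: field_ring_def)
    show "Group.comm_monoid (field_ring :: 'k ring)"
      by (rule comm_monoidI) (auto simp: field_ring_def)
  qed (auto simp: field_ring_def distrib_right)
  show ?thesis
  proof (rule cring_fieldI2)
    fix a :: 'k assume "a \<noteq> \<zero>\<^bsub>field_ring\<^esub>"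
    then show "\<exists>b\<in>carrier field_ring. a \<otimes>\<^bsub>field_ring\<^esub> b = \<one>\<^bsub>field_ring\<^esub>"
      by (auto simp: field_ring_def intro!: exI[of _ "inverse a"])
  qed (simp add: field_ring_def)
qed

lemma field_ring_simps:
  "carrier field_ring = UNIV" "a \<otimes>\<^bsub>field_ring\<^esub> b = a * b" "a \<oplus>\<^bsub>field_ring\<^esub> b = a + b"
  "\<one>\<^bsub>field_ring\<^esub> = 1" "\<zero>\<^bsub>field_ring\<^esub> = 0"
  by (simp_all add: field_ring_def)

definition coset :: "'a::ab_group_add set \<Rightarrow> 'a \<Rightarrow> 'a set" where
  "coset W x = {w + x | w. w \<in> W}"

lemma coset_iff: "z \<in> coset W x \<longleftrightarrow> z - x \<in> W"
  unfolding coset_def by (auto intro!: exI[of _ "z - x"])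

lemma coset_eq_iff:
  assumes "fract_vs.subspace W"
  shows "coset W x = coset W z \<longleftrightarrow> x - z \<in> W"
proof
  assume "coset W x = coset W z"
  moreover have "x \<in> coset W x"
    using fract_vs.subspace_0[OF assms] by (simp add: coset_iff)
  ultimately show "x - z \<in> W" by (simp add: coset_iff)
next
  assume xz: "x - z \<in> W"
  have "u - x \<in> W \<longleftrightarrow> u - z \<in> W" for u
    using fract_vs.subspace_add[OF assms _ xz, of "u - x"] fract_vs.subspace_diff[OF assms _ xz, of "u - z"]
    by auto
  then show "coset W x = coset W z" by (auto simp: coset_iff)
qed

text \<open>A model of (D + W)/W. In the main instance \<open>W\<close> consists of the boundaries
  of all degrees while \<open>D\<close> is a single degree, so neither space need contain the
  other.\<close>

locale quotient_space =
  fixes V :: "('k::field, ('n::{finite,linorder}, 'k) mpoly fract set, 'm) module_scheme"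
    and W D :: "('n, 'k) mpoly fract set"
  assumes W: "fract_vs.subspace W" and D: "fract_vs.subspace D"
    and carrier_eq: "carrier V = coset W ` D" and zero_eq: "\<zero>\<^bsub>V\<^esub> = coset W 0"
    and add_eq: "coset W x \<oplus>\<^bsub>V\<^esub> coset W z = coset W (x + z)"
    and smult_eq: "c \<odot>\<^bsub>V\<^esub> coset W x = coset W (emb (mconst c) * x)"
begin

lemma coset_eq: "coset W x = coset W z \<longleftrightarrow> x - z \<in> W"
  by (rule coset_eq_iff[OF W])

sublocale VS: vectorspace field_ring V
proof (rule vs_criteria[OF field_field_ring])
  show "\<zero>\<^bsub>V\<^esub> \<in> carrier V"
    using fract_vs.subspace_0[OF D] by (auto simp: zero_eq carrier_eq)
  show "\<forall>v w. v \<in> carrier V \<and> w \<in> carrier V \<longrightarrow> v \<oplus>\<^bsub>V\<^esub> w \<in> carrier V"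
    using fract_vs.subspace_add[OF D] by (auto simp: carrier_eq add_eq)
  show "\<forall>v\<in>carrier V. \<exists>neg_v\<in>carrier V. v \<oplus>\<^bsub>V\<^esub> neg_v = \<zero>\<^bsub>V\<^esub>"
  proof
    fix v assume "v \<in> carrier V"
    then obtain x where "v = coset W x" "x \<in> D" by (auto simp: carrier_eq)
    then show "\<exists>neg_v\<in>carrier V. v \<oplus>\<^bsub>V\<^esub> neg_v = \<zero>\<^bsub>V\<^esub>"
      using fract_vs.subspace_neg[OF D]
      by (intro bexI[of _ "coset W (- x)"]) (auto simp: carrier_eq add_eq zero_eq)
  qed
  show "\<forall>c v. c \<in> carrier field_ring \<and> v \<in> carrier V \<longrightarrow> c \<odot>\<^bsub>V\<^esub> v \<in> carrier V"
    using fract_vs.subspace_scale[OF D] by (auto simp: carrier_eq smult_eq)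
  show "\<forall>v w. v \<in> carrier V \<and> w \<in> carrier V \<longrightarrow> v \<oplus>\<^bsub>V\<^esub> w = w \<oplus>\<^bsub>V\<^esub> v"
    by (auto simp: carrier_eq add_eq add.commute)
  show "\<forall>v w x. v \<in> carrier V \<and> w \<in> carrier V \<and> x \<in> carrier V \<longrightarrow>
      v \<oplus>\<^bsub>V\<^esub> w \<oplus>\<^bsub>V\<^esub> x = v \<oplus>\<^bsub>V\<^esub> (w \<oplus>\<^bsub>V\<^esub> x)"
    by (auto simp: carrier_eq add_eq add.assoc)
  show "\<forall>v\<in>carrier V. v \<oplus>\<^bsub>V\<^esub> \<zero>\<^bsub>V\<^esub> = v"
    by (auto simp: carrier_eq add_eq zero_eq)
  show "\<forall>a b v. a \<in> carrier field_ring \<and> b \<in> carrier field_ring \<and> v \<in> carrier V \<longrightarrow>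
      (a \<otimes>\<^bsub>field_ring\<^esub> b) \<odot>\<^bsub>V\<^esub> v = a \<odot>\<^bsub>V\<^esub> (b \<odot>\<^bsub>V\<^esub> v)"
  proof (intro allI impI, elim conjE)
    fix a b v assume "v \<in> carrier V"
    then obtain x where x: "v = coset W x" by (auto simp: carrier_eq)
    show "(a \<otimes>\<^bsub>field_ring\<^esub> b) \<odot>\<^bsub>V\<^esub> v = a \<odot>\<^bsub>V\<^esub> (b \<odot>\<^bsub>V\<^esub> v)"
      by (simp only: x field_ring_simps smult_eq mconst_mult emb_mult mult.assoc)
  qed
  show "\<forall>v\<in>carrier V. \<one>\<^bsub>field_ring\<^esub> \<odot>\<^bsub>V\<^esub> v = v"
    by (auto simp: carrier_eq smult_eq field_ring_simps)
  show "\<forall>a b v. a \<in> carrier field_ring \<and> b \<in> carrier field_ring \<and> v \<in> carrier V \<longrightarrow>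
      (a \<oplus>\<^bsub>field_ring\<^esub> b) \<odot>\<^bsub>V\<^esub> v = a \<odot>\<^bsub>V\<^esub> v \<oplus>\<^bsub>V\<^esub> b \<odot>\<^bsub>V\<^esub> v"
  proof (intro allI impI, elim conjE)
    fix a b v assume "v \<in> carrier V"
    then obtain x where x: "v = coset W x" by (auto simp: carrier_eq)
    show "(a \<oplus>\<^bsub>field_ring\<^esub> b) \<odot>\<^bsub>V\<^esub> v = a \<odot>\<^bsub>V\<^esub> v \<oplus>\<^bsub>V\<^esub> b \<odot>\<^bsub>V\<^esub> v"
      by (simp only: x field_ring_simps smult_eq add_eq mconst_add emb_add distrib_right)
  qed
  show "\<forall>a v w. a \<in> carrier field_ring \<and> v \<in> carrier V \<and> w \<in> carrier V \<longrightarrow>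
      a \<odot>\<^bsub>V\<^esub> (v \<oplus>\<^bsub>V\<^esub> w) = a \<odot>\<^bsub>V\<^esub> v \<oplus>\<^bsub>V\<^esub> a \<odot>\<^bsub>V\<^esub> w"
  proof (intro allI impI, elim conjE)
    fix a v w assume "v \<in> carrier V" "w \<in> carrier V"
    then obtain x z where x: "v = coset W x" "w = coset W z" by (auto simp: carrier_eq)
    show "a \<odot>\<^bsub>V\<^esub> (v \<oplus>\<^bsub>V\<^esub> w) = a \<odot>\<^bsub>V\<^esub> v \<oplus>\<^bsub>V\<^esub> a \<odot>\<^bsub>V\<^esub> w"
      by (simp only: x smult_eq add_eq distrib_left)
  qed
qed

lemma fin_dim:
  assumes B: "finite B" "B \<subseteq> D" and span: "\<And>x. x \<in> D \<Longrightarrow> \<exists>z\<in>fract_vs.span B. x - z \<in> W"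
  shows "VS.fin_dim"
proof -
  define A where "A = coset W ` B"
  have A: "finite A" "A \<subseteq> carrier V"
    using B by (auto simp: A_def carrier_eq)
  have sub: "submodule field_ring (VS.span A) V"
    by (rule VS.span_is_submodule[OF A(2)])
  have in_span: "coset W z \<in> VS.span A" if "z \<in> fract_vs.span B" for z
    using that
  proof (induction rule: fract_vs.span_induct_alt)
    case base
    show ?case using submodule.zero_closed[OF sub] by (simp add: zero_eq)
  next
    case (step c x z)
    have "coset W x \<in> VS.span A"
      using step.hyps VS.in_own_span[OF A(2)] by (auto simp: A_def)
    then have "c \<odot>\<^bsub>V\<^esub> coset W x \<oplus>\<^bsub>V\<^esub> coset W z \<in> VS.span A"
      using step.IH
      by (intro submodule.m_closed[OF sub] submodule.smult_closed[OF sub]) (auto simp: field_ring_def)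
    then show ?case by (simp add: smult_eq add_eq)
  qed
  have "carrier V \<subseteq> VS.span A"
    unfolding carrier_eq
  proof safe
    fix x assume "x \<in> D"
    then obtain z where "z \<in> fract_vs.span B" "coset W x = coset W z"
      using span coset_eq by blast
    then show "coset W x \<in> VS.span A" using in_span by simp
  qed
  moreover have "VS.span A \<subseteq> carrier V"
    using submodule.subset[OF sub] .
  ultimately show ?thesis
    unfolding VS.fin_dim_def using A by blast
qed

end

lemma rank_over_quotient_trivial:
  assumes "quotient_space V W W"
  shows "rank_over V = 0"
proof -
  interpret quotient_space V W W by fact
  have "coset W x = \<zero>\<^bsub>V\<^esub>" if "x \<in> W" for x
    unfolding zero_eq coset_eq using that by simp
  then have carrier: "carrier V = {\<zero>\<^bsub>V\<^esub>}"
    unfolding carrier_eq using fract_vs.subspace_0[OF W] by (auto simp: image_constant_conv)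
  have sub: "submodule field_ring (VS.span {}) V"
    by (rule VS.span_is_submodule) (rule empty_subsetI)
  have "VS.span {} \<subseteq> carrier V"
    by (rule submodule.subset[OF sub])
  moreover have "carrier V \<subseteq> VS.span {}"
    using submodule.zero_closed[OF sub] unfolding carrier by simp
  ultimately have gen: "VS.span {} = carrier V"
    by (rule equalityI)
  have "VS.fin_dim"
    unfolding VS.fin_dim_def using gen finite.emptyI empty_subsetI by blast
  moreover have "\<exists>A. finite A \<and> card A = 0 \<and> A \<subseteq> carrier V \<and> VS.span A = carrier V"
    using gen finite.emptyI empty_subsetI card.empty by blast
  then have "VS.dim \<le> 0"
    unfolding VS.dim_def by (rule Least_le)
  ultimately have "VS.fin_dim" "VS.dim = 0"
    by simp_all
  then show ?thesis by (simp add: rank_over_def zero_enat_def)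
qed

text \<open>The induced map evaluates \<open>g\<close> at a chosen representative; \<open>g\<close>
  maps \<open>W\<close> into \<open>W'\<close>, so the class of the result does not depend on the
  choice.\<close>

lemma quotient_map:
  fixes g :: "('n::{finite,linorder}, 'k::field) mpoly fract \<Rightarrow> ('n, 'k) mpoly fract"
  assumes V: "quotient_space V W D" and V': "quotient_space V' W' D'"
    and add: "\<And>x z. g (x + z) = g x + g z"
    and scale: "\<And>c x. g (emb (mconst c) * x) = emb (mconst c) * g x"
    and gW: "\<And>x. x \<in> W \<Longrightarrow> g x \<in> W'" and gD: "\<And>x. x \<in> D \<Longrightarrow> g x \<in> D'"
  defines "T \<equiv> \<lambda>C. coset W' (g (SOME x. x \<in> C))"
  shows "T (coset W x) = coset W' (g x)" and "linear_map field_ring V V' T"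
proof -
  interpret V: quotient_space V W D by fact
  interpret V': quotient_space V' W' D' by fact
  have diff: "g (x - z) = g x - g z" for x z
    using add[of "x - z" z] by (simp add: eq_diff_eq)
  show T: "T (coset W x) = coset W' (g x)" for x
  proof -
    have "x \<in> coset W x"
      using fract_vs.subspace_0[OF V.W] by (simp add: coset_iff)
    then have "(SOME z. z \<in> coset W x) \<in> coset W x"
      by (rule someI)
    then have "g ((SOME z. z \<in> coset W x) - x) \<in> W'"
      by (intro gW) (simp add: coset_iff)
    then show ?thesis
      unfolding T_def V'.coset_eq by (simp add: diff)
  qed
  show "linear_map field_ring V V' T"
  proof (intro linear_map.intro mod_hom.intro V.VS.vectorspace_axioms V'.VS.vectorspace_axioms
      V.VS.module_axioms V'.VS.module_axioms mod_hom_axioms.intro)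
    show "T \<in> module_hom field_ring V V'"
      unfolding module_hom_def
      by (auto simp: V.carrier_eq V'.carrier_eq T V.add_eq V'.add_eq V.smult_eq V'.smult_eq add scale gD)
  qed
qed

section \<open>Local cohomology as a quotient space\<close>

lemma cech_coset: "W +>\<^bsub>cech_top y S\<^esub> x = coset W x"
  by (auto simp: a_r_coset_def r_coset_def cech_top_def frac_space_def coset_def)

lemma cech_class_eq: "cech_class y S x = coset (cech_boundaries y S) x"
  by (simp add: cech_class_def cech_coset)

lemma carrier_local_cohom:
  "carrier (local_cohom y S) = coset (cech_boundaries y S) ` localized S (cech_prod y)"
proof -
  have "carrier (local_cohom y S) =
      (\<Union>a\<in>localized S (cech_prod y). {cech_boundaries y S +>\<^bsub>cech_top y S\<^esub> a})"
    by (simp add: local_cohom_def quot_module_def A_RCOSETS_def RCOSETS_def a_r_coset_def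
        cech_top_def)
  then show ?thesis by (auto simp: cech_coset)
qed

lemma local_cohom_quotient_space:
  assumes W: "fract_vs.subspace (cech_boundaries y S)" and D: "fract_vs.subspace D"
  shows "quotient_space ((local_cohom y S)\<lparr>carrier := coset (cech_boundaries y S) ` D\<rparr>)
    (cech_boundaries y S) D"
proof -
  define W where "W = cech_boundaries y S"
  note W = W[folded W_def]
  have add: "set_add (cech_top y S) (coset W x) (coset W z) = coset W (x + z)" for x z
  proof -
    have "set_add (cech_top y S) (coset W x) (coset W z) = {(a + x) + (b + z) | a b. a \<in> W \<and> b \<in> W}"
      unfolding set_add_def set_mult_def cech_top_def frac_space_def coset_def by force
    also have "\<dots> = coset W (x + z)"
    proof (intro equalityI subsetI)
      fix u assume "u \<in> {(a + x) + (b + z) | a b. a \<in> W \<and> b \<in> W}"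
      then obtain a b where ab: "a \<in> W" "b \<in> W" "u = (a + x) + (b + z)" by blast
      then have "u = (a + b) + (x + z)" by (simp only: ac_simps)
      then show "u \<in> coset W (x + z)"
        using fract_vs.subspace_add[OF W ab(1,2)] unfolding coset_def by blast
    next
      fix u assume "u \<in> coset W (x + z)"
      then obtain a where a: "a \<in> W" "u = a + (x + z)" unfolding coset_def by blast
      then have "u = (a + x) + (0 + z)" by (simp only: ac_simps add_0_left add_0_right)
      then show "u \<in> {(a + x) + (b + z) | a b. a \<in> W \<and> b \<in> W}"
        using a(1) fract_vs.subspace_0[OF W] by blast
    qed
    finally show ?thesis .
  qed
  have smult: "(\<Union>z\<in>coset W x. coset W (emb (mconst c) * z)) = coset W (emb (mconst c) * x)" for c x
  proof -
    have "coset W (emb (mconst c) * z) = coset W (emb (mconst c) * x)" if "z \<in> coset W x" for z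
    proof -
      have "emb (mconst c) * (z - x) \<in> W"
        using that by (intro fract_vs.subspace_scale[OF W]) (simp add: coset_iff)
      then show ?thesis
        by (simp add: coset_eq_iff[OF W] right_diff_distrib)
    qed
    moreover have "x \<in> coset W x"
      using fract_vs.subspace_0[OF W] by (simp add: coset_iff)
    ultimately show ?thesis by blast
  qed
  have W0: "W = coset W 0"
    by (auto simp: coset_iff)
  have sm: "c \<odot>\<^bsub>cech_top y S\<^esub> z = emb (mconst c) * z" for c z
    by (simp add: cech_top_def frac_space_def emb_def)
  show ?thesis
    unfolding W_def[symmetric]
    by unfold_locales
      (simp_all add: W D local_cohom_def quot_module_def add cech_coset sm smult flip: W_def W0)
qed

lemma linear_map_dims:
  assumes "linear_map K V W T" "vectorspace.fin_dim K V"
  shows "vectorspace.dim K (W\<lparr>carrier := T ` carrier V\<rparr>) +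
      vectorspace.dim K (V\<lparr>carrier := {v \<in> carrier V. T v = \<zero>\<^bsub>W\<^esub>}\<rparr>) = vectorspace.dim K V"
    and "T ` carrier V = carrier W \<Longrightarrow> vectorspace.fin_dim K W"
proof -
  interpret linear_map K V W T by fact
  show "vectorspace.dim K (W\<lparr>carrier := T ` carrier V\<rparr>) +
      vectorspace.dim K (V\<lparr>carrier := {v \<in> carrier V. T v = \<zero>\<^bsub>W\<^esub>}\<rparr>) = vectorspace.dim K V"
    using rank_nullity_main(1)[OF assms(2)] unfolding im_def ker_def .
  show "vectorspace.fin_dim K W" if "T ` carrier V = carrier W"
    using rank_nullity_main(2)[OF assms(2) that] .
qed

section \<open>Comparison of the graded pieces\<close>

lemma (in cech_data) localized_deg_subset: "localized_deg S Y k \<subseteq> localized S Y"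
  unfolding localized_deg_eq localized_eq by blast

lemma (in cech_data) graded_part_local_cohom:
  "graded_part y S (local_cohom y S) k =
    (local_cohom y S)\<lparr>carrier := coset (cech_boundaries y S) ` localized_deg S Y k\<rparr>"
proof -
  have "carrier (local_cohom y S) \<inter> coset bd ` localized_deg S Y k = coset bd ` localized_deg S Y k"
    unfolding carrier_local_cohom using localized_deg_subset by blast
  then show ?thesis
    by (simp add: graded_part_def cech_class_eq[abs_def])
qed

context cyclic_cech
begin

lemma F_pow_div: "(f.frac ^^ l) (emb r / emb Y ^ d) = emb ((f ^^ l) r) / emb Y ^ d"
proof -
  have "f (Y ^ d) = Y ^ d"
    by (induction d) (simp_all add: lin_act_times f_Y)
  then show ?thesis
    using U.Y_nz by (induction l) (simp_all add: F_div flip: emb_power)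
qed

text \<open>All denominators are powers of products of parameters and hence invariant, so the action
  and the trace of a boundary are computed on numerators. The two membership clauses then place the
  results over R and over the invariants.\<close>

lemma boundary_cases:
  assumes "x \<in> cech_boundaries y UNIV"
  shows "\<exists>r D. x = (\<Sum>i\<in>UNIV. emb (r i) / emb (D i)) \<and> (\<forall>i. D i \<noteq> 0 \<and> f (D i) = D i) \<and>
    (\<forall>i s. emb s / emb (D i) \<in> localized UNIV (\<Prod>j\<in>UNIV - {i}. y j)) \<and>
    (\<forall>i. \<forall>s\<in>RG. emb s / emb (D i) \<in> localized RG (\<Prod>j\<in>UNIV - {i}. y j))"
proof -
  obtain w where w: "x = (\<Sum>i\<in>UNIV. w i)" "\<And>i. w i \<in> localized UNIV (\<Prod>l\<in>UNIV - {i}. y l)"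
    using assms unfolding cech_boundaries_def by blast
  have "\<forall>i. \<exists>r d. w i = emb r / emb ((\<Prod>l\<in>UNIV - {i}. y l) ^ d)"
    using w(2) unfolding localized_eq emb_power by blast
  from choice[OF this] obtain r where "\<forall>i. \<exists>d. w i = emb (r i) / emb ((\<Prod>l\<in>UNIV - {i}. y l) ^ d)" ..
  from choice[OF this] obtain d where d: "\<forall>i. w i = emb (r i) / emb ((\<Prod>l\<in>UNIV - {i}. y l) ^ d i)" ..
  define D where "D i = (\<Prod>l\<in>UNIV - {i}. y l) ^ d i" for i
  have "x = (\<Sum>i\<in>UNIV. emb (r i) / emb (D i))"
    unfolding w(1) D_def using d by simp
  moreover have "D i \<noteq> 0" for i
    by (simp add: D_def nz)
  moreover have "D i \<in> RG" for i
    unfolding D_def by (intro I.S_power I.S_prod I.y_in)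
  moreover have "emb s / emb (D i) \<in> localized S (\<Prod>j\<in>UNIV - {i}. y j)" if "s \<in> S" for i s S
    using that unfolding localized_eq D_def emb_power by blast
  ultimately show ?thesis
    by (intro exI[of _ r] exI[of _ D]) simp
qed

lemma F_boundary:
  assumes "x \<in> cech_boundaries y UNIV"
  shows "f.frac x \<in> cech_boundaries y UNIV"
proof -
  obtain r D where x: "x = (\<Sum>i\<in>UNIV. emb (r i) / emb (D i))" "\<forall>i. D i \<noteq> 0 \<and> f (D i) = D i"
    "\<forall>i s. emb s / emb (D i) \<in> localized UNIV (\<Prod>j\<in>UNIV - {i}. y j)"
    "\<forall>i. \<forall>s\<in>RG. emb s / emb (D i) \<in> localized RG (\<Prod>j\<in>UNIV - {i}. y j)"
    using boundary_cases[OF assms] by blast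
  have "f.frac x = (\<Sum>i\<in>UNIV. emb (f (r i)) / emb (D i))"
    unfolding x(1) F.sum using x(2) by (intro sum.cong refl F_div) auto
  moreover have "\<forall>i. emb (f (r i)) / emb (D i) \<in> localized UNIV (\<Prod>j\<in>UNIV - {i}. y j)"
    using x(3) by blast
  ultimately show ?thesis
    unfolding cech_boundaries_def by blast
qed

lemma F_tr_boundary:
  assumes "x \<in> cech_boundaries y UNIV"
  shows "F.tr x \<in> cech_boundaries y RG"
proof -
  obtain r D where x: "x = (\<Sum>i\<in>UNIV. emb (r i) / emb (D i))" "\<forall>i. D i \<noteq> 0 \<and> f (D i) = D i"
    "\<forall>i s. emb s / emb (D i) \<in> localized UNIV (\<Prod>j\<in>UNIV - {i}. y j)"
    "\<forall>i. \<forall>s\<in>RG. emb s / emb (D i) \<in> localized RG (\<Prod>j\<in>UNIV - {i}. y j)"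
    using boundary_cases[OF assms] by blast
  have tr_sum: "F.tr (\<Sum>i\<in>J. h i) = (\<Sum>i\<in>J. F.tr (h i))" for h and J :: "'n set"
    by (induction J rule: infinite_finite_induct) (simp_all add: F.tr_add F.tr_zero)
  have "F.tr x = (\<Sum>i\<in>UNIV. emb (f.tr (r i)) / emb (D i))"
    unfolding x(1) tr_sum using x(2) by (intro sum.cong refl f.tr_frac) auto
  moreover have "\<forall>i. emb (f.tr (r i)) / emb (D i) \<in> localized RG (\<Prod>j\<in>UNIV - {i}. y j)"
    using x(4) f.f_tr by blast
  ultimately show ?thesis
    unfolding cech_boundaries_def by blast
qed

lemma F_pow_boundary: "x \<in> cech_boundaries y UNIV \<Longrightarrow> (f.frac ^^ l) x \<in> cech_boundaries y UNIV"
  by (induction l) (simp_all add: F_boundary)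

lemma F_localized_deg:
  assumes "x \<in> localized_deg UNIV Y k"
  shows "f.frac x \<in> localized_deg UNIV Y k"
proof -
  obtain r d j where r: "x = emb r / emb Y ^ d" "homogeneous j r" "int j - int (d * U.E) = k"
    using assms unfolding U.localized_deg_eq by blast
  have "f.frac x = emb (f r) / emb Y ^ d"
    using F_pow_div[of 1] by (simp add: r(1))
  then show ?thesis
    using U.localized_deg_memI[OF UNIV_I homogeneous_f[OF r(2)] r(3)] by simp
qed

lemma F_tr_localized_deg:
  assumes "x \<in> localized_deg UNIV Y k"
  shows "F.tr x \<in> localized_deg RG Y k"
proof -
  obtain r d j where r: "x = emb r / emb Y ^ d" "homogeneous j r" "int j - int (d * U.E) = k"
    using assms unfolding U.localized_deg_eq by blast
  have "homogeneous j ((f ^^ l) r)" for l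
    by (induction l) (simp_all add: r homogeneous_f)
  then have "homogeneous j (f.tr r)"
    unfolding f.tr_def by (intro homogeneous_sum)
  moreover have "int j - int (d * I.E) = k"
    using r(3) by (simp only: U.E_def I.E_def)
  ultimately show ?thesis
    unfolding r(1) F_tr_div using f.f_tr by (intro I.localized_deg_memI) auto
qed

text \<open>The union runs over all fractions representing the class. The action preserves
  boundaries, so all of them give one coset, and at least one such fraction exists because
  \<open>x\<close> is in the localization.\<close>

lemma cohom_act_coset:
  assumes x: "x \<in> localized UNIV Y"
  shows "cohom_act y (A [^]\<^bsub>GL\<^esub> l) (coset (cech_boundaries y UNIV) x) =
    coset (cech_boundaries y UNIV) ((f.frac ^^ l) x)"
proof -
  let ?W = "cech_boundaries y UNIV"
  have cls: "cech_class y UNIV (Fract (lin_act (A [^]\<^bsub>GL\<^esub> l) r) (Y ^ d)) = coset ?W ((f.frac ^^ l) (emb r / emb Y ^ d))" for r d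
    by (simp only: cech_class_eq Fract_emb emb_power lin_act_pow F_pow_div)
  have act: "cohom_act y (A [^]\<^bsub>GL\<^esub> l) (coset ?W x) =
      (\<Union>(r, d)\<in>{(r, d). emb r / emb Y ^ d \<in> coset ?W x}. coset ?W ((f.frac ^^ l) (emb r / emb Y ^ d)))"
    unfolding cohom_act_def cls by (simp only: Fract_emb emb_power)
  have "coset ?W ((f.frac ^^ l) z) = coset ?W ((f.frac ^^ l) x)" if "z \<in> coset ?W x" for z
  proof -
    have "(f.frac ^^ l) z = (f.frac ^^ l) (z - x) + (f.frac ^^ l) x"
      by (simp flip: F.pow_add)
    moreover have "(f.frac ^^ l) (z - x) \<in> ?W"
      using that by (intro F_pow_boundary) (simp add: coset_iff)
    ultimately show ?thesis
      by (simp add: coset_eq_iff[OF U.subspace_bd])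
  qed
  moreover obtain r d where r: "x = emb r / emb Y ^ d"
    using x unfolding localized_eq by blast
  moreover have "x \<in> coset ?W x"
    using fract_vs.subspace_0[OF U.subspace_bd] by (simp add: coset_iff)
  ultimately show ?thesis
    unfolding act by blast
qed

lemma graded_part_invariants:
  assumes G: "G = (\<lambda>l. A [^]\<^bsub>GL\<^esub> (l::nat)) ` {..<N}"
  shows "graded_part y UNIV (local_cohom_invariants G y) k =
    (local_cohom y UNIV)\<lparr>carrier := coset (cech_boundaries y UNIV) `
      {x \<in> localized_deg UNIV Y k. f.frac x - x \<in> cech_boundaries y UNIV}\<rparr>"
proof -
  let ?W = "cech_boundaries y UNIV"
  have inv: "(\<forall>g\<in>G. cohom_act y g (coset ?W x) = coset ?W x) \<longleftrightarrow> f.frac x - x \<in> ?W"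
    if x: "x \<in> localized UNIV Y" for x
  proof
    assume "\<forall>g\<in>G. cohom_act y g (coset ?W x) = coset ?W x"
    then have fix_l: "(f.frac ^^ l) x - x \<in> ?W" if "l < N" for l
      using that x by (simp add: G cohom_act_coset coset_eq_iff[OF U.subspace_bd])
    show "f.frac x - x \<in> ?W"
    proof (cases "N = 1")
      \<comment> \<open>For \<open>N = 1\<close> the exponent \<open>1\<close> is not among those
        enumerating \<open>G\<close>; the automorphism is the identity by its order.\<close>
      case True
      then have "f.frac x = x" using F.order[of x] by simp
      then show ?thesis using fract_vs.subspace_0[OF U.subspace_bd] by simp
    next
      case False
      then have "1 < N" using N_pos by simp
      from fix_l[OF this] show ?thesis by simp
    qed
  next
    assume *: "f.frac x - x \<in> ?W"
    have "(f.frac ^^ l) x - x \<in> ?W" for l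
    proof (induction l)
      case 0
      show ?case using fract_vs.subspace_0[OF U.subspace_bd] by simp
    next
      case (Suc l)
      have eq: "(f.frac ^^ Suc l) x - x = f.frac ((f.frac ^^ l) x - x) + (f.frac x - x)"
        by (simp add: F.diff)
      show ?case
        unfolding eq by (rule fract_vs.subspace_add[OF U.subspace_bd F_boundary[OF Suc.IH] *])
    qed
    then show "\<forall>g\<in>G. cohom_act y g (coset ?W x) = coset ?W x"
      using x by (auto simp: G cohom_act_coset coset_eq_iff[OF U.subspace_bd])
  qed
  have "{C \<in> carrier (local_cohom y UNIV). \<forall>g\<in>G. cohom_act y g C = C} \<inter> coset ?W ` localized_deg UNIV Y k =
      coset ?W ` {x \<in> localized_deg UNIV Y k. f.frac x - x \<in> ?W}"
  proof
    show "{C \<in> carrier (local_cohom y UNIV). \<forall>g\<in>G. cohom_act y g C = C} \<inter> coset ?W ` localized_deg UNIV Y k \<subseteq>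
      coset ?W ` {x \<in> localized_deg UNIV Y k. f.frac x - x \<in> ?W}"
    proof
      fix C assume C: "C \<in> {C \<in> carrier (local_cohom y UNIV). \<forall>g\<in>G. cohom_act y g C = C} \<inter>
          coset ?W ` localized_deg UNIV Y k"
      then obtain x where x: "x \<in> localized_deg UNIV Y k" "C = coset ?W x" by blast
      then have "f.frac x - x \<in> ?W"
        using C inv[of x] U.localized_deg_subset by blast
      then show "C \<in> coset ?W ` {x \<in> localized_deg UNIV Y k. f.frac x - x \<in> ?W}"
        using x by blast
    qed
    show "coset ?W ` {x \<in> localized_deg UNIV Y k. f.frac x - x \<in> ?W} \<subseteq>
      {C \<in> carrier (local_cohom y UNIV). \<forall>g\<in>G. cohom_act y g C = C} \<inter> coset ?W ` localized_deg UNIV Y k"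
    proof
      fix C assume "C \<in> coset ?W ` {x \<in> localized_deg UNIV Y k. f.frac x - x \<in> ?W}"
      then obtain x where x: "x \<in> localized_deg UNIV Y k" "C = coset ?W x" "f.frac x - x \<in> ?W" by blast
      then have "x \<in> localized UNIV Y"
        using U.localized_deg_subset by blast
      then show "C \<in> {C \<in> carrier (local_cohom y UNIV). \<forall>g\<in>G. cohom_act y g C = C} \<inter>
          coset ?W ` localized_deg UNIV Y k"
        using x inv[of x] unfolding carrier_local_cohom by blast
    qed
  qed
  then show ?thesis
    by (simp add: graded_part_def local_cohom_invariants_def cech_class_eq[abs_def])
qed

text \<open>The trace identifies the coinvariants of the cohomology of the polynomial ring with the
  cohomology of the invariants, and for a cyclic group acting on a finite-dimensional space
  invariants and coinvariants have the same dimension.\<close>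

lemma rank_graded_parts:
  assumes G: "G = (\<lambda>l. A [^]\<^bsub>GL\<^esub> (l::nat)) ` {..<N}"
    and rad: "\<And>p. p \<in> RG \<Longrightarrow> lookup p 0 = 0 \<Longrightarrow> \<exists>t. p ^ t \<in> gen_ideal y"
  shows "rank_over (graded_part y RG (local_cohom y RG) k) =
    rank_over (graded_part y UNIV (local_cohom_invariants G y) k)"
proof -
  define W where "W = cech_boundaries y UNIV"
  define W' where "W' = cech_boundaries y RG"
  define D where "D = localized_deg UNIV Y k"
  define D' where "D' = localized_deg RG Y k"
  define K where "K = {x \<in> D. f.frac x - x \<in> W}"
  define V where "V = (local_cohom y UNIV)\<lparr>carrier := coset W ` D\<rparr>"
  define V' where "V' = (local_cohom y RG)\<lparr>carrier := coset W' ` D'\<rparr>"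
  define VK where "VK = (local_cohom y UNIV)\<lparr>carrier := coset W ` K\<rparr>"
  have W: "fract_vs.subspace W" and W': "fract_vs.subspace W'" and D: "fract_vs.subspace D" and D': "fract_vs.subspace D'"
    by (simp_all only: W_def W'_def D_def D'_def U.subspace_bd I.subspace_bd U.subspace_localized_deg
        I.subspace_localized_deg)
  define g where "g x = f.frac x - x" for x
  have g_add: "g (x + z) = g x + g z" for x z
    by (simp add: g_def F.add)
  have g_scale: "g (emb (mconst c) * x) = emb (mconst c) * g x" for c x
    by (simp only: g_def F_const right_diff_distrib)
  have g_W: "g x \<in> W" if "x \<in> W" for x
    unfolding g_def using that F_boundary by (intro fract_vs.subspace_diff[OF W]) (auto simp: W_def)
  have g_D: "g x \<in> D" if "x \<in> D" for x
    unfolding g_def using that F_localized_deg by (intro fract_vs.subspace_diff[OF D]) (auto simp: D_def)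
  have K_eq: "K = {x \<in> D. g x \<in> W}" by (simp only: K_def g_def)
  have K: "fract_vs.subspace K"
  proof (rule fract_vs.subspaceI)
    have "g 0 = 0" using g_scale[of 0 0] by simp
    then show "0 \<in> K"
      using fract_vs.subspace_0[OF D] fract_vs.subspace_0[OF W] by (simp add: K_eq)
    show "x + z \<in> K" if "x \<in> K" "z \<in> K" for x z
      using that fract_vs.subspace_add[OF D] fract_vs.subspace_add[OF W] by (simp add: K_eq g_add)
    show "emb (mconst c) * x \<in> K" if "x \<in> K" for c x
      using that fract_vs.subspace_scale[OF D] fract_vs.subspace_scale[OF W] by (simp add: K_eq g_scale)
  qed
  have qV: "quotient_space V W D"
    unfolding V_def W_def by (rule local_cohom_quotient_space[OF U.subspace_bd D])
  have qV': "quotient_space V' W' D'"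
    unfolding V'_def W'_def by (rule local_cohom_quotient_space[OF I.subspace_bd D'])
  have qVK: "quotient_space VK W K"
    unfolding VK_def W_def by (rule local_cohom_quotient_space[OF U.subspace_bd K])
  interpret V: quotient_space V W D by (rule qV)
  interpret V': quotient_space V' W' D' by (rule qV')
  interpret VK: quotient_space VK W K by (rule qVK)
  obtain B where B: "finite B" "B \<subseteq> D" "\<And>x. x \<in> D \<Longrightarrow> \<exists>z\<in>fract_vs.span B. x - z \<in> W"
    using finite_spanning[OF rad, of k] unfolding D_def W_def by blast
  have fin_V: "vectorspace.fin_dim field_ring V"
    by (rule V.fin_dim[OF B])
  have fin_VK: "vectorspace.fin_dim field_ring VK"
  proof -
    \<comment> \<open>A representative in the span of \<open>B\<close> of an element of
      \<open>K\<close> differs from it by a boundary, so it lies in \<open>K\<close> as well; a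
      basis of this intersection is finite.\<close>
    define K0 where "K0 = K \<inter> fract_vs.span B"
    obtain B' where B': "B' \<subseteq> K0" "fract_vs.independent B'" "K0 \<subseteq> fract_vs.span B'"
      by (rule fract_vs.basis_exists[of K0])
    have "finite B'"
      using fract_vs.independent_span_bound[OF B(1) B'(2)] B'(1) by (auto simp: K0_def)
    moreover have "B' \<subseteq> K" using B'(1) by (auto simp: K0_def)
    moreover have "\<exists>z\<in>fract_vs.span B'. x - z \<in> W" if x: "x \<in> K" for x
    proof -
      obtain z where z: "z \<in> fract_vs.span B" "x - z \<in> W"
        using B(3)[of x] x by (auto simp: K_eq)
      have "z \<in> D"
        using fract_vs.span_minimal[OF B(2) D] z(1) by blast
      moreover have "g z = g x - g (x - z)"
        using g_add[of "x - z" z] by (simp add: algebra_simps)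
      then have "g z \<in> W"
        using fract_vs.subspace_diff[OF W _ g_W[OF z(2)], of "g x"] x by (simp add: K_eq)
      ultimately have "z \<in> K0"
        using z(1) by (simp add: K0_def K_eq)
      then show ?thesis using B'(3) z(2) by blast
    qed
    ultimately show ?thesis by (rule VK.fin_dim)
  qed
  define T where "T = (\<lambda>C. coset W (g (SOME x. x \<in> C)))"
  define T' where "T' = (\<lambda>C. coset W' (F.tr (SOME x. x \<in> C)))"
  have T: "T (coset W x) = coset W (g x)" for x
    unfolding T_def by (rule quotient_map(1)[OF qV qV g_add g_scale g_W g_D])
  have T_lin: "linear_map field_ring V V T"
    unfolding T_def by (rule quotient_map(2)[OF qV qV g_add g_scale g_W g_D])
  have tr_W: "F.tr x \<in> W'" if "x \<in> W" for x
    using that F_tr_boundary by (simp add: W_def W'_def)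
  have tr_D: "F.tr x \<in> D'" if "x \<in> D" for x
    using that F_tr_localized_deg by (simp add: D_def D'_def)
  have T': "T' (coset W x) = coset W' (F.tr x)" for x
    unfolding T'_def by (rule quotient_map(1)[OF qV qV' F.tr_add F_tr_const tr_W tr_D])
  have T'_lin: "linear_map field_ring V V' T'"
    unfolding T'_def by (rule quotient_map(2)[OF qV qV' F.tr_add F_tr_const tr_W tr_D])
  have T_zero: "T (coset W x) = \<zero>\<^bsub>V\<^esub> \<longleftrightarrow> g x \<in> W" for x
    by (simp add: V.zero_eq T coset_eq_iff[OF W])
  have ker_T: "{v \<in> carrier V. T v = \<zero>\<^bsub>V\<^esub>} = coset W ` K"
  proof (intro equalityI subsetI)
    fix C assume "C \<in> {v \<in> carrier V. T v = \<zero>\<^bsub>V\<^esub>}"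
    then obtain x where x: "x \<in> D" "C = coset W x" "T (coset W x) = \<zero>\<^bsub>V\<^esub>"
      unfolding V.carrier_eq by blast
    then have "x \<in> K"
      unfolding T_zero K_eq by blast
    then show "C \<in> coset W ` K" using x(2) by blast
  next
    fix C assume "C \<in> coset W ` K"
    then obtain x where x: "x \<in> D" "g x \<in> W" "C = coset W x"
      unfolding K_eq by blast
    then have "T C = \<zero>\<^bsub>V\<^esub>"
      unfolding x(3) T_zero by blast
    then show "C \<in> {v \<in> carrier V. T v = \<zero>\<^bsub>V\<^esub>}"
      using x(1,3) unfolding V.carrier_eq by blast
  qed
  have im_T': "T' ` carrier V = carrier V'"
  proof
    show "T' ` carrier V \<subseteq> carrier V'"
      using tr_D by (auto simp: V.carrier_eq V'.carrier_eq T')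
    show "carrier V' \<subseteq> T' ` carrier V"
    proof
      fix C assume "C \<in> carrier V'"
      then obtain x where x: "x \<in> D'" "C = coset W' x" by (auto simp: V'.carrier_eq)
      obtain u w where uw: "u \<in> D" "w \<in> W'" "x = F.tr u + w"
        using trace_surjective[of x k] x(1) unfolding D_def D'_def W'_def by blast
      then have "C = T' (coset W u)"
        unfolding x(2) T' coset_eq_iff[OF W'] by simp
      then show "C \<in> T' ` carrier V"
        using uw(1) by (auto simp: V.carrier_eq)
    qed
  qed
  have ker_T': "{v \<in> carrier V. T' v = \<zero>\<^bsub>V'\<^esub>} = T ` carrier V"
  proof
    show "{v \<in> carrier V. T' v = \<zero>\<^bsub>V'\<^esub>} \<subseteq> T ` carrier V"
    proof
      fix C assume C: "C \<in> {v \<in> carrier V. T' v = \<zero>\<^bsub>V'\<^esub>}"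
      then obtain u where u: "u \<in> D" "C = coset W u" by (auto simp: V.carrier_eq)
      then have "F.tr u \<in> W'"
        using C by (simp add: T' V'.zero_eq coset_eq_iff[OF W'])
      then obtain v w where vw: "v \<in> D" "w \<in> W" "u = g v + w"
        using trace_kernel[of u k] u(1) unfolding D_def W_def W'_def g_def by blast
      then have "C = T (coset W v)"
        unfolding u(2) T coset_eq_iff[OF W] by simp
      then show "C \<in> T ` carrier V"
        using vw(1) by (auto simp: V.carrier_eq)
    qed
    show "T ` carrier V \<subseteq> {v \<in> carrier V. T' v = \<zero>\<^bsub>V'\<^esub>}"
    proof
      fix C assume "C \<in> T ` carrier V"
      then obtain v where v: "v \<in> D" "C = coset W (g v)" by (auto simp: V.carrier_eq T)
      have "F.tr (f.frac v) = F.tr v"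
        using F.f_tr[of v] by (simp add: F.tr_def F.sum funpow_swap1)
      moreover have "F.tr (g v) + F.tr v = F.tr (f.frac v)"
        unfolding F.tr_add[symmetric] g_def by simp
      ultimately have "F.tr (g v) = 0" by simp
      then show "C \<in> {v \<in> carrier V. T' v = \<zero>\<^bsub>V'\<^esub>}"
        using g_D[OF v(1)] by (simp add: v(2) T' V.carrier_eq V'.zero_eq)
    qed
  qed
  \<comment> \<open>Rank-nullity for \<open>T'\<close> and for \<open>T\<close>, both starting at
    \<open>V\<close>: the kernel of \<open>T'\<close> is the image of \<open>T\<close>, so
    subtracting its dimension leaves \<open>V'\<close> on one side and the kernel of
    \<open>T\<close> on the other.\<close>
  have "vectorspace.dim field_ring V' = vectorspace.dim field_ring VK"
  proof -
    have "V'\<lparr>carrier := T' ` carrier V\<rparr> = V'"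
      unfolding im_T' by simp
    moreover have "V\<lparr>carrier := coset W ` K\<rparr> = VK"
      by (simp add: V_def VK_def)
    ultimately show ?thesis
      using linear_map_dims(1)[OF T'_lin fin_V] linear_map_dims(1)[OF T_lin fin_V]
      unfolding ker_T ker_T' by simp
  qed
  moreover have "vectorspace.fin_dim field_ring V'"
    by (rule linear_map_dims(2)[OF T'_lin fin_V im_T'])
  ultimately have "rank_over V' = rank_over VK"
    using fin_VK by (simp add: rank_over_def)
  moreover have "graded_part y RG (local_cohom y RG) k = V'"
    unfolding V'_def W'_def D'_def by (rule I.graded_part_local_cohom)
  moreover have "graded_part y UNIV (local_cohom_invariants G y) k = VK"
    unfolding VK_def W_def K_def D_def by (rule graded_part_invariants[OF G])
  ultimately show ?thesis by simp
qed

end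

text \<open>If some \<open>y i\<close> vanishes, then all localizations at the product degenerate (\<open>0\<^sup>0 = 1\<close> and
  \<open>x / 0 = 0\<close>) and both sides are zero.\<close>

lemma (in cech_subring) localized_subset_bd:
  assumes "cech_prod y = 0"
  shows "localized S (cech_prod y) \<subseteq> cech_boundaries y S"
proof
  fix x assume "x \<in> localized S (cech_prod y)"
  then obtain r d where r: "x = emb r / emb (cech_prod y) ^ d" "r \<in> S"
    unfolding localized_eq by blast
  define s where "s = (if d = 0 then r else 0)"
  have s: "x = emb s / emb (\<Prod>j\<in>UNIV - {i}. y j) ^ 0" "s \<in> S" for i
    using r S_0 by (auto simp: s_def assms)
  define i0 :: 'n where "i0 = undefined"
  define w where "w l = (if l = i0 then x else 0)" for l
  have zero: "0 \<in> localized S (\<Prod>j\<in>UNIV - {l}. y j)" for l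
    by (intro fract_vs.subspace_0 subspace_localized S_prod y_in)
  have "x \<in> localized S (\<Prod>j\<in>UNIV - {l}. y j)" for l
    unfolding localized_eq using s by blast
  then have "\<forall>l. w l \<in> localized S (\<Prod>j\<in>UNIV - {l}. y j)"
    using zero by (simp add: w_def)
  moreover have "x = (\<Sum>l\<in>UNIV. w l)"
    by (simp add: w_def)
  ultimately show "x \<in> cech_boundaries y S"
    unfolding cech_boundaries_def by blast
qed

lemma localized_deg_degenerate:
  assumes "cech_prod y = 0" "0 \<in> S"
  shows "localized_deg S (cech_prod y) k \<subseteq> localized S (cech_prod y)"
    and "localized_deg S (cech_prod y) k \<noteq> {}"
proof -
  show "localized_deg S (cech_prod y) k \<subseteq> localized S (cech_prod y)"
    unfolding localized_deg_def localized_def by blast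
  \<comment> \<open>The zero polynomial is homogeneous of every degree, so degrees of numerator and
    denominator can be chosen with difference \<open>k\<close>, whatever its sign.\<close>
  have "int (nat k) - int (1 * nat (- k)) = k" by simp
  then have "Fract 0 (cech_prod y ^ 1) \<in> localized_deg S (cech_prod y) k"
    unfolding localized_deg_def using assms
    by (intro CollectI exI[of _ 0] exI[of _ 1] exI[of _ "nat (- k)"] exI[of _ "nat k"]) simp
  then show "localized_deg S (cech_prod y) k \<noteq> {}" by blast
qed

lemma (in cech_subring) coset_image_bd:
  assumes "T \<subseteq> cech_boundaries y S" "T \<noteq> {}"
  shows "coset (cech_boundaries y S) ` T = coset (cech_boundaries y S) ` cech_boundaries y S"
proof -
  have "coset (cech_boundaries y S) x = coset (cech_boundaries y S) 0" if "x \<in> cech_boundaries y S" for x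
    using that by (simp add: coset_eq_iff[OF subspace_bd])
  then have image: "coset (cech_boundaries y S) ` T' = {coset (cech_boundaries y S) 0}"
    if "T' \<subseteq> cech_boundaries y S" "T' \<noteq> {}" for T'
    using that by blast
  have "cech_boundaries y S \<noteq> {}"
    using fract_vs.subspace_0[OF subspace_bd] by blast
  then show ?thesis
    unfolding image[OF assms] by (intro image[symmetric] subset_refl)
qed

text \<open>Stated for any record that differs from the cohomology only in its carrier, so that it
  covers the full cohomology and its invariants alike.\<close>

lemma (in cech_subring) rank_degenerate:
  assumes 0: "cech_prod y = 0" and N: "N = (local_cohom y S)\<lparr>carrier := carrier N\<rparr>"
    and bd: "coset (cech_boundaries y S) 0 \<in> carrier N"
  shows "rank_over (graded_part y S N k) = 0"
proof -
  let ?W = "cech_boundaries y S"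
  have "coset ?W ` localized_deg S (cech_prod y) k = coset ?W ` ?W"
    using localized_deg_degenerate[OF 0 S_0] localized_subset_bd[OF 0] by (intro coset_image_bd) auto
  moreover have W: "coset ?W ` ?W = {coset ?W 0}"
    using coset_image_bd[of "{0}"] fract_vs.subspace_0[OF subspace_bd] by simp
  ultimately have "carrier N \<inter> cech_class y S ` localized_deg S (cech_prod y) k = coset ?W ` ?W"
    using bd by (simp add: cech_class_eq[abs_def])
  then have "graded_part y S N k = (local_cohom y S)\<lparr>carrier := coset ?W ` ?W\<rparr>"
    unfolding graded_part_def by (subst N) simp
  then show ?thesis
    using rank_over_quotient_trivial[OF local_cohom_quotient_space[OF subspace_bd subspace_bd]] by simp
qed

section \<open>Reduction to a generator of the group and its exact order\<close>

theorem corollary5p1: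
  fixes G :: "('k::field ^ 'n::{finite,linorder} ^ 'n::{finite,linorder}) set"
    and y :: "'n \<Rightarrow> ('n, 'k) mpoly"
    and k :: int
  assumes "subgroup G GL"
    and "finite G"
    and "cyclic_group (GL\<lparr>carrier := G\<rparr>)"
    and "\<forall>g\<in>G. \<not> transvection g"
    and "hsop (invariants G) y"
  shows "rank_over (graded_part y (invariants G) (local_cohom y (invariants G)) k) =
         rank_over (graded_part y UNIV (local_cohom_invariants G y) k)"
proof -
  obtain A N where N: "N > 0" and G: "G = (\<lambda>i. A [^]\<^bsub>GL\<^esub> (i::nat)) ` {..<N}"
    and AN: "A [^]\<^bsub>GL\<^esub> N = mat 1" and minN: "\<forall>i. 0 < i \<and> i < N \<longrightarrow> A [^]\<^bsub>GL\<^esub> i \<noteq> mat 1"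
    using finite_cyclic_GL[OF assms(1-3)] by blast
  have A_pow1: "A [^]\<^bsub>GL\<^esub> (1::nat) = A"
    using matrix_mul_lid[of A] by (simp add: nat_pow_def)
  \<comment> \<open>In the trivial group only the exponent \<open>0\<close> is listed, so
    \<open>A\<close> has to be recognized as the identity.\<close>
  have "A \<in> G"
  proof (cases "N = 1")
    case True
    then have "A [^]\<^bsub>GL\<^esub> (0::nat) = A" using AN A_pow1 by simp
    then show ?thesis unfolding G using N by (intro image_eqI[of _ _ 0]) auto
  next
    case False
    then show ?thesis unfolding G using N A_pow1 by (intro image_eqI[of _ _ 1]) auto
  qed
  then have A: "invertible A"
    using subgroup.subset[OF assms(1)] by auto
  define RG where "RG = {p. lin_act A p = p}"
  have inv: "invariants G = RG"
  proof
    show "invariants G \<subseteq> RG"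
      using \<open>A \<in> G\<close> by (auto simp: invariants_def RG_def)
    have "(lin_act A ^^ i) p = p" if "p \<in> RG" for i p
      using that by (induction i) (simp_all add: RG_def)
    then show "RG \<subseteq> invariants G"
      by (auto simp: invariants_def G lin_act_pow)
  qed
  have y: "y i \<in> RG" and ex_e: "\<exists>d>0. homogeneous d (y i)" for i
    using assms(5) by (simp_all add: hsop_def inv)
  have rad: "\<exists>t. p ^ t \<in> gen_ideal y" if "p \<in> RG" "lookup p 0 = 0" for p
  proof -
    have "p \<in> hom_max_ideal RG" using that by (simp add: hom_max_ideal_def)
    then have "p \<in> {p \<in> RG. \<exists>t. p ^ t \<in> {\<Sum>i\<in>UNIV. a i * y i | a. \<forall>i. a i \<in> RG}}"
      using assms(5) unfolding hsop_def inv by simp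
    then show ?thesis unfolding gen_ideal_def by blast
  qed
  show ?thesis
  proof (cases "\<exists>i. y i = 0")
    case False
    have "\<forall>i. \<exists>d. d > 0 \<and> homogeneous d (y i)"
      using ex_e by blast
    from choice[OF this] obtain e where e: "\<forall>i. e i > 0 \<and> homogeneous (e i) (y i)" ..
    have yA: "lin_act A (y i) = y i" for i
      using y by (simp add: RG_def)
    interpret cyclic_cech y e A N
    proof
      show "(lin_act A ^^ N) p = p" for p
        by (simp add: AN lin_act_1 flip: lin_act_pow)
      show "\<exists>t c. t \<noteq> 0 \<and> (\<forall>m\<in>keys t. lookup m i = 0) \<and> poly_subst y t = (\<Sum>l<N. (lin_act A ^^ l) c)" for i
        using assms(4) by (intro variable_free_trace[OF N AN _ A _ yA]) (auto simp: G minN)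
    qed (use N e yA False in auto)
    show ?thesis
      unfolding inv RG_def using rad by (intro rank_graded_parts[OF G]) (simp add: RG_def)
  next
    case True
    then have 0: "cech_prod y = 0"
      by (auto simp: cech_prod_def intro: prod_zero)
    interpret I: cech_subring y RG
      by unfold_locales (use y in \<open>simp_all add: RG_def lin_act_add lin_act_times\<close>)
    interpret U: cech_subring y UNIV
      by unfold_locales simp_all
    let ?W = "cech_boundaries y UNIV"
    have mem: "coset (cech_boundaries y S) 0 \<in> carrier (local_cohom y S)" if "0 \<in> S" for S
      unfolding carrier_local_cohom localized_eq using that by (intro imageI) (force intro!: exI[of _ 0])
    have coset_bd: "coset ?W x = coset ?W 0" if "x \<in> ?W" for x
      using that by (simp add: coset_eq_iff[OF U.subspace_bd])
    have act: "cohom_act y g (coset ?W 0) = coset ?W 0" for g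
    proof -
      have "Fract (lin_act g r) (cech_prod y ^ d) \<in> ?W" for r d
        using U.localized_subset_bd[OF 0] unfolding localized_def by blast
      then have "cech_class y UNIV (Fract (lin_act g r) (cech_prod y ^ d)) = coset ?W 0" for r d
        by (simp add: cech_class_eq coset_bd)
      moreover have "Fract 0 (cech_prod y ^ 0) \<in> coset ?W 0"
        using fract_vs.subspace_0[OF U.subspace_bd] by (simp add: coset_iff Fract_emb)
      ultimately show ?thesis
        unfolding cohom_act_def by blast
    qed
    have "rank_over (graded_part y RG (local_cohom y RG) k) = 0"
      by (rule I.rank_degenerate[OF 0]) (use mem I.S_0 in auto)
    moreover have "rank_over (graded_part y UNIV (local_cohom_invariants G y) k) = 0"
      by (rule U.rank_degenerate[OF 0]) (use mem act in \<open>auto simp: local_cohom_invariants_def\<close>)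
    ultimately show ?thesis by (simp add: inv)
  qed
qed

end
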